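(* Let $(W,S)$ be a finite Coxeter group, $\Phi$ a $W$-gluing data for abelian categories $(\mathcal{C}_w)_{w\in W}$, $J\subset S$ a subset of simple reflections, $W_J\subset W$ the subgroup generated by $J$, and $\Phi_J$ the induced gluing data for the categories $(\mathcal{C}_w)_{w\in W_J}$. Assume that for every $s\in S$ and every $w\in W$ such that $w^{-1}sw\notin W_J$, the morphism $\nu_s:\Phi_s^2|_{\mathcal{C}_w}\to\mathrm{Id}_{\mathcal{C}_w}$ is an isomorphism. Then the glued category $\mathcal{C}(\Phi)$ is equivalent to $\mathcal{C}(\Phi_J)$.
   Context: A $W$-gluing data $\Phi$ consists of right-exact functors $\Phi_w:\mathcal{C}_{w'}\to\mathcal{C}_{ww'}$ for all $w,w'\in W$ (same symbol for all $w'$), with $\Phi_1=\mathrm{Id}$, and morphisms of functors $\nu_{w,w'}:\Phi_w\Phi_{w'}\to\Phi_{ww'}$ (on each $\mathcal{C}_{w''}$) with $\nu_{1,w}=\nu_{w,1}=\mathrm{id}$, satisfying associativity $\nu_{ww',w''}\circ(\nu_{w,w'}\Phi_{w''})=\nu_{w,w'w''}\circ(\Phi_w\nu_{w',w''})$, and such that $\nu_{w,w'}$ is an isomorphism whenever $\ell(ww')=\ell(w)+\ell(w')$ ($\ell$ the length function). Write $\nu_s=\nu_{s,s}$ for $s\in S$. For a subset $P\subset W$, the category glued from $(\mathcal{C}_w)_{w\in P}$ has as objects collections $(A_w,w\in P;\alpha_{w,w'})$ with $A_w\in\mathcal{C}_w$ and morphisms $\alpha_{w,w'}:\Phi_wA_{w'}\to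 A_{ww'}$ for $w',ww'\in P$, with $\alpha_{1,w'}=\mathrm{id}$ and $\alpha_{w_1,w_2w'}\circ\Phi_{w_1}(\alpha_{w_2,w'})=\alpha_{w_1w_2,w'}\circ\nu_{w_1,w_2}$; morphisms are componentwise and compatible with $\alpha$. $\mathcal{C}(\Phi)$ is the case $P=W$ and $\mathcal{C}(\Phi_J)$ the case $P=W_J$. *)

theory Defs
  imports "HOL-Algebra.Generated_Groups"
begin

section \<open>Categories\<close>

text \<open>Every arrow determines its source and target. Only elements of \<open>obj\<close> and
  \<open>arr\<close> matter; the operations are unconstrained elsewhere.\<close>

record ('o, 'm) category_data =
  obj :: "'o set"
  arr :: "'m set"
  src :: "'m \<Rightarrow> 'o"
  tgt :: "'m \<Rightarrow> 'o"
  ident :: "'o \<Rightarrow> 'm"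
  cmp :: "'m \<Rightarrow> 'm \<Rightarrow> 'm"  (infixl "\<cdot>\<index>" 70)

definition homset :: "('o, 'm, 'x) category_data_scheme \<Rightarrow> 'o \<Rightarrow> 'o \<Rightarrow> 'm set" where
  "homset C A B = {f \<in> arr C. src C f = A \<and> tgt C f = B}"

locale category =
  fixes C :: "('o, 'm, 'x) category_data_scheme" (structure)
  assumes src_closed: "f \<in> arr C \<Longrightarrow> src C f \<in> obj C"
    and tgt_closed: "f \<in> arr C \<Longrightarrow> tgt C f \<in> obj C"
    and ident_closed: "A \<in> obj C \<Longrightarrow> ident C A \<in> homset C A A"
    and cmp_closed: "\<lbrakk>f \<in> arr C; g \<in> arr C; tgt C f = src C g\<rbrakk>
      \<Longrightarrow> g \<cdot> f \<in> homset C (src C f) (tgt C g)"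
    and ident_left: "f \<in> arr C \<Longrightarrow> ident C (tgt C f) \<cdot> f = f"
    and ident_right: "f \<in> arr C \<Longrightarrow> f \<cdot> ident C (src C f) = f"
    and cmp_assoc: "\<lbrakk>f \<in> arr C; g \<in> arr C; h \<in> arr C; tgt C f = src C g; tgt C g = src C h\<rbrakk>
      \<Longrightarrow> (h \<cdot> g) \<cdot> f = h \<cdot> (g \<cdot> f)"

definition is_iso :: "('o, 'm, 'x) category_data_scheme \<Rightarrow> 'm \<Rightarrow> bool" where
  "is_iso C f \<longleftrightarrow> f \<in> arr C \<and>
     (\<exists>g \<in> homset C (tgt C f) (src C f).
        g \<cdot>\<^bsub>C\<^esub> f = ident C (src C f) \<and> f \<cdot>\<^bsub>C\<^esub> g = ident C (tgt C f))"

definition is_mono :: "('o, 'm, 'x) category_data_scheme \<Rightarrow> 'm \<Rightarrow> bool" where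
  "is_mono C f \<longleftrightarrow> f \<in> arr C \<and>
     (\<forall>g \<in> arr C. \<forall>h \<in> arr C.
        src C g = src C h \<longrightarrow> tgt C g = src C f \<longrightarrow> tgt C h = src C f \<longrightarrow>
        f \<cdot>\<^bsub>C\<^esub> g = f \<cdot>\<^bsub>C\<^esub> h \<longrightarrow> g = h)"

definition is_epi :: "('o, 'm, 'x) category_data_scheme \<Rightarrow> 'm \<Rightarrow> bool" where
  "is_epi C f \<longleftrightarrow> f \<in> arr C \<and>
     (\<forall>g \<in> arr C. \<forall>h \<in> arr C.
        tgt C g = tgt C h \<longrightarrow> src C g = tgt C f \<longrightarrow> src C h = tgt C f \<longrightarrow>
        g \<cdot>\<^bsub>C\<^esub> f = h \<cdot>\<^bsub>C\<^esub> f \<longrightarrow> g = h)"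


section \<open>Functors, natural transformations, equivalences\<close>

record ('o, 'm, 'p, 'n) functor_data =
  on_obj :: "'o \<Rightarrow> 'p"
  on_arr :: "'m \<Rightarrow> 'n"

definition id_functor :: "('o, 'm, 'o, 'm) functor_data" where
  "id_functor = \<lparr>on_obj = (\<lambda>A. A), on_arr = (\<lambda>f. f)\<rparr>"

definition comp_functor ::
  "('p, 'n, 'q, 'k) functor_data \<Rightarrow> ('o, 'm, 'p, 'n) functor_data \<Rightarrow> ('o, 'm, 'q, 'k) functor_data"
  (infixl "\<circ>\<^sub>F" 55) where
  "G \<circ>\<^sub>F F = \<lparr>on_obj = (\<lambda>A. on_obj G (on_obj F A)), on_arr = (\<lambda>f. on_arr G (on_arr F f))\<rparr>"

definition is_functor ::
  "('o, 'm, 'x) category_data_scheme \<Rightarrow> ('p, 'n, 'y) category_data_scheme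
   \<Rightarrow> ('o, 'm, 'p, 'n) functor_data \<Rightarrow> bool" where
  "is_functor C D F \<longleftrightarrow> category C \<and> category D \<and>
     (\<forall>A \<in> obj C. on_obj F A \<in> obj D \<and> on_arr F (ident C A) = ident D (on_obj F A)) \<and>
     (\<forall>f \<in> arr C. on_arr F f \<in> homset D (on_obj F (src C f)) (on_obj F (tgt C f))) \<and>
     (\<forall>f \<in> arr C. \<forall>g \<in> arr C. tgt C f = src C g \<longrightarrow>
        on_arr F (g \<cdot>\<^bsub>C\<^esub> f) = on_arr F g \<cdot>\<^bsub>D\<^esub> on_arr F f)"

definition natural_transformation ::
  "('o, 'm, 'x) category_data_scheme \<Rightarrow> ('p, 'n, 'y) category_data_scheme
   \<Rightarrow> ('o, 'm, 'p, 'n) functor_data \<Rightarrow> ('o, 'm, 'p, 'n) functor_data \<Rightarrow> ('o \<Rightarrow> 'n) \<Rightarrow> bool" where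
  "natural_transformation C D F G \<tau> \<longleftrightarrow> is_functor C D F \<and> is_functor C D G \<and>
     (\<forall>A \<in> obj C. \<tau> A \<in> homset D (on_obj F A) (on_obj G A)) \<and>
     (\<forall>f \<in> arr C. \<tau> (tgt C f) \<cdot>\<^bsub>D\<^esub> on_arr F f = on_arr G f \<cdot>\<^bsub>D\<^esub> \<tau> (src C f))"

definition natural_isomorphism ::
  "('o, 'm, 'x) category_data_scheme \<Rightarrow> ('p, 'n, 'y) category_data_scheme
   \<Rightarrow> ('o, 'm, 'p, 'n) functor_data \<Rightarrow> ('o, 'm, 'p, 'n) functor_data \<Rightarrow> ('o \<Rightarrow> 'n) \<Rightarrow> bool" where
  "natural_isomorphism C D F G \<tau> \<longleftrightarrow> natural_transformation C D F G \<tau> \<and>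
     (\<forall>A \<in> obj C. is_iso D (\<tau> A))"

definition equivalent_categories ::
  "('o, 'm, 'x) category_data_scheme \<Rightarrow> ('p, 'n, 'y) category_data_scheme \<Rightarrow> bool" where
  "equivalent_categories C D \<longleftrightarrow>
     (\<exists>(F :: ('o, 'm, 'p, 'n) functor_data) (G :: ('p, 'n, 'o, 'm) functor_data) \<eta> \<epsilon>.
        is_functor C D F \<and> is_functor D C G \<and>
        natural_isomorphism C C id_functor (G \<circ>\<^sub>F F) \<eta> \<and>
        natural_isomorphism D D (F \<circ>\<^sub>F G) id_functor \<epsilon>)"


section \<open>Abelian categories and right exact functors\<close>

record ('o, 'm) preadditive_data = "('o, 'm) category_data" +
  hadd :: "'m \<Rightarrow> 'm \<Rightarrow> 'm"  (infixl "\<boxplus>\<index>" 65)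
  hzero :: "'o \<Rightarrow> 'o \<Rightarrow> 'm"

locale preadditive_category = category C
  for C :: "('o, 'm, 'x) preadditive_data_scheme" (structure) +
  assumes hom_comm_group: "\<lbrakk>A \<in> obj C; B \<in> obj C\<rbrakk>
      \<Longrightarrow> comm_group \<lparr>carrier = homset C A B, mult = hadd C, one = hzero C A B\<rparr>"
    and cmp_add_right: "\<lbrakk>f \<in> homset C A B; f' \<in> homset C A B; g \<in> homset C B D\<rbrakk>
      \<Longrightarrow> g \<cdot> (f \<boxplus> f') = (g \<cdot> f) \<boxplus> (g \<cdot> f')"
    and cmp_add_left: "\<lbrakk>f \<in> homset C A B; g \<in> homset C B D; g' \<in> homset C B D\<rbrakk>
      \<Longrightarrow> (g \<boxplus> g') \<cdot> f = (g \<cdot> f) \<boxplus> (g' \<cdot> f)"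

definition is_zero_object :: "('o, 'm, 'x) category_data_scheme \<Rightarrow> 'o \<Rightarrow> bool" where
  "is_zero_object C Z \<longleftrightarrow> Z \<in> obj C \<and>
     (\<forall>A \<in> obj C. (\<exists>!f. f \<in> homset C A Z) \<and> (\<exists>!f. f \<in> homset C Z A))"

definition is_biproduct :: "('o, 'm, 'x) preadditive_data_scheme
  \<Rightarrow> 'o \<Rightarrow> 'o \<Rightarrow> 'o \<Rightarrow> 'm \<Rightarrow> 'm \<Rightarrow> 'm \<Rightarrow> 'm \<Rightarrow> bool" where
  "is_biproduct C A B P i j p q \<longleftrightarrow> P \<in> obj C \<and>
     i \<in> homset C A P \<and> j \<in> homset C B P \<and> p \<in> homset C P A \<and> q \<in> homset C P B \<and>
     p \<cdot>\<^bsub>C\<^esub> i = ident C A \<and> q \<cdot>\<^bsub>C\<^esub> j = ident C B \<and>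
     q \<cdot>\<^bsub>C\<^esub> i = hzero C A B \<and> p \<cdot>\<^bsub>C\<^esub> j = hzero C B A \<and>
     (i \<cdot>\<^bsub>C\<^esub> p) \<boxplus>\<^bsub>C\<^esub> (j \<cdot>\<^bsub>C\<^esub> q) = ident C P"

definition is_kernel :: "('o, 'm, 'x) preadditive_data_scheme \<Rightarrow> 'm \<Rightarrow> 'm \<Rightarrow> bool" where
  "is_kernel C f k \<longleftrightarrow> f \<in> arr C \<and> k \<in> arr C \<and> tgt C k = src C f \<and>
     f \<cdot>\<^bsub>C\<^esub> k = hzero C (src C k) (tgt C f) \<and>
     (\<forall>h \<in> arr C. tgt C h = src C f \<longrightarrow> f \<cdot>\<^bsub>C\<^esub> h = hzero C (src C h) (tgt C f) \<longrightarrow>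
        (\<exists>!u. u \<in> homset C (src C h) (src C k) \<and> k \<cdot>\<^bsub>C\<^esub> u = h))"

definition is_cokernel :: "('o, 'm, 'x) preadditive_data_scheme \<Rightarrow> 'm \<Rightarrow> 'm \<Rightarrow> bool" where
  "is_cokernel C f c \<longleftrightarrow> f \<in> arr C \<and> c \<in> arr C \<and> src C c = tgt C f \<and>
     c \<cdot>\<^bsub>C\<^esub> f = hzero C (src C f) (tgt C c) \<and>
     (\<forall>h \<in> arr C. src C h = tgt C f \<longrightarrow> h \<cdot>\<^bsub>C\<^esub> f = hzero C (src C f) (tgt C h) \<longrightarrow>
        (\<exists>!u. u \<in> homset C (tgt C c) (tgt C h) \<and> u \<cdot>\<^bsub>C\<^esub> c = h))"

locale abelian_category = preadditive_category +
  assumes ex_zero_object: "\<exists>Z. is_zero_object C Z"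
    and ex_biproduct: "\<lbrakk>A \<in> obj C; B \<in> obj C\<rbrakk> \<Longrightarrow> \<exists>P i j p q. is_biproduct C A B P i j p q"
    and ex_kernel: "f \<in> arr C \<Longrightarrow> \<exists>k. is_kernel C f k"
    and ex_cokernel: "f \<in> arr C \<Longrightarrow> \<exists>c. is_cokernel C f c"
    and mono_normal: "is_mono C f \<Longrightarrow> \<exists>g. is_kernel C g f"
    and epi_normal: "is_epi C f \<Longrightarrow> \<exists>g. is_cokernel C g f"

text \<open>Exactness of \<open>A \<rightarrow> B \<rightarrow> D\<close> at \<open>B\<close>: the image of \<open>f\<close>, i.e. the kernel of its
  cokernel, is the kernel of \<open>g\<close>.\<close>

definition exact_pair :: "('o, 'm, 'x) preadditive_data_scheme \<Rightarrow> 'm \<Rightarrow> 'm \<Rightarrow> bool" where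
  "exact_pair C f g \<longleftrightarrow> f \<in> arr C \<and> g \<in> arr C \<and> tgt C f = src C g \<and>
     (\<exists>c k. is_cokernel C f c \<and> is_kernel C c k \<and> is_kernel C g k)"

definition additive_functor ::
  "('o, 'm, 'x) preadditive_data_scheme \<Rightarrow> ('p, 'n, 'y) preadditive_data_scheme
   \<Rightarrow> ('o, 'm, 'p, 'n) functor_data \<Rightarrow> bool" where
  "additive_functor C D F \<longleftrightarrow> is_functor C D F \<and>
     (\<forall>f \<in> arr C. \<forall>g \<in> arr C. src C f = src C g \<longrightarrow> tgt C f = tgt C g \<longrightarrow>
        on_arr F (f \<boxplus>\<^bsub>C\<^esub> g) = on_arr F f \<boxplus>\<^bsub>D\<^esub> on_arr F g)"

text \<open>Exactness of \<open>A \<rightarrow> B \<rightarrow> D \<rightarrow> 0\<close> at \<open>D\<close> is the statement that \<open>g\<close> is an epimorphism.\<close>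

definition right_exact_functor ::
  "('o, 'm, 'x) preadditive_data_scheme \<Rightarrow> ('p, 'n, 'y) preadditive_data_scheme
   \<Rightarrow> ('o, 'm, 'p, 'n) functor_data \<Rightarrow> bool" where
  "right_exact_functor C D F \<longleftrightarrow> additive_functor C D F \<and>
     (\<forall>f g. exact_pair C f g \<and> is_epi C g \<longrightarrow>
        exact_pair D (on_arr F f) (on_arr F g) \<and> is_epi D (on_arr F g))"


section \<open>Coxeter systems\<close>

text \<open>The presentation \<open>\<langle>S | (s t)\<^sup>m\<^sup>(\<^sup>s\<^sup>,\<^sup>t\<^sup>) = 1\<rangle>\<close> is expressed by positive words: since
  \<open>m s s = 1\<close>, the relators include \<open>s s\<close>, so every generator is its own inverse and the
  monoid with this presentation is the group with this presentation. The value
  \<open>m s t = 0\<close> encodes infinity; it yields the empty relator.\<close>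

definition coxeter_matrix :: "'w set \<Rightarrow> ('w \<Rightarrow> 'w \<Rightarrow> nat) \<Rightarrow> bool" where
  "coxeter_matrix S m \<longleftrightarrow>
     (\<forall>s \<in> S. m s s = 1) \<and>
     (\<forall>s \<in> S. \<forall>t \<in> S. m s t = m t s \<and> (s \<noteq> t \<longrightarrow> m s t = 0 \<or> 2 \<le> m s t))"

definition coxeter_relators :: "'w set \<Rightarrow> ('w \<Rightarrow> 'w \<Rightarrow> nat) \<Rightarrow> 'w list set" where
  "coxeter_relators S m = {concat (replicate (m s t) [s, t]) | s t. s \<in> S \<and> t \<in> S}"

inductive word_equiv :: "'w set \<Rightarrow> 'w list set \<Rightarrow> 'w list \<Rightarrow> 'w list \<Rightarrow> bool" for S R where
  relator: "\<lbrakk>xs \<in> lists S; ys \<in> lists S; r \<in> R\<rbrakk> \<Longrightarrow> word_equiv S R (xs @ r @ ys) (xs @ ys)"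
| refl: "xs \<in> lists S \<Longrightarrow> word_equiv S R xs xs"
| sym: "word_equiv S R xs ys \<Longrightarrow> word_equiv S R ys xs"
| trans: "\<lbrakk>word_equiv S R xs ys; word_equiv S R ys zs\<rbrakk> \<Longrightarrow> word_equiv S R xs zs"

definition word_prod :: "('w, 'b) monoid_scheme \<Rightarrow> 'w list \<Rightarrow> 'w" where
  "word_prod W xs = foldr (mult W) xs \<one>\<^bsub>W\<^esub>"

definition word_length :: "('w, 'b) monoid_scheme \<Rightarrow> 'w set \<Rightarrow> 'w \<Rightarrow> nat" where
  "word_length W S w = (LEAST n. \<exists>xs \<in> lists S. length xs = n \<and> word_prod W xs = w)"

locale coxeter_system = group W
  for W :: "('w, 'b) monoid_scheme" (structure) +
  fixes S :: "'w set"
  assumes S_subset: "S \<subseteq> carrier W"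
    and S_generates: "generate W S = carrier W"
    and presentation: "\<exists>m. coxeter_matrix S m \<and>
      (\<forall>xs \<in> lists S. \<forall>ys \<in> lists S.
         word_prod W xs = word_prod W ys \<longleftrightarrow> word_equiv S (coxeter_relators S m) xs ys)"


section \<open>Gluing data and glued categories\<close>

text \<open>\<open>\<Phi> w w'\<close> is the functor \<open>\<Phi>\<^sub>w : C\<^sub>w\<^sub>' \<rightarrow> C\<^sub>w\<^sub>w\<^sub>'\<close>, and \<open>\<nu> w w' v A\<close> is the component at
  \<open>A \<in> C\<^sub>v\<close> of \<open>\<nu>\<^sub>w\<^sub>,\<^sub>w\<^sub>' : \<Phi>\<^sub>w \<Phi>\<^sub>w\<^sub>' \<rightarrow> \<Phi>\<^sub>w\<^sub>w\<^sub>'\<close>.\<close>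

locale gluing_data = coxeter_system W S
  for W :: "('w, 'b) monoid_scheme" (structure) and S +
  fixes C :: "'w \<Rightarrow> ('o, 'm, 'x) preadditive_data_scheme"
    and \<Phi> :: "'w \<Rightarrow> 'w \<Rightarrow> ('o, 'm, 'o, 'm) functor_data"
    and \<nu> :: "'w \<Rightarrow> 'w \<Rightarrow> 'w \<Rightarrow> 'o \<Rightarrow> 'm"
  assumes abelian: "w \<in> carrier W \<Longrightarrow> abelian_category (C w)"
    and right_exact: "\<lbrakk>w \<in> carrier W; w' \<in> carrier W\<rbrakk>
      \<Longrightarrow> right_exact_functor (C w') (C (w \<otimes> w')) (\<Phi> w w')"
    and \<Phi>_one_obj: "\<lbrakk>w \<in> carrier W; A \<in> obj (C w)\<rbrakk> \<Longrightarrow> on_obj (\<Phi> \<one> w) A = A"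
    and \<Phi>_one_arr: "\<lbrakk>w \<in> carrier W; f \<in> arr (C w)\<rbrakk> \<Longrightarrow> on_arr (\<Phi> \<one> w) f = f"
    and \<nu>_natural: "\<lbrakk>w \<in> carrier W; w' \<in> carrier W; v \<in> carrier W\<rbrakk>
      \<Longrightarrow> natural_transformation (C v) (C (w \<otimes> w' \<otimes> v))
            (\<Phi> w (w' \<otimes> v) \<circ>\<^sub>F \<Phi> w' v) (\<Phi> (w \<otimes> w') v) (\<nu> w w' v)"
    and \<nu>_one_left: "\<lbrakk>w \<in> carrier W; v \<in> carrier W; A \<in> obj (C v)\<rbrakk>
      \<Longrightarrow> \<nu> \<one> w v A = ident (C (w \<otimes> v)) (on_obj (\<Phi> w v) A)"
    and \<nu>_one_right: "\<lbrakk>w \<in> carrier W; v \<in> carrier W; A \<in> obj (C v)\<rbrakk>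
      \<Longrightarrow> \<nu> w \<one> v A = ident (C (w \<otimes> v)) (on_obj (\<Phi> w v) A)"
    and \<nu>_assoc:
      "\<lbrakk>w \<in> carrier W; w' \<in> carrier W; w'' \<in> carrier W; v \<in> carrier W; A \<in> obj (C v)\<rbrakk>
       \<Longrightarrow> \<nu> (w \<otimes> w') w'' v A
             \<cdot>\<^bsub>C (w \<otimes> w' \<otimes> w'' \<otimes> v)\<^esub> \<nu> w w' (w'' \<otimes> v) (on_obj (\<Phi> w'' v) A)
           = \<nu> w (w' \<otimes> w'') v A
             \<cdot>\<^bsub>C (w \<otimes> w' \<otimes> w'' \<otimes> v)\<^esub> on_arr (\<Phi> w (w' \<otimes> w'' \<otimes> v)) (\<nu> w' w'' v A)"
    and \<nu>_iso: "\<lbrakk>w \<in> carrier W; w' \<in> carrier W; v \<in> carrier W;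
        word_length W S (w \<otimes> w') = word_length W S w + word_length W S w'\<rbrakk>
      \<Longrightarrow> natural_isomorphism (C v) (C (w \<otimes> w' \<otimes> v))
            (\<Phi> w (w' \<otimes> v) \<circ>\<^sub>F \<Phi> w' v) (\<Phi> (w \<otimes> w') v) (\<nu> w w' v)"

text \<open>An object of the category glued over \<open>P\<close> is a pair \<open>(A, \<alpha>)\<close> with
  \<open>\<alpha> (w, w') : \<Phi>\<^sub>w A\<^sub>w\<^sub>' \<rightarrow> A\<^sub>w\<^sub>w\<^sub>'\<close>; families are extensional (\<open>undefined\<close> outside their index
  set), so that equality of families is equality of HOL functions. An arrow carries its
  source and target.\<close>

type_synonym ('w, 'o, 'm) glued_object = "('w \<Rightarrow> 'o) \<times> ('w \<times> 'w \<Rightarrow> 'm)"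
type_synonym ('w, 'o, 'm) glued_arrow =
  "('w, 'o, 'm) glued_object \<times> ('w, 'o, 'm) glued_object \<times> ('w \<Rightarrow> 'm)"

definition glue_index :: "('w, 'b) monoid_scheme \<Rightarrow> 'w set \<Rightarrow> ('w \<times> 'w) set" where
  "glue_index W P = {(w, w'). w \<in> carrier W \<and> w' \<in> P \<and> w \<otimes>\<^bsub>W\<^esub> w' \<in> P}"

definition glued_objects ::
  "('w, 'b) monoid_scheme \<Rightarrow> ('w \<Rightarrow> ('o, 'm, 'x) preadditive_data_scheme)
   \<Rightarrow> ('w \<Rightarrow> 'w \<Rightarrow> ('o, 'm, 'o, 'm) functor_data) \<Rightarrow> ('w \<Rightarrow> 'w \<Rightarrow> 'w \<Rightarrow> 'o \<Rightarrow> 'm)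
   \<Rightarrow> 'w set \<Rightarrow> ('w, 'o, 'm) glued_object set" where
  "glued_objects W C \<Phi> \<nu> P =
     {(A, \<alpha>). A \<in> (\<Pi>\<^sub>E w\<in>P. obj (C w)) \<and>
        \<alpha> \<in> (\<Pi>\<^sub>E (w, w')\<in>glue_index W P.
               homset (C (w \<otimes>\<^bsub>W\<^esub> w')) (on_obj (\<Phi> w w') (A w')) (A (w \<otimes>\<^bsub>W\<^esub> w'))) \<and>
        (\<forall>w'\<in>P. \<alpha> (\<one>\<^bsub>W\<^esub>, w') = ident (C w') (A w')) \<and>
        (\<forall>w1\<in>carrier W. \<forall>w2\<in>carrier W. \<forall>w'\<in>P.
           w2 \<otimes>\<^bsub>W\<^esub> w' \<in> P \<longrightarrow> w1 \<otimes>\<^bsub>W\<^esub> w2 \<otimes>\<^bsub>W\<^esub> w' \<in> P \<longrightarrow>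
           \<alpha> (w1, w2 \<otimes>\<^bsub>W\<^esub> w')
             \<cdot>\<^bsub>C (w1 \<otimes>\<^bsub>W\<^esub> w2 \<otimes>\<^bsub>W\<^esub> w')\<^esub> on_arr (\<Phi> w1 (w2 \<otimes>\<^bsub>W\<^esub> w')) (\<alpha> (w2, w'))
           = \<alpha> (w1 \<otimes>\<^bsub>W\<^esub> w2, w')
             \<cdot>\<^bsub>C (w1 \<otimes>\<^bsub>W\<^esub> w2 \<otimes>\<^bsub>W\<^esub> w')\<^esub> \<nu> w1 w2 w' (A w'))}"

definition glued_arrows ::
  "('w, 'b) monoid_scheme \<Rightarrow> ('w \<Rightarrow> ('o, 'm, 'x) preadditive_data_scheme)
   \<Rightarrow> ('w \<Rightarrow> 'w \<Rightarrow> ('o, 'm, 'o, 'm) functor_data) \<Rightarrow> ('w \<Rightarrow> 'w \<Rightarrow> 'w \<Rightarrow> 'o \<Rightarrow> 'm)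
   \<Rightarrow> 'w set \<Rightarrow> ('w, 'o, 'm) glued_arrow set" where
  "glued_arrows W C \<Phi> \<nu> P =
     {((A, \<alpha>), (B, \<beta>), f).
        (A, \<alpha>) \<in> glued_objects W C \<Phi> \<nu> P \<and> (B, \<beta>) \<in> glued_objects W C \<Phi> \<nu> P \<and>
        f \<in> (\<Pi>\<^sub>E w\<in>P. homset (C w) (A w) (B w)) \<and>
        (\<forall>(w, w')\<in>glue_index W P.
           \<beta> (w, w') \<cdot>\<^bsub>C (w \<otimes>\<^bsub>W\<^esub> w')\<^esub> on_arr (\<Phi> w w') (f w')
           = f (w \<otimes>\<^bsub>W\<^esub> w') \<cdot>\<^bsub>C (w \<otimes>\<^bsub>W\<^esub> w')\<^esub> \<alpha> (w, w'))}"

definition glued_category ::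
  "('w, 'b) monoid_scheme \<Rightarrow> ('w \<Rightarrow> ('o, 'm, 'x) preadditive_data_scheme)
   \<Rightarrow> ('w \<Rightarrow> 'w \<Rightarrow> ('o, 'm, 'o, 'm) functor_data) \<Rightarrow> ('w \<Rightarrow> 'w \<Rightarrow> 'w \<Rightarrow> 'o \<Rightarrow> 'm)
   \<Rightarrow> 'w set \<Rightarrow> (('w, 'o, 'm) glued_object, ('w, 'o, 'm) glued_arrow) category_data" where
  "glued_category W C \<Phi> \<nu> P =
     \<lparr>obj = glued_objects W C \<Phi> \<nu> P,
      arr = glued_arrows W C \<Phi> \<nu> P,
      src = (\<lambda>(X, Y, f). X),
      tgt = (\<lambda>(X, Y, f). Y),
      ident = (\<lambda>X. (X, X, \<lambda>w\<in>P. ident (C w) (fst X w))),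
      cmp = (\<lambda>(Y, Z, g) (X, Y', f). (X, Z, \<lambda>w\<in>P. g w \<cdot>\<^bsub>C w\<^esub> f w))\<rparr>"

end

theory Submission
  imports Defs
begin

text \<open>Let \<open>H = W\<^sub>J\<close>. The restriction functor from \<open>\<C>(\<Phi>)\<close> to \<open>\<C>(\<Phi>\<^sub>J)\<close> forgets the components outside
  \<open>H\<close>, and the point is that they are determined by those in \<open>H\<close>. Let \<open>n\<close> be the element of minimal
  length of a coset \<open>n H\<close>. If \<open>n = s n'\<close> splits off the first letter of a reduced expression, then \<open>n'\<close> is minimal
  in its own coset, and that coset differs from \<open>n H\<close>; so for \<open>u \<in> H\<close> the element \<open>w = n' u\<close> has
  \<open>w\<^sup>-\<^sup>1 s w \<notin> H\<close> and \<open>\<nu>\<^sub>s\<close> is invertible on \<open>\<C>\<^sub>w\<close> and on \<open>\<C>\<^sub>s\<^sub>w\<close>. In a glued object the two composites of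
  \<open>\<alpha>\<^sub>s\<^sub>,\<^sub>w\<close> and \<open>\<alpha>\<^sub>s\<^sub>,\<^sub>s\<^sub>w\<close>, with \<open>\<Phi>\<^sub>s\<close> applied to the inner map, are \<open>\<nu>\<^sub>s\<close>, which forces \<open>\<alpha>\<^sub>s\<^sub>,\<^sub>w\<close> to be an
  isomorphism (\<open>generator_map_iso\<close>). Walking
  along the reduced expression, \<open>\<alpha>\<^sub>n\<^sub>,\<^sub>u : \<Phi>\<^sub>n A\<^sub>u \<rightarrow> A\<^sub>n\<^sub>u\<close> is an isomorphism (\<open>minimal_map_iso\<close>).

  Conversely, an object \<open>(A, \<alpha>)\<close> over \<open>H\<close> is extended by \<open>A\<^sub>n\<^sub>u = \<Phi>\<^sub>n A\<^sub>u\<close>. If \<open>w n = m v\<close> with \<open>m\<close> minimal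
  and \<open>v \<in> H\<close>, the gluing map \<open>\<Phi>\<^sub>w \<Phi>\<^sub>n A\<^sub>u \<rightarrow> \<Phi>\<^sub>m A\<^sub>v\<^sub>u\<close> is
  \<open>\<Phi>\<^sub>m(\<alpha>\<^sub>v\<^sub>,\<^sub>u) \<circ> \<nu>\<^sub>m\<^sub>,\<^sub>v\<^sup>-\<^sup>1 \<circ> \<nu>\<^sub>w\<^sub>,\<^sub>n\<close>. The inverse exists because lengths add in the product \<open>m v\<close>
  (\<open>len_mult_minimal\<close>), and the associativity of the new maps is the cocycle property
  \<open>transition_cocycle\<close> of \<open>\<nu>\<^sub>m\<^sub>,\<^sub>v\<^sup>-\<^sup>1 \<circ> \<nu>\<^sub>w\<^sub>,\<^sub>n\<close>, a consequence of the associativity of \<open>\<nu>\<close>.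
  Extending and then restricting gives back the same object, while the maps \<open>\<alpha>\<^sub>n\<^sub>,\<^sub>u\<close> form a natural
  isomorphism from the extension of the restriction to the original object.

  The additivity of lengths rests on the exchange condition, derived from the presentation by
  counting modulo 2 how often a reflection occurs along a word.\<close>

section \<open>Isomorphisms, functors and natural isomorphisms\<close>

context category
begin

lemma homset_objD: "f \<in> homset C A B \<Longrightarrow> A \<in> obj C \<and> B \<in> obj C"
  using src_closed tgt_closed by (auto simp: homset_def)

lemma comp_in_homset:
  "\<lbrakk>f \<in> homset C A B; g \<in> homset C B D\<rbrakk> \<Longrightarrow> g \<cdot> f \<in> homset C A D"
  using cmp_closed[of f g] by (simp add: homset_def)

lemma comp_assoc:
  "\<lbrakk>f \<in> homset C A B; g \<in> homset C B D; h \<in> homset C D E\<rbrakk> \<Longrightarrow> (h \<cdot> g) \<cdot> f = h \<cdot> (g \<cdot> f)"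
  using cmp_assoc[of f g h] by (simp add: homset_def)

lemma ident_comp: "f \<in> homset C A B \<Longrightarrow> ident C B \<cdot> f = f"
  using ident_left by (auto simp: homset_def)

lemma comp_ident: "f \<in> homset C A B \<Longrightarrow> f \<cdot> ident C A = f"
  using ident_right by (auto simp: homset_def)

lemma isoI:
  assumes "f \<in> homset C A B" "g \<in> homset C B A" "g \<cdot> f = ident C A" "f \<cdot> g = ident C B"
  shows "is_iso C f"
  using assms by (auto simp: is_iso_def homset_def)

lemma isoE:
  assumes "is_iso C f" "f \<in> homset C A B"
  obtains g where "g \<in> homset C B A" "g \<cdot> f = ident C A" "f \<cdot> g = ident C B"
  using assms by (auto simp: is_iso_def homset_def)

lemma iso_ident: "A \<in> obj C \<Longrightarrow> is_iso C (ident C A)"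
  using isoI ident_closed ident_comp by blast

lemma ex1_lift_along_iso:
  assumes "is_iso C f" "f \<in> homset C B D" "k \<in> homset C A D"
  shows "\<exists>!g. g \<in> homset C A B \<and> f \<cdot> g = k"
proof -
  obtain f' where f': "f' \<in> homset C D B" "f' \<cdot> f = ident C B" "f \<cdot> f' = ident C D"
    using isoE assms by blast
  show ?thesis
  proof (rule ex1I[of _ "f' \<cdot> k"])
    show "f' \<cdot> k \<in> homset C A B \<and> f \<cdot> (f' \<cdot> k) = k"
      using comp_assoc[OF assms(3) f'(1) assms(2)] f' assms comp_in_homset ident_comp by metis
    show "g = f' \<cdot> k" if "g \<in> homset C A B \<and> f \<cdot> g = k" for g
      using comp_assoc[OF _ assms(2) f'(1)] f' that ident_comp by metis
  qed
qed

lemma iso_comp: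
  assumes f: "is_iso C f" "f \<in> homset C A B" and g: "is_iso C g" "g \<in> homset C B D"
  shows "is_iso C (g \<cdot> f)"
proof -
  obtain f' where f': "f' \<in> homset C B A" "f' \<cdot> f = ident C A" "f \<cdot> f' = ident C B"
    using isoE f by blast
  obtain g' where g': "g' \<in> homset C D B" "g' \<cdot> g = ident C B" "g \<cdot> g' = ident C D"
    using isoE g by blast
  note gf = comp_in_homset[OF f(2) g(2)] and f'g' = comp_in_homset[OF g'(1) f'(1)]
  show ?thesis using gf f'g'
  proof (rule isoI)
    show "(f' \<cdot> g') \<cdot> (g \<cdot> f) = ident C A"
      using comp_assoc[OF gf g'(1) f'(1)] comp_assoc[OF f(2) g(2) g'(1)] f' g' ident_comp[OF f(2)] by simp
    show "(g \<cdot> f) \<cdot> (f' \<cdot> g') = ident C D"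
      using comp_assoc[OF f'g' f(2) g(2)] comp_assoc[OF g'(1) f'(1) f(2)] f' g' ident_comp[OF g'(1)] by simp
  qed
qed

text \<open>Here \<open>f\<close> has a left inverse and a right inverse, which must then agree.\<close>

lemma iso_if_comp_iso_both_sides:
  assumes f: "f \<in> homset C A B" and g: "g \<in> homset C B D" and h: "h \<in> homset C E A"
    and gf: "is_iso C (g \<cdot> f)" and fh: "is_iso C (f \<cdot> h)"
  shows "is_iso C f"
proof -
  obtain a where a: "a \<in> homset C D A" "a \<cdot> (g \<cdot> f) = ident C A"
    using isoE[OF gf comp_in_homset[OF f g]] by blast
  obtain b where b: "b \<in> homset C B E" "(f \<cdot> h) \<cdot> b = ident C B"
    using isoE[OF fh comp_in_homset[OF h f]] by blast
  have l: "(a \<cdot> g) \<cdot> f = ident C A" using a comp_assoc[OF f g a(1)] by simp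
  have r: "f \<cdot> (h \<cdot> b) = ident C B" using b comp_assoc[OF b(1) h f] by simp
  have ag: "a \<cdot> g \<in> homset C B A" and hb: "h \<cdot> b \<in> homset C B A"
    using comp_in_homset g a(1) b(1) h by blast+
  have "a \<cdot> g = h \<cdot> b"
    using comp_assoc[OF hb f ag] l r ident_comp[OF hb] comp_ident[OF ag] by simp
  then show ?thesis using isoI[OF f ag] l r by simp
qed

lemma iso_left_factor:
  assumes f: "is_iso C f" "f \<in> homset C A B" and g: "g \<in> homset C B D" and gf: "is_iso C (g \<cdot> f)"
  shows "is_iso C g"
proof -
  obtain f' where f': "f' \<in> homset C B A" "f' \<cdot> f = ident C A" "f \<cdot> f' = ident C B"
    using isoE f by blast
  have "is_iso C f'" using isoI[OF f'(1) f(2)] f' by simp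
  then have "is_iso C ((g \<cdot> f) \<cdot> f')" using iso_comp f'(1) gf comp_in_homset[OF f(2) g] by blast
  then show ?thesis using comp_assoc[OF f'(1) f(2) g] f'(3) comp_ident[OF g] by simp
qed

end

lemma functor_preserves_homset:
  "\<lbrakk>is_functor C D F; f \<in> homset C A B\<rbrakk> \<Longrightarrow> on_arr F f \<in> homset D (on_obj F A) (on_obj F B)"
  by (auto simp: is_functor_def homset_def)

lemma functor_preserves_comp:
  "\<lbrakk>is_functor C D F; f \<in> homset C A B; g \<in> homset C B E\<rbrakk>
   \<Longrightarrow> on_arr F (g \<cdot>\<^bsub>C\<^esub> f) = on_arr F g \<cdot>\<^bsub>D\<^esub> on_arr F f"
  by (auto simp: is_functor_def homset_def)

lemma functor_preserves_iso:
  assumes F: "is_functor C D F" and f: "is_iso C f"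
  shows "is_iso D (on_arr F f)"
proof -
  interpret C: category C using F by (simp add: is_functor_def)
  interpret D: category D using F by (simp add: is_functor_def)
  have h: "f \<in> homset C (src C f) (tgt C f)" using f by (simp add: is_iso_def homset_def)
  obtain g where g: "g \<in> homset C (tgt C f) (src C f)"
      "g \<cdot>\<^bsub>C\<^esub> f = ident C (src C f)" "f \<cdot>\<^bsub>C\<^esub> g = ident C (tgt C f)"
    using C.isoE[OF f h] by blast
  have F_ident: "on_arr F (ident C A) = ident D (on_obj F A)" if "A \<in> obj C" for A
    using F that by (simp add: is_functor_def)
  show ?thesis
    using functor_preserves_homset[OF F h] functor_preserves_homset[OF F g(1)]
  proof (rule D.isoI)
    show "on_arr F g \<cdot>\<^bsub>D\<^esub> on_arr F f = ident D (on_obj F (src C f))"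
      using functor_preserves_comp[OF F h g(1)] g(2) F_ident C.homset_objD[OF h] by simp
    show "on_arr F f \<cdot>\<^bsub>D\<^esub> on_arr F g = ident D (on_obj F (tgt C f))"
      using functor_preserves_comp[OF F g(1) h] g(3) F_ident C.homset_objD[OF h] by simp
  qed
qed

lemma comp_is_functor:
  "\<lbrakk>is_functor C D F; is_functor D E G\<rbrakk> \<Longrightarrow> is_functor C E (G \<circ>\<^sub>F F)"
  by (auto simp: is_functor_def comp_functor_def homset_def)

lemma id_is_functor: "category C \<Longrightarrow> is_functor C C id_functor"
  by (auto simp: is_functor_def id_functor_def homset_def category.src_closed category.tgt_closed)

text \<open>Naturality passes to the pointwise inverses: a naturality square for \<open>\<tau>\<close> can be
  composed with an inverse of \<open>\<tau>\<close> on each side.\<close>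

lemma natural_isomorphism_inverse:
  assumes "natural_isomorphism C D F G \<tau>"
  shows "\<exists>\<sigma>. natural_isomorphism C D G F \<sigma>"
proof -
  have F: "is_functor C D F" and G: "is_functor C D G"
    and \<tau>_hom: "A \<in> obj C \<Longrightarrow> \<tau> A \<in> homset D (on_obj F A) (on_obj G A)"
    and nat: "f \<in> arr C \<Longrightarrow> \<tau> (tgt C f) \<cdot>\<^bsub>D\<^esub> on_arr F f = on_arr G f \<cdot>\<^bsub>D\<^esub> \<tau> (src C f)"
    and \<tau>_iso: "A \<in> obj C \<Longrightarrow> is_iso D (\<tau> A)" for A f
    using assms by (auto simp: natural_isomorphism_def natural_transformation_def)
  interpret C: category C using F by (simp add: is_functor_def)
  interpret D: category D using F by (simp add: is_functor_def)
  have "\<forall>A. \<exists>g. A \<in> obj C \<longrightarrow> g \<in> homset D (on_obj G A) (on_obj F A) \<and>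
      g \<cdot>\<^bsub>D\<^esub> \<tau> A = ident D (on_obj F A) \<and> \<tau> A \<cdot>\<^bsub>D\<^esub> g = ident D (on_obj G A)"
    using D.isoE[OF \<tau>_iso \<tau>_hom] by metis
  then obtain \<sigma> where \<sigma>: "A \<in> obj C \<Longrightarrow> \<sigma> A \<in> homset D (on_obj G A) (on_obj F A)"
      "A \<in> obj C \<Longrightarrow> \<sigma> A \<cdot>\<^bsub>D\<^esub> \<tau> A = ident D (on_obj F A)"
      "A \<in> obj C \<Longrightarrow> \<tau> A \<cdot>\<^bsub>D\<^esub> \<sigma> A = ident D (on_obj G A)" for A
    by metis
  have \<sigma>_nat: "\<sigma> (tgt C f) \<cdot>\<^bsub>D\<^esub> on_arr G f = on_arr F f \<cdot>\<^bsub>D\<^esub> \<sigma> (src C f)" if f: "f \<in> arr C" for f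
  proof -
    let ?A = "src C f" and ?B = "tgt C f"
    have A: "?A \<in> obj C" and B: "?B \<in> obj C" using f C.src_closed C.tgt_closed by auto
    have fh: "f \<in> homset C ?A ?B" using f by (simp add: homset_def)
    note Ff = functor_preserves_homset[OF F fh] and Gf = functor_preserves_homset[OF G fh]
    have "on_arr F f \<cdot>\<^bsub>D\<^esub> \<sigma> ?A = (\<sigma> ?B \<cdot>\<^bsub>D\<^esub> \<tau> ?B) \<cdot>\<^bsub>D\<^esub> (on_arr F f \<cdot>\<^bsub>D\<^esub> \<sigma> ?A)"
      using D.ident_comp[OF D.comp_in_homset[OF \<sigma>(1)[OF A] Ff]] \<sigma>(2)[OF B] by simp
    also have "\<dots> = \<sigma> ?B \<cdot>\<^bsub>D\<^esub> ((\<tau> ?B \<cdot>\<^bsub>D\<^esub> on_arr F f) \<cdot>\<^bsub>D\<^esub> \<sigma> ?A)"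
      using D.comp_assoc[OF \<sigma>(1)[OF A] Ff \<tau>_hom[OF B]]
        D.comp_assoc[OF D.comp_in_homset[OF \<sigma>(1)[OF A] Ff] \<tau>_hom[OF B] \<sigma>(1)[OF B]] by simp
    also have "\<dots> = \<sigma> ?B \<cdot>\<^bsub>D\<^esub> (on_arr G f \<cdot>\<^bsub>D\<^esub> (\<tau> ?A \<cdot>\<^bsub>D\<^esub> \<sigma> ?A))"
      using nat[OF f] D.comp_assoc[OF \<sigma>(1)[OF A] \<tau>_hom[OF A] Gf] by simp
    also have "\<dots> = \<sigma> ?B \<cdot>\<^bsub>D\<^esub> on_arr G f"
      using \<sigma>(3)[OF A] D.comp_ident[OF Gf] by simp
    finally show ?thesis by simp
  qed
  have "is_iso D (\<sigma> A)" if "A \<in> obj C" for A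
    using D.isoI[OF \<sigma>(1)[OF that] \<tau>_hom[OF that]] \<sigma> that by simp
  then show ?thesis
    using F G \<sigma>(1) \<sigma>_nat
    by (auto simp: natural_isomorphism_def natural_transformation_def intro!: exI[of _ \<sigma>])
qed

section \<open>Glued categories\<close>

context gluing_data
begin

lemma category_at: "w \<in> carrier W \<Longrightarrow> category (C w)"
  using abelian unfolding abelian_category_def preadditive_category_def by blast

text \<open>The indices of the categories are products in the group that occur in several bracketings.
  The rules below therefore take each product as a variable constrained by an equation, so that
  they apply to any expression for it.\<close>

lemma \<Phi>_functor:
  "\<lbrakk>w \<in> carrier W; v \<in> carrier W; w \<otimes> v = x\<rbrakk> \<Longrightarrow> is_functor (C v) (C x) (\<Phi> w v)"
  using right_exact unfolding right_exact_functor_def additive_functor_def by blast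

lemma \<Phi>_obj:
  "\<lbrakk>A \<in> obj (C v); w \<in> carrier W; v \<in> carrier W; w \<otimes> v = x\<rbrakk> \<Longrightarrow> on_obj (\<Phi> w v) A \<in> obj (C x)"
  using \<Phi>_functor unfolding is_functor_def by blast

lemma \<Phi>_ident:
  "\<lbrakk>A \<in> obj (C v); w \<in> carrier W; v \<in> carrier W; w \<otimes> v = x\<rbrakk>
   \<Longrightarrow> on_arr (\<Phi> w v) (ident (C v) A) = ident (C x) (on_obj (\<Phi> w v) A)"
  using \<Phi>_functor unfolding is_functor_def by blast

lemma \<Phi>_hom:
  "\<lbrakk>f \<in> homset (C v) A B; w \<in> carrier W; v \<in> carrier W; w \<otimes> v = x\<rbrakk>
   \<Longrightarrow> on_arr (\<Phi> w v) f \<in> homset (C x) (on_obj (\<Phi> w v) A) (on_obj (\<Phi> w v) B)"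
  by (rule functor_preserves_homset[OF \<Phi>_functor])

lemma \<Phi>_comp:
  "\<lbrakk>f \<in> homset (C v) A B; g \<in> homset (C v) B D; w \<in> carrier W; v \<in> carrier W; w \<otimes> v = x\<rbrakk>
   \<Longrightarrow> on_arr (\<Phi> w v) (g \<cdot>\<^bsub>C v\<^esub> f) = on_arr (\<Phi> w v) g \<cdot>\<^bsub>C x\<^esub> on_arr (\<Phi> w v) f"
  by (rule functor_preserves_comp[OF \<Phi>_functor])

lemma \<Phi>_iso:
  "\<lbrakk>is_iso (C v) f; w \<in> carrier W; v \<in> carrier W; w \<otimes> v = x\<rbrakk> \<Longrightarrow> is_iso (C x) (on_arr (\<Phi> w v) f)"
  by (rule functor_preserves_iso[OF \<Phi>_functor])

lemma \<nu>_hom: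
  assumes "A \<in> obj (C v)" "w \<in> carrier W" "w' \<in> carrier W" "v \<in> carrier W"
    "w' \<otimes> v = y" "w \<otimes> y = x" "w \<otimes> w' = z"
  shows "\<nu> w w' v A \<in> homset (C x) (on_obj (\<Phi> w y) (on_obj (\<Phi> w' v) A)) (on_obj (\<Phi> z v) A)"
proof -
  have "w \<otimes> w' \<otimes> v = x" using assms m_assoc[of w w' v] by simp
  then show ?thesis
    using \<nu>_natural[of w w' v] assms
    by (simp add: natural_transformation_def comp_functor_def)
qed

lemma \<nu>_naturality:
  assumes "f \<in> homset (C v) A B" "w \<in> carrier W" "w' \<in> carrier W" "v \<in> carrier W"
    "w' \<otimes> v = y" "w \<otimes> y = x" "w \<otimes> w' = z"
  shows "\<nu> w w' v B \<cdot>\<^bsub>C x\<^esub> on_arr (\<Phi> w y) (on_arr (\<Phi> w' v) f)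
         = on_arr (\<Phi> z v) f \<cdot>\<^bsub>C x\<^esub> \<nu> w w' v A"
proof -
  have "w \<otimes> w' \<otimes> v = x" using assms m_assoc[of w w' v] by simp
  then show ?thesis
    using \<nu>_natural[of w w' v] assms
    by (auto simp: natural_transformation_def comp_functor_def homset_def)
qed

lemma \<nu>_associativity:
  assumes A: "A \<in> obj (C v)"
    and "w \<in> carrier W" "w' \<in> carrier W" "w'' \<in> carrier W" "v \<in> carrier W"
    and "w'' \<otimes> v = y" "w' \<otimes> y = x" "w \<otimes> x = z" "w \<otimes> w' = a" "w' \<otimes> w'' = b"
  shows "\<nu> a w'' v A \<cdot>\<^bsub>C z\<^esub> \<nu> w w' y (on_obj (\<Phi> w'' v) A)
         = \<nu> w b v A \<cdot>\<^bsub>C z\<^esub> on_arr (\<Phi> w x) (\<nu> w' w'' v A)"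
proof -
  have "w \<otimes> w' \<otimes> w'' \<otimes> v = z" "w' \<otimes> w'' \<otimes> v = x"
    using assms m_assoc[of w' w'' v] m_assoc[of w w' "w'' \<otimes> v"] m_assoc[of "w \<otimes> w'" w'' v] by auto
  then show ?thesis using \<nu>_assoc[of w w' w'' v A] assms by simp
qed

lemma glued_objectD:
  assumes "(A, \<alpha>) \<in> glued_objects W C \<Phi> \<nu> P"
  shows glued_object_obj: "w \<in> P \<Longrightarrow> A w \<in> obj (C w)"
    and glued_object_hom: "\<lbrakk>w \<in> carrier W; v \<in> P; w \<otimes> v = x; x \<in> P\<rbrakk>
      \<Longrightarrow> \<alpha> (w, v) \<in> homset (C x) (on_obj (\<Phi> w v) (A v)) (A x)"
    and glued_object_one: "v \<in> P \<Longrightarrow> \<alpha> (\<one>, v) = ident (C v) (A v)"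
proof -
  show "w \<in> P \<Longrightarrow> A w \<in> obj (C w)" "v \<in> P \<Longrightarrow> \<alpha> (\<one>, v) = ident (C v) (A v)"
    using assms by (auto simp: glued_objects_def)
  have \<alpha>: "\<alpha> \<in> (\<Pi>\<^sub>E (w, w')\<in>glue_index W P.
               homset (C (w \<otimes> w')) (on_obj (\<Phi> w w') (A w')) (A (w \<otimes> w')))"
    using assms by (auto simp: glued_objects_def)
  show "\<alpha> (w, v) \<in> homset (C x) (on_obj (\<Phi> w v) (A v)) (A x)"
    if "w \<in> carrier W" "v \<in> P" "w \<otimes> v = x" "x \<in> P"
    using PiE_mem[OF \<alpha>, of "(w, v)"] that by (simp add: glue_index_def)
qed

lemma glued_object_assoc:
  assumes "(A, \<alpha>) \<in> glued_objects W C \<Phi> \<nu> P" and P: "P \<subseteq> carrier W"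
    and w: "w1 \<in> carrier W" "w2 \<in> carrier W" "v \<in> P" "w2 \<otimes> v = y" "y \<in> P" "w1 \<otimes> y = x" "x \<in> P"
      "w1 \<otimes> w2 = z"
  shows "\<alpha> (w1, y) \<cdot>\<^bsub>C x\<^esub> on_arr (\<Phi> w1 y) (\<alpha> (w2, v)) = \<alpha> (z, v) \<cdot>\<^bsub>C x\<^esub> \<nu> w1 w2 v (A v)"
proof -
  have "w1 \<otimes> w2 \<otimes> v = x" using w P m_assoc[of w1 w2 v] by auto
  moreover have "\<forall>w1\<in>carrier W. \<forall>w2\<in>carrier W. \<forall>w'\<in>P.
           w2 \<otimes>\<^bsub>W\<^esub> w' \<in> P \<longrightarrow> w1 \<otimes>\<^bsub>W\<^esub> w2 \<otimes>\<^bsub>W\<^esub> w' \<in> P \<longrightarrow>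
           \<alpha> (w1, w2 \<otimes>\<^bsub>W\<^esub> w')
             \<cdot>\<^bsub>C (w1 \<otimes>\<^bsub>W\<^esub> w2 \<otimes>\<^bsub>W\<^esub> w')\<^esub> on_arr (\<Phi> w1 (w2 \<otimes>\<^bsub>W\<^esub> w')) (\<alpha> (w2, w'))
           = \<alpha> (w1 \<otimes>\<^bsub>W\<^esub> w2, w')
             \<cdot>\<^bsub>C (w1 \<otimes>\<^bsub>W\<^esub> w2 \<otimes>\<^bsub>W\<^esub> w')\<^esub> \<nu> w1 w2 w' (A w')"
    using assms(1) unfolding glued_objects_def by blast
  ultimately show ?thesis using w by metis
qed

lemma glued_objectI:
  assumes P: "P \<subseteq> carrier W"
    and "A \<in> extensional P" "\<alpha> \<in> extensional (glue_index W P)"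
    and "\<And>w. w \<in> P \<Longrightarrow> A w \<in> obj (C w)"
    and "\<And>w v x. \<lbrakk>w \<in> carrier W; v \<in> P; w \<otimes> v = x; x \<in> P\<rbrakk>
      \<Longrightarrow> \<alpha> (w, v) \<in> homset (C x) (on_obj (\<Phi> w v) (A v)) (A x)"
    and "\<And>v. v \<in> P \<Longrightarrow> \<alpha> (\<one>, v) = ident (C v) (A v)"
    and assoc: "\<And>w1 w2 v y x. \<lbrakk>w1 \<in> carrier W; w2 \<in> carrier W; v \<in> P; w2 \<otimes> v = y; y \<in> P; w1 \<otimes> y = x; x \<in> P\<rbrakk>
      \<Longrightarrow> \<alpha> (w1, y) \<cdot>\<^bsub>C x\<^esub> on_arr (\<Phi> w1 y) (\<alpha> (w2, v)) = \<alpha> (w1 \<otimes> w2, v) \<cdot>\<^bsub>C x\<^esub> \<nu> w1 w2 v (A v)"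
  shows "(A, \<alpha>) \<in> glued_objects W C \<Phi> \<nu> P"
proof -
  have "\<alpha> (w1, w2 \<otimes> v) \<cdot>\<^bsub>C (w1 \<otimes> w2 \<otimes> v)\<^esub> on_arr (\<Phi> w1 (w2 \<otimes> v)) (\<alpha> (w2, v))
      = \<alpha> (w1 \<otimes> w2, v) \<cdot>\<^bsub>C (w1 \<otimes> w2 \<otimes> v)\<^esub> \<nu> w1 w2 v (A v)"
    if h: "w1 \<in> carrier W" "w2 \<in> carrier W" "v \<in> P" "w2 \<otimes> v \<in> P" "w1 \<otimes> w2 \<otimes> v \<in> P" for w1 w2 v
    using assoc[OF h(1-3) HOL.refl h(4) _ h(5)] m_assoc[of w1 w2 v] h P by auto
  then show ?thesis
    using assms(2-6) unfolding glued_objects_def by (auto simp: PiE_def glue_index_def)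
qed

lemma glued_arrowI:
  assumes "(A, \<alpha>) \<in> glued_objects W C \<Phi> \<nu> P" "(B, \<beta>) \<in> glued_objects W C \<Phi> \<nu> P"
    and "f \<in> extensional P" "\<And>w. w \<in> P \<Longrightarrow> f w \<in> homset (C w) (A w) (B w)"
    and "\<And>w v x. \<lbrakk>w \<in> carrier W; v \<in> P; w \<otimes> v = x; x \<in> P\<rbrakk> \<Longrightarrow>
           \<beta> (w, v) \<cdot>\<^bsub>C x\<^esub> on_arr (\<Phi> w v) (f v) = f x \<cdot>\<^bsub>C x\<^esub> \<alpha> (w, v)"
  shows "((A, \<alpha>), (B, \<beta>), f) \<in> glued_arrows W C \<Phi> \<nu> P"
  using assms by (auto simp: glued_arrows_def glue_index_def PiE_def)

lemma glued_arrowD: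
  assumes "((A, \<alpha>), (B, \<beta>), f) \<in> glued_arrows W C \<Phi> \<nu> P"
  shows glued_arrow_src: "(A, \<alpha>) \<in> glued_objects W C \<Phi> \<nu> P"
    and glued_arrow_tgt: "(B, \<beta>) \<in> glued_objects W C \<Phi> \<nu> P"
    and glued_arrow_ext: "f \<in> extensional P"
    and glued_arrow_hom: "w \<in> P \<Longrightarrow> f w \<in> homset (C w) (A w) (B w)"
    and glued_arrow_comm: "\<lbrakk>w \<in> carrier W; v \<in> P; w \<otimes> v = x; x \<in> P\<rbrakk> \<Longrightarrow>
           \<beta> (w, v) \<cdot>\<^bsub>C x\<^esub> on_arr (\<Phi> w v) (f v) = f x \<cdot>\<^bsub>C x\<^esub> \<alpha> (w, v)"
  using assms by (auto simp: glued_arrows_def glue_index_def PiE_def)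

lemma glued_category_simps [simp]:
  "obj (glued_category W C \<Phi> \<nu> P) = glued_objects W C \<Phi> \<nu> P"
  "arr (glued_category W C \<Phi> \<nu> P) = glued_arrows W C \<Phi> \<nu> P"
  "src (glued_category W C \<Phi> \<nu> P) (X, Y, f) = X"
  "tgt (glued_category W C \<Phi> \<nu> P) (X, Y, f) = Y"
  "ident (glued_category W C \<Phi> \<nu> P) X = (X, X, \<lambda>w\<in>P. ident (C w) (fst X w))"
  "(Y', Z, g) \<cdot>\<^bsub>glued_category W C \<Phi> \<nu> P\<^esub> (X, Y, f) = (X, Z, \<lambda>w\<in>P. g w \<cdot>\<^bsub>C w\<^esub> f w)"
  by (simp_all add: glued_category_def)

lemma homset_glued_iff:
  "h \<in> homset (glued_category W C \<Phi> \<nu> P) X Y \<longleftrightarrow>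
   (\<exists>f. h = (X, Y, f) \<and> (X, Y, f) \<in> glued_arrows W C \<Phi> \<nu> P)"
  by (cases h) (auto simp: homset_def)

lemma glued_ident:
  assumes P: "P \<subseteq> carrier W" and X: "(A, \<alpha>) \<in> glued_objects W C \<Phi> \<nu> P"
  shows "((A, \<alpha>), (A, \<alpha>), \<lambda>w\<in>P. ident (C w) (A w)) \<in> glued_arrows W C \<Phi> \<nu> P"
proof (rule glued_arrowI[OF X X])
  show "(\<lambda>w\<in>P. ident (C w) (A w)) w \<in> homset (C w) (A w) (A w)" if "w \<in> P" for w
    using that P glued_object_obj[OF X] category.ident_closed[OF category_at] by auto
next
  fix w v x assume h: "w \<in> carrier W" "v \<in> P" "w \<otimes> v = x" "x \<in> P"
  then have c: "v \<in> carrier W" "x \<in> carrier W" using P by auto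
  interpret D: category "C x" using category_at c by simp
  have \<alpha>: "\<alpha> (w, v) \<in> homset (C x) (on_obj (\<Phi> w v) (A v)) (A x)" using glued_object_hom[OF X] h by blast
  show "\<alpha> (w, v) \<cdot>\<^bsub>C x\<^esub> on_arr (\<Phi> w v) ((\<lambda>w\<in>P. ident (C w) (A w)) v) =
       (\<lambda>w\<in>P. ident (C w) (A w)) x \<cdot>\<^bsub>C x\<^esub> \<alpha> (w, v)"
    using \<Phi>_ident[OF glued_object_obj[OF X h(2)] h(1) c(1) h(3)] h D.ident_comp[OF \<alpha>] D.comp_ident[OF \<alpha>]
    by simp
qed simp

lemma glued_comp:
  assumes P: "P \<subseteq> carrier W" and f: "((A, \<alpha>), (B, \<beta>), f) \<in> glued_arrows W C \<Phi> \<nu> P"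
    and g: "((B, \<beta>), (D, \<delta>), g) \<in> glued_arrows W C \<Phi> \<nu> P"
  shows "((A, \<alpha>), (D, \<delta>), \<lambda>w\<in>P. g w \<cdot>\<^bsub>C w\<^esub> f w) \<in> glued_arrows W C \<Phi> \<nu> P"
proof (rule glued_arrowI[OF glued_arrow_src[OF f] glued_arrow_tgt[OF g]])
  show "(\<lambda>w\<in>P. g w \<cdot>\<^bsub>C w\<^esub> f w) w \<in> homset (C w) (A w) (D w)" if "w \<in> P" for w
    using that P category.comp_in_homset[OF category_at glued_arrow_hom[OF f] glued_arrow_hom[OF g]]
    by auto
next
  fix w v x assume h: "w \<in> carrier W" "v \<in> P" "w \<otimes> v = x" "x \<in> P"
  then have c: "v \<in> carrier W" "x \<in> carrier W" using P by auto
  interpret D: category "C x" using category_at c by simp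
  note fv = glued_arrow_hom[OF f h(2)] and gv = glued_arrow_hom[OF g h(2)]
  note fx = glued_arrow_hom[OF f h(4)] and gx = glued_arrow_hom[OF g h(4)]
  note \<alpha> = glued_object_hom[OF glued_arrow_src[OF f] h]
  note \<beta> = glued_object_hom[OF glued_arrow_tgt[OF f] h]
  note \<delta> = glued_object_hom[OF glued_arrow_tgt[OF g] h]
  note \<Phi>f = \<Phi>_hom[OF fv h(1) c(1) h(3)] and \<Phi>g = \<Phi>_hom[OF gv h(1) c(1) h(3)]
  have "\<delta> (w, v) \<cdot>\<^bsub>C x\<^esub> on_arr (\<Phi> w v) (g v \<cdot>\<^bsub>C v\<^esub> f v)
      = (g x \<cdot>\<^bsub>C x\<^esub> \<beta> (w, v)) \<cdot>\<^bsub>C x\<^esub> on_arr (\<Phi> w v) (f v)"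
    using \<Phi>_comp[OF fv gv h(1) c(1) h(3)] D.comp_assoc[OF \<Phi>f \<Phi>g \<delta>] glued_arrow_comm[OF g h] by simp
  also have "\<dots> = (g x \<cdot>\<^bsub>C x\<^esub> f x) \<cdot>\<^bsub>C x\<^esub> \<alpha> (w, v)"
    using D.comp_assoc[OF \<Phi>f \<beta> gx] glued_arrow_comm[OF f h] D.comp_assoc[OF \<alpha> fx gx] by simp
  finally show "\<delta> (w, v) \<cdot>\<^bsub>C x\<^esub> on_arr (\<Phi> w v) ((\<lambda>w\<in>P. g w \<cdot>\<^bsub>C w\<^esub> f w) v) =
       (\<lambda>w\<in>P. g w \<cdot>\<^bsub>C w\<^esub> f w) x \<cdot>\<^bsub>C x\<^esub> \<alpha> (w, v)"
    using h by simp
qed simp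

lemma extensional_arrow_eqI:
  assumes "f \<in> extensional P" "\<And>w. w \<in> P \<Longrightarrow> g w = f w"
  shows "(\<lambda>w\<in>P. g w) = f"
  using assms by (auto simp: extensional_def fun_eq_iff)

lemma glued_category_is_category:
  assumes P: "P \<subseteq> carrier W"
  shows "category (glued_category W C \<Phi> \<nu> P)" (is "category ?G")
proof (unfold_locales, goal_cases)
  case (1 f) then show ?case by (auto simp: glued_arrows_def)
next
  case (2 f) then show ?case by (auto simp: glued_arrows_def)
next
  case (3 A) then show ?case using glued_ident[OF P] by (cases A) (simp add: homset_glued_iff)
next
  case (4 f g)
  obtain A \<alpha> B \<beta> f' where f: "f = ((A, \<alpha>), (B, \<beta>), f')" by (metis prod.exhaust)
  obtain X D \<delta> g' where "g = (X, (D, \<delta>), g')" by (metis prod.exhaust)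
  then have g: "g = ((B, \<beta>), (D, \<delta>), g')" using 4 f by simp
  have "((A, \<alpha>), (B, \<beta>), f') \<in> glued_arrows W C \<Phi> \<nu> P"
    and "((B, \<beta>), (D, \<delta>), g') \<in> glued_arrows W C \<Phi> \<nu> P"
    using 4(1-2) f g by simp_all
  from glued_comp[OF P this] show ?case using f g by (simp add: homset_glued_iff)
next
  case (5 f)
  obtain A \<alpha> B \<beta> f' where f: "f = ((A, \<alpha>), (B, \<beta>), f')" by (metis prod.exhaust)
  then have f': "((A, \<alpha>), (B, \<beta>), f') \<in> glued_arrows W C \<Phi> \<nu> P" using 5 by simp
  have "(\<lambda>w\<in>P. (\<lambda>w\<in>P. ident (C w) (B w)) w \<cdot>\<^bsub>C w\<^esub> f' w) = f'"
    using P category.ident_comp[OF category_at glued_arrow_hom[OF f']]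
    by (intro extensional_arrow_eqI[OF glued_arrow_ext[OF f']]) auto
  then show ?case using f by simp
next
  case (6 f)
  obtain A \<alpha> B \<beta> f' where f: "f = ((A, \<alpha>), (B, \<beta>), f')" by (metis prod.exhaust)
  then have f': "((A, \<alpha>), (B, \<beta>), f') \<in> glued_arrows W C \<Phi> \<nu> P" using 6 by simp
  have "(\<lambda>w\<in>P. f' w \<cdot>\<^bsub>C w\<^esub> (\<lambda>w\<in>P. ident (C w) (A w)) w) = f'"
    using P category.comp_ident[OF category_at glued_arrow_hom[OF f']]
    by (intro extensional_arrow_eqI[OF glued_arrow_ext[OF f']]) auto
  then show ?case using f by simp
next
  case (7 f g h)
  obtain A \<alpha> B \<beta> f' where f: "f = ((A, \<alpha>), (B, \<beta>), f')" by (metis prod.exhaust)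
  obtain X D \<delta> g' where "g = (X, (D, \<delta>), g')" by (metis prod.exhaust)
  then have g: "g = ((B, \<beta>), (D, \<delta>), g')" using 7 f by simp
  obtain Y E \<epsilon> h' where "h = (Y, (E, \<epsilon>), h')" by (metis prod.exhaust)
  then have h: "h = ((D, \<delta>), (E, \<epsilon>), h')" using 7 g by simp
  have "(h' w \<cdot>\<^bsub>C w\<^esub> g' w) \<cdot>\<^bsub>C w\<^esub> f' w = h' w \<cdot>\<^bsub>C w\<^esub> (g' w \<cdot>\<^bsub>C w\<^esub> f' w)" if "w \<in> P" for w
  proof -
    have "((A, \<alpha>), (B, \<beta>), f') \<in> glued_arrows W C \<Phi> \<nu> P"
      and "((B, \<beta>), (D, \<delta>), g') \<in> glued_arrows W C \<Phi> \<nu> P"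
      and "((D, \<delta>), (E, \<epsilon>), h') \<in> glued_arrows W C \<Phi> \<nu> P"
      using 7(1-3) f g h by simp_all
    note hom = this[THEN glued_arrow_hom, OF that]
    show ?thesis
      using category.comp_assoc[OF category_at hom] that P by blast
  qed
  then show ?case using f g h by (simp cong: restrict_cong)
qed

text \<open>The componentwise inverse of a morphism of glued objects is again compatible with the
  gluing maps.\<close>

lemma glued_iso:
  assumes P: "P \<subseteq> carrier W" and f: "((A, \<alpha>), (B, \<beta>), f) \<in> glued_arrows W C \<Phi> \<nu> P"
    and iso: "\<And>w. w \<in> P \<Longrightarrow> is_iso (C w) (f w)"
  shows "is_iso (glued_category W C \<Phi> \<nu> P) ((A, \<alpha>), (B, \<beta>), f)"
proof -
  interpret G: category "glued_category W C \<Phi> \<nu> P" by (rule glued_category_is_category[OF P])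
  note f_hom = glued_arrow_hom[OF f]
  have "\<forall>w. \<exists>g. w \<in> P \<longrightarrow> g \<in> homset (C w) (B w) (A w) \<and>
      g \<cdot>\<^bsub>C w\<^esub> f w = ident (C w) (A w) \<and> f w \<cdot>\<^bsub>C w\<^esub> g = ident (C w) (B w)"
    using category.isoE[OF category_at iso f_hom] P by (metis subsetD)
  then obtain g0 where g0: "w \<in> P \<Longrightarrow> g0 w \<in> homset (C w) (B w) (A w) \<and>
      g0 w \<cdot>\<^bsub>C w\<^esub> f w = ident (C w) (A w) \<and> f w \<cdot>\<^bsub>C w\<^esub> g0 w = ident (C w) (B w)" for w
    by metis
  define g where "g = restrict g0 P"
  have g: "g w \<in> homset (C w) (B w) (A w)" "g w \<cdot>\<^bsub>C w\<^esub> f w = ident (C w) (A w)"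
      "f w \<cdot>\<^bsub>C w\<^esub> g w = ident (C w) (B w)" if "w \<in> P" for w
    using g0[OF that] that by (simp_all add: g_def)
  have g_arr: "((B, \<beta>), (A, \<alpha>), g) \<in> glued_arrows W C \<Phi> \<nu> P"
  proof (rule glued_arrowI[OF glued_arrow_tgt[OF f] glued_arrow_src[OF f]])
    show "g \<in> extensional P" by (simp add: g_def)
    show "w \<in> P \<Longrightarrow> g w \<in> homset (C w) (B w) (A w)" for w by (rule g)
  next
    fix w v x assume h: "w \<in> carrier W" "v \<in> P" "w \<otimes> v = x" "x \<in> P"
    then have c: "v \<in> carrier W" "x \<in> carrier W" using P by auto
    interpret D: category "C x" using category_at c by simp
    note fv = f_hom[OF h(2)] and fx = f_hom[OF h(4)] and gv = g(1)[OF h(2)] and gx = g(1)[OF h(4)]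
    note \<alpha> = glued_object_hom[OF glued_arrow_src[OF f] h]
    note \<beta> = glued_object_hom[OF glued_arrow_tgt[OF f] h]
    note \<Phi>f = \<Phi>_hom[OF fv h(1) c(1) h(3)] and \<Phi>g = \<Phi>_hom[OF gv h(1) c(1) h(3)]
    let ?l = "\<alpha> (w, v) \<cdot>\<^bsub>C x\<^esub> on_arr (\<Phi> w v) (g v)"
    have l: "?l \<in> homset (C x) (on_obj (\<Phi> w v) (B v)) (A x)" using D.comp_in_homset[OF \<Phi>g \<alpha>] .
    have "on_arr (\<Phi> w v) (f v) \<cdot>\<^bsub>C x\<^esub> on_arr (\<Phi> w v) (g v) = ident (C x) (on_obj (\<Phi> w v) (B v))"
      using \<Phi>_comp[OF gv fv h(1) c(1) h(3)] g(3)[OF h(2)]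
        \<Phi>_ident[OF glued_object_obj[OF glued_arrow_tgt[OF f] h(2)] h(1) c(1) h(3)] by simp
    then have "f x \<cdot>\<^bsub>C x\<^esub> ?l = \<beta> (w, v)"
      using D.comp_assoc[OF \<Phi>g \<alpha> fx] glued_arrow_comm[OF f h] D.comp_assoc[OF \<Phi>g \<Phi>f \<beta>]
        D.comp_ident[OF \<beta>] by simp
    then show "?l = g x \<cdot>\<^bsub>C x\<^esub> \<beta> (w, v)"
      using D.comp_assoc[OF l fx gx] g(2)[OF h(4)] D.ident_comp[OF l] by simp
  qed
  show ?thesis
  proof (rule G.isoI)
    show "((A, \<alpha>), (B, \<beta>), f) \<in> homset (glued_category W C \<Phi> \<nu> P) (A, \<alpha>) (B, \<beta>)"
      "((B, \<beta>), (A, \<alpha>), g) \<in> homset (glued_category W C \<Phi> \<nu> P) (B, \<beta>) (A, \<alpha>)"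
      using f g_arr by (auto simp: homset_glued_iff)
  qed (use g in \<open>auto simp: fun_eq_iff\<close>)
qed

end

section \<open>The exchange condition\<close>

context coxeter_system
begin

abbreviation len :: "'w \<Rightarrow> nat" where
  "len w \<equiv> word_length W S w"

lemma word_prod_Nil [simp]: "word_prod W [] = \<one>"
  and word_prod_Cons [simp]: "word_prod W (s # xs) = s \<otimes> word_prod W xs"
  by (simp_all add: word_prod_def)

lemma generator_closed [simp]: "s \<in> S \<Longrightarrow> s \<in> carrier W"
  using S_subset by blast

lemma word_prod_closed [simp]: "xs \<in> lists S \<Longrightarrow> word_prod W xs \<in> carrier W"
  by (induction xs) auto

lemma word_prod_append:
  "\<lbrakk>xs \<in> lists S; ys \<in> lists S\<rbrakk> \<Longrightarrow> word_prod W (xs @ ys) = word_prod W xs \<otimes> word_prod W ys"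
  by (induction xs) (auto simp: m_assoc)

text \<open>The letter \<open>s\<close> of a word \<open>ys @ s # xs\<close> determines the reflection \<open>x\<^sup>-\<^sup>1 s x\<close>, where \<open>x\<close> is the value
  of \<open>xs\<close>: multiplying the word by it on the right deletes that letter. Modulo 2, the number of occurrences of \<open>t\<close> is Bourbaki's
  cocycle describing the action of the group on signed reflections.\<close>

primrec reflection_count :: "'w list \<Rightarrow> 'w \<Rightarrow> nat" where
  "reflection_count [] t = 0"
| "reflection_count (s # xs) t =
     of_bool (inv (word_prod W xs) \<otimes> s \<otimes> word_prod W xs = t) + reflection_count xs t"

lemma conjugate_eq_iff:
  assumes "a \<in> carrier W" "b \<in> carrier W" "t \<in> carrier W"
  shows "inv b \<otimes> a \<otimes> b = t \<longleftrightarrow> a = b \<otimes> t \<otimes> inv b"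
  using assms by (metis inv_closed inv_solve_left inv_solve_right' m_assoc m_closed)

lemma reflection_count_append:
  assumes "xs \<in> lists S" "ys \<in> lists S" "t \<in> carrier W"
  shows "reflection_count (xs @ ys) t =
    reflection_count xs (word_prod W ys \<otimes> t \<otimes> inv (word_prod W ys)) + reflection_count ys t"
  using assms(1)
proof (induction xs rule: list.induct)
  case (Cons s xs)
  let ?a = "word_prod W xs" and ?b = "word_prod W ys"
  have c: "s \<in> carrier W" "?a \<in> carrier W" "?b \<in> carrier W"
    using Cons.prems assms(2) by simp_all
  have "inv (word_prod W (xs @ ys)) \<otimes> s \<otimes> word_prod W (xs @ ys)
      = inv ?b \<otimes> (inv ?a \<otimes> s \<otimes> ?a) \<otimes> ?b"
    using Cons.prems assms(2) c by (simp add: word_prod_append inv_mult_group m_assoc)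
  then have "inv (word_prod W (xs @ ys)) \<otimes> s \<otimes> word_prod W (xs @ ys) = t \<longleftrightarrow>
      inv ?a \<otimes> s \<otimes> ?a = ?b \<otimes> t \<otimes> inv ?b"
    using conjugate_eq_iff[of "inv ?a \<otimes> s \<otimes> ?a" ?b t] c assms(3) by simp
  then show ?case using Cons by simp
qed simp

lemma generator_involution:
  assumes "s \<in> S"
  shows "s \<otimes> s = \<one>"
proof -
  obtain m where m: "coxeter_matrix S m" and
    eq: "\<And>xs ys. \<lbrakk>xs \<in> lists S; ys \<in> lists S\<rbrakk> \<Longrightarrow>
      word_prod W xs = word_prod W ys \<longleftrightarrow> word_equiv S (coxeter_relators S m) xs ys"
    using presentation by blast
  have "m s s = 1" using m assms by (simp add: coxeter_matrix_def)
  then have "[s, s] \<in> coxeter_relators S m"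
    using assms unfolding coxeter_relators_def by (force intro!: exI[of _ s])
  then have "word_equiv S (coxeter_relators S m) ([] @ [s, s] @ []) ([] @ [])"
    by (intro word_equiv.relator) auto
  then have "word_prod W [s, s] = word_prod W []" using eq[of "[s, s]" "[]"] assms by simp
  then show ?thesis using assms S_subset by auto
qed

lemma inv_generator: "s \<in> S \<Longrightarrow> inv s = s"
  using generator_involution S_subset inv_equality by blast

text \<open>In the dihedral word \<open>s t s t \<dots>\<close> ending in \<open>t\<close>, the reflection of the letter that has \<open>j\<close> letters
  to its right is \<open>(t s)\<^sup>j t\<close>, since conjugation by \<open>t\<close> inverts \<open>s t\<close>.\<close>

lemma reflection_count_alternating:
  assumes s: "s \<in> S" and t: "t \<in> S"
  shows "word_prod W (concat (replicate k [s, t])) = (s \<otimes> t) [^] k"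
    and "reflection_count (concat (replicate k [s, t])) x =
      (\<Sum>j<2 * k. of_bool ((t \<otimes> s) [^] j \<otimes> t = x))"
proof -
  have c: "s \<in> carrier W" "t \<in> carrier W" using s t S_subset by auto
  show prod: "word_prod W (concat (replicate k [s, t])) = (s \<otimes> t) [^] k" for k
  proof (induction k)
    case (Suc k)
    then show ?case using c nat_pow_Suc2[of "s \<otimes> t" k] by (simp add: m_assoc del: nat_pow_Suc)
  qed simp
  have flip: "t \<otimes> (s \<otimes> t) [^] k = (t \<otimes> s) [^] k \<otimes> t" for k :: nat
  proof (induction k)
    case (Suc k)
    have "t \<otimes> (s \<otimes> t) [^] Suc k = (t \<otimes> (s \<otimes> t) [^] k) \<otimes> (s \<otimes> t)" using c by (simp add: m_assoc)
    also have "\<dots> = (t \<otimes> s) [^] k \<otimes> t \<otimes> (s \<otimes> t)" using Suc by simp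
    also have "\<dots> = (t \<otimes> s) [^] Suc k \<otimes> t" using c by (simp add: m_assoc)
    finally show ?case .
  qed (use c in simp)
  have inv_pow: "inv ((s \<otimes> t) [^] k) = (t \<otimes> s) [^] k" for k :: nat
    using c s t inv_generator nat_pow_inv[of "s \<otimes> t" k] by (simp add: inv_mult_group)
  show "reflection_count (concat (replicate k [s, t])) x =
      (\<Sum>j<2 * k. of_bool ((t \<otimes> s) [^] j \<otimes> t = x))"
  proof (induction k)
    case (Suc k)
    let ?c = "(s \<otimes> t) [^] k" and ?d = "(t \<otimes> s) [^] k"
    have C: "?c \<in> carrier W" "?d \<in> carrier W" using c by auto
    have second: "inv ?c \<otimes> t \<otimes> ?c = (t \<otimes> s) [^] (2 * k) \<otimes> t"
    proof -
      have "inv ?c \<otimes> t \<otimes> ?c = ?d \<otimes> (t \<otimes> ?c)" using inv_pow C c by (simp add: m_assoc)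
      also have "\<dots> = ?d \<otimes> ?d \<otimes> t" using flip C c by (simp add: m_assoc)
      also have "?d \<otimes> ?d = (t \<otimes> s) [^] (2 * k)" using c nat_pow_mult[of "t \<otimes> s" k k] by (simp add: mult_2)
      finally show ?thesis .
    qed
    have first: "inv (t \<otimes> ?c) \<otimes> s \<otimes> (t \<otimes> ?c) = (t \<otimes> s) [^] Suc (2 * k) \<otimes> t"
    proof -
      have "inv (t \<otimes> ?c) = ?d \<otimes> t" using inv_pow C c inv_generator[OF t] by (simp add: inv_mult_group)
      then have "inv (t \<otimes> ?c) \<otimes> s \<otimes> (t \<otimes> ?c) = ?d \<otimes> (t \<otimes> s) \<otimes> (t \<otimes> ?c)"
        using C c by (simp add: m_assoc)
      also have "\<dots> = (t \<otimes> s) [^] Suc k \<otimes> (?d \<otimes> t)" using flip by simp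
      also have "\<dots> = (t \<otimes> s) [^] Suc k \<otimes> ?d \<otimes> t" using C c by (simp add: m_assoc)
      also have "(t \<otimes> s) [^] Suc k \<otimes> ?d = (t \<otimes> s) [^] Suc (2 * k)"
        using c nat_pow_mult[of "t \<otimes> s" "Suc k" k] by (simp add: mult_2 del: nat_pow_Suc)
      finally show ?thesis .
    qed
    show ?case
      using Suc first second prod[of k] by (simp del: nat_pow_Suc)
  qed simp
qed

text \<open>If the dihedral word of length \<open>2 k\<close> is trivial, its list of reflections is periodic with
  period \<open>k\<close>, so each reflection occurs an even number of times.\<close>

lemma reflection_count_relator:
  assumes s: "s \<in> S" and t: "t \<in> S" and one: "word_prod W (concat (replicate k [s, t])) = \<one>"
  shows "even (reflection_count (concat (replicate k [s, t])) x)"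
proof -
  have c: "s \<in> carrier W" "t \<in> carrier W" using s t S_subset by auto
  have "(s \<otimes> t) [^] k = \<one>" using reflection_count_alternating(1)[OF s t] one by simp
  then have "(t \<otimes> s) [^] k = \<one>"
    using nat_pow_inv[of "s \<otimes> t" k] c s t inv_generator by (simp add: inv_mult_group)
  then have period: "(t \<otimes> s) [^] (k + j) = (t \<otimes> s) [^] j" for j
    using nat_pow_mult[of "t \<otimes> s" k j] c by simp
  have split: "(\<Sum>j<k + n. f j) = (\<Sum>j<k. f j) + (\<Sum>j<n. f (k + j))" for f :: "nat \<Rightarrow> nat" and n
    by (induction n) auto
  show ?thesis
    using reflection_count_alternating(2)[OF s t, of k x] split[of _ k] period by (simp add: mult_2)
qed

text \<open>The parity of the count depends only on the group element, because deleting a relator changes no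
  parity: the relator itself contributes an even number, and since its value is \<open>\<one>\<close>, the
  reflections of the letters to its left do not change.\<close>

lemma even_reflection_count_cong:
  assumes "xs \<in> lists S" "ys \<in> lists S" "word_prod W xs = word_prod W ys" "x \<in> carrier W"
  shows "even (reflection_count xs x) \<longleftrightarrow> even (reflection_count ys x)"
proof -
  obtain m where 
    eq: "\<And>xs ys. \<lbrakk>xs \<in> lists S; ys \<in> lists S\<rbrakk> \<Longrightarrow>
      word_prod W xs = word_prod W ys \<longleftrightarrow> word_equiv S (coxeter_relators S m) xs ys"
    using presentation by blast
  have "word_equiv S (coxeter_relators S m) xs ys" using assms eq by blast
  then have "\<forall>x\<in>carrier W. even (reflection_count xs x) \<longleftrightarrow> even (reflection_count ys x)"
  proof induction
    case (relator xs ys r)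
    obtain s t where st: "s \<in> S" "t \<in> S" and r: "r = concat (replicate (m s t) [s, t])"
      using relator(3) by (auto simp: coxeter_relators_def)
    have rS: "r \<in> lists S" using st by (auto simp: r split: if_splits)
    have "word_equiv S (coxeter_relators S m) ([] @ r @ []) ([] @ [])"
      using relator(3) by (intro word_equiv.relator) auto
    then have r1: "word_prod W r = \<one>" using eq[OF rS, of "[]"] by simp
    have "even (reflection_count r x)" for x
      using reflection_count_relator[OF st] r1 unfolding r by blast
    then show ?case
      using relator(1,2) rS r1 word_prod_closed
      by (simp add: reflection_count_append word_prod_append)
  qed auto
  then show ?thesis using assms by blast
qed

lemma lists_remove1: "ys @ a # zs \<in> lists A \<Longrightarrow> ys @ zs \<in> lists A"
  by auto

lemma word_length_le: "xs \<in> lists S \<Longrightarrow> len (word_prod W xs) \<le> length xs"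
  unfolding word_length_def by (rule Least_le) blast

lemma generate_eq_word_prod:
  assumes J: "J \<subseteq> S"
  shows "w \<in> generate W J \<longleftrightarrow> (\<exists>xs \<in> lists J. word_prod W xs = w)"
proof
  assume "w \<in> generate W J"
  then show "\<exists>xs \<in> lists J. word_prod W xs = w"
  proof induction
    case one
    then show ?case by (intro bexI[of _ "[]"]) auto
  next
    case (incl s)
    then show ?case using J S_subset by (intro bexI[of _ "[s]"]) auto
  next
    case (inv s)
    then have "inv s = s" "s \<in> carrier W" using J S_subset inv_generator by auto
    then show ?case using inv by (intro bexI[of _ "[s]"]) auto
  next
    case (eng a b)
    then obtain xs ys where "xs \<in> lists J" "word_prod W xs = a" "ys \<in> lists J" "word_prod W ys = b"
      by blast
    moreover then have "xs \<in> lists S" "ys \<in> lists S" using J by auto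
    ultimately show ?case using word_prod_append by (intro bexI[of _ "xs @ ys"]) auto
  qed
next
  assume "\<exists>xs \<in> lists J. word_prod W xs = w"
  then obtain xs where "xs \<in> lists J" "word_prod W xs = w" by blast
  then show "w \<in> generate W J"
    by (induction xs arbitrary: w) (auto intro: generate.one generate.incl generate.eng)
qed

text \<open>Each generator is its own inverse, so positive words reach every element and the minimum that
  defines the length is attained.\<close>

lemma ex_reduced_word:
  assumes "w \<in> carrier W"
  obtains xs where "xs \<in> lists S" "word_prod W xs = w" "length xs = len w"
proof -
  have "\<exists>n. \<exists>xs \<in> lists S. length xs = n \<and> word_prod W xs = w"
    using generate_eq_word_prod[of S w] S_generates assms by auto
  from LeastI_ex[OF this] show ?thesis using that unfolding word_length_def by blast
qed

text \<open>An odd count is nonzero, so some letter has \<open>s\<close> as its reflection; multiplying by \<open>s\<close> cancels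
  that letter.\<close>

lemma odd_reflection_count_delete:
  assumes "odd (reflection_count xs s)" "xs \<in> lists S" "s \<in> S"
  shows "\<exists>ys a zs. xs = ys @ a # zs \<and> word_prod W xs \<otimes> s = word_prod W (ys @ zs)"
proof -
  have "\<exists>ys a zs. xs = ys @ a # zs \<and> inv (word_prod W zs) \<otimes> a \<otimes> word_prod W zs = s"
    using assms(1)
  proof (induction xs)
    case (Cons x xs)
    show ?case
    proof (cases "inv (word_prod W xs) \<otimes> x \<otimes> word_prod W xs = s")
      case True
      then show ?thesis by blast
    next
      case False
      then have "odd (reflection_count xs s)" using Cons.prems by simp
      then obtain ys a zs where "xs = ys @ a # zs" "inv (word_prod W zs) \<otimes> a \<otimes> word_prod W zs = s"
        using Cons.IH by blast
      then have "x # xs = (x # ys) @ a # zs \<and> inv (word_prod W zs) \<otimes> a \<otimes> word_prod W zs = s" by simp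
      then show ?thesis by blast
    qed
  qed simp
  then obtain ys a zs where xs: "xs = ys @ a # zs" 
    and a: "inv (word_prod W zs) \<otimes> a \<otimes> word_prod W zs = s" by blast
  have l: "ys \<in> lists S" "zs \<in> lists S" "a \<in> S" using assms(2) xs by auto
  have c: "word_prod W ys \<in> carrier W" "word_prod W zs \<in> carrier W" "a \<in> carrier W"
    using l word_prod_closed S_subset by auto
  have "word_prod W zs \<otimes> s = a \<otimes> word_prod W zs"
    using c by (simp add: a[symmetric] m_assoc[symmetric])
  then have "word_prod W xs \<otimes> s = word_prod W ys \<otimes> (a \<otimes> a \<otimes> word_prod W zs)"
    using xs l c assms(3) S_subset by (auto simp: word_prod_append m_assoc)
  then have "word_prod W xs \<otimes> s = word_prod W (ys @ zs)"
    using generator_involution[OF l(3)] l c by (simp add: word_prod_append)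
  then show ?thesis using xs by blast
qed

text \<open>Let \<open>w\<close> be the value of \<open>xs\<close>. If \<open>s\<close> occurs an odd number of times among the reflections of
  \<open>xs\<close>, a letter can be deleted. Otherwise it occurs an odd number of times for \<open>xs @ [s]\<close>, hence
  for a reduced word of \<open>w s\<close>; deleting a letter of that word shows that \<open>w\<close> is strictly shorter than
  \<open>w s\<close>.\<close>

lemma exchange:
  assumes xs: "xs \<in> lists S" and s: "s \<in> S"
    and le: "len (word_prod W xs \<otimes> s) \<le> len (word_prod W xs)"
  shows "\<exists>ys a zs. xs = ys @ a # zs \<and> word_prod W xs \<otimes> s = word_prod W (ys @ zs)"
proof (cases "odd (reflection_count xs s)")
  case True
  then show ?thesis using odd_reflection_count_delete assms by blast
next
  case False
  have c: "word_prod W xs \<in> carrier W" "s \<in> carrier W" using xs s S_subset word_prod_closed by auto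
  obtain zs where zs: "zs \<in> lists S" "word_prod W zs = word_prod W xs \<otimes> s"
      "length zs = len (word_prod W xs \<otimes> s)"
    using ex_reduced_word[of "word_prod W xs \<otimes> s"] c by blast
  have "word_prod W (xs @ [s]) = word_prod W zs"
    using xs s zs c by (simp add: word_prod_append)
  moreover have "odd (reflection_count (xs @ [s]) s)"
    using False xs s c by (simp add: reflection_count_append m_assoc)
  ultimately have "odd (reflection_count zs s)"
    using even_reflection_count_cong[of "xs @ [s]" zs s] xs s zs c by auto
  then obtain us a vs where uv: "zs = us @ a # vs" "word_prod W zs \<otimes> s = word_prod W (us @ vs)"
    using odd_reflection_count_delete zs(1) s by blast
  have "word_prod W zs \<otimes> s = word_prod W xs"
    using zs(2) c generator_involution[OF s] by (simp add: m_assoc)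
  then have "len (word_prod W xs) \<le> length (us @ vs)"
    using word_length_le[OF lists_remove1] zs(1) uv by metis
  then show ?thesis using le zs(3) uv(1) by simp
qed

section \<open>Minimal coset representatives\<close>

definition minimal_in_coset :: "'w set \<Rightarrow> 'w \<Rightarrow> bool" where
  "minimal_in_coset J n \<longleftrightarrow> n \<in> carrier W \<and> (\<forall>v \<in> generate W J. len n \<le> len (n \<otimes> v))"

lemma len_one [simp]: "len \<one> = 0"
  using word_length_le[of "[]"] by simp

lemma len_mult_le:
  assumes "a \<in> carrier W" "b \<in> carrier W"
  shows "len (a \<otimes> b) \<le> len a + len b"
proof -
  obtain xs ys where xs: "xs \<in> lists S" "word_prod W xs = a" "length xs = len a"
    and ys: "ys \<in> lists S" "word_prod W ys = b" "length ys = len b"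
    using ex_reduced_word assms by metis
  then show ?thesis using word_length_le[of "xs @ ys"] by (simp add: word_prod_append)
qed

text \<open>Append the letters of \<open>ts\<close> to a reduced word of \<open>n\<close> one at a time. If a step did not increase the
  length, the exchange condition would delete a letter of \<open>n\<close>, contradicting its minimality
  in the coset, or a letter of \<open>ts\<close>, contradicting the choice of \<open>ts\<close> as a shortest word in \<open>J\<close>.\<close>

lemma len_mult_reduced_word:
  assumes J: "J \<subseteq> S" and n: "minimal_in_coset J n"
    and "ts \<in> lists J" "\<And>ts'. \<lbrakk>ts' \<in> lists J; word_prod W ts' = word_prod W ts\<rbrakk> \<Longrightarrow> length ts \<le> length ts'"
  shows "len (n \<otimes> word_prod W ts) = len n + length ts"
  using assms(3-4)
proof (induction ts rule: rev_induct)
  case Nil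
  then show ?case using n by (simp add: minimal_in_coset_def)
next
  case (snoc t ts)
  have nc: "n \<in> carrier W" using n by (simp add: minimal_in_coset_def)
  have tsJ: "ts \<in> lists J" and tJ: "t \<in> J" using snoc.prems(1) by auto
  have tsS: "ts \<in> lists S" and tS: "t \<in> S" using tsJ tJ J by auto
  have tc: "t \<in> carrier W" "word_prod W ts \<in> carrier W" using tS S_subset tsS word_prod_closed by auto
  have JS: "\<And>us. us \<in> lists J \<Longrightarrow> us \<in> lists S" using J by auto
  have IH: "len (n \<otimes> word_prod W ts) = len n + length ts"
  proof (rule snoc.IH[OF tsJ])
    fix ts' assume ts': "ts' \<in> lists J" "word_prod W ts' = word_prod W ts"
    then have "word_prod W (ts' @ [t]) = word_prod W (ts @ [t])"
      using tsS JS tS by (simp add: word_prod_append)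
    then show "length ts \<le> length ts'" using snoc.prems(2)[of "ts' @ [t]"] ts' tJ by simp
  qed
  obtain ns where ns: "ns \<in> lists S" "word_prod W ns = n" "length ns = len n"
    using ex_reduced_word nc by blast
  have prod: "word_prod W (ns @ ts) = n \<otimes> word_prod W ts" using ns tsS by (simp add: word_prod_append)
  have prod_t: "n \<otimes> word_prod W (ts @ [t]) = word_prod W (ns @ ts) \<otimes> t"
    using prod tsS tS nc tc by (simp add: word_prod_append m_assoc)
  have "\<not> len (n \<otimes> word_prod W (ts @ [t])) \<le> len (n \<otimes> word_prod W ts)"
  proof
    assume "len (n \<otimes> word_prod W (ts @ [t])) \<le> len (n \<otimes> word_prod W ts)"
    then obtain ys a zs where e: "ns @ ts = ys @ a # zs"
        "word_prod W (ns @ ts) \<otimes> t = word_prod W (ys @ zs)"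
      using exchange[of "ns @ ts" t] ns tsS tS prod prod_t by auto
    then consider us where "ns = ys @ a # us" "zs = us @ ts" | us where "ys = ns @ us" "ts = us @ a # zs"
      by (auto simp: append_eq_append_conv2 append_eq_Cons_conv Cons_eq_append_conv)
    then show False
    proof cases
      case 1
      \<comment> \<open>deleting a letter of \<open>ns\<close> leaves a shorter word whose value \<open>n v\<close> lies in the coset of \<open>n\<close>\<close>
      let ?v = "word_prod W ts \<otimes> t \<otimes> inv (word_prod W ts)"
      have usS: "ys @ us \<in> lists S" using ns(1) 1 by auto
      have pc: "word_prod W (ys @ us) \<in> carrier W" using usS word_prod_closed by blast
      have ysS: "ys \<in> lists S" "us \<in> lists S" using usS by auto
      have "word_prod W (ys @ us) \<otimes> word_prod W ts = n \<otimes> word_prod W ts \<otimes> t"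
        using e(2) 1 ysS tsS prod by (simp add: word_prod_append m_assoc word_prod_closed)
      then have eq: "word_prod W (ys @ us) = n \<otimes> ?v"
        using pc nc tc inv_solve_right[of "word_prod W (ys @ us)" "n \<otimes> word_prod W ts \<otimes> t" "word_prod W ts"]
        by (simp add: m_assoc)
      have "word_prod W ts \<in> generate W J" using generate_eq_word_prod[OF J] tsJ by blast
      moreover have "t \<in> generate W J" using tJ generate.incl by metis
      moreover have "inv (word_prod W ts) \<in> generate W J"
        using generate_m_inv_closed[of J] J S_subset calculation by blast
      ultimately have "?v \<in> generate W J" using generate.eng by metis
      then have "len n \<le> len (word_prod W (ys @ us))" using n eq by (simp add: minimal_in_coset_def)
      also have "\<dots> \<le> length (ys @ us)" using word_length_le usS by blast
      finally show False using ns(3) 1 by simp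
    next
      case 2
      have uzJ: "us @ zs \<in> lists J" using tsJ 2 by auto
      have uzS: "us \<in> lists S" "zs \<in> lists S" using uzJ J by auto
      have "n \<otimes> word_prod W (ts @ [t]) = n \<otimes> word_prod W (us @ zs)"
        using prod_t e(2) 2 ns uzS nc by (simp add: word_prod_append m_assoc word_prod_closed)
      then have "word_prod W (us @ zs) = word_prod W (ts @ [t])"
        using nc word_prod_closed[of "ts @ [t]"] word_prod_closed[of "us @ zs"] tsS tS uzS by simp
      then show False using snoc.prems(2)[OF uzJ] 2 by simp
    qed
  qed
  moreover have "len (n \<otimes> word_prod W (ts @ [t])) \<le> len n + length (ts @ [t])"
    using word_length_le[of "ns @ ts @ [t]"] ns tsS tS by (simp add: word_prod_append)
  ultimately show ?case using IH by simp
qed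

text \<open>Applied to the minimal element \<open>\<one>\<close>, the previous lemma shows that a shortest word in \<open>J\<close> is
  also a shortest word in \<open>S\<close>.\<close>

lemma len_mult_minimal:
  assumes J: "J \<subseteq> S" and n: "minimal_in_coset J n" and u: "u \<in> generate W J"
  shows "len (n \<otimes> u) = len n + len u"
proof -
  have "\<exists>k. \<exists>ts \<in> lists J. word_prod W ts = u \<and> length ts = k"
    using generate_eq_word_prod[OF J] u by blast
  from LeastI_ex[OF this] obtain ts where ts: "ts \<in> lists J" "word_prod W ts = u"
      "length ts = (LEAST k. \<exists>ts \<in> lists J. word_prod W ts = u \<and> length ts = k)" by blast
  have min: "length ts \<le> length ts'" if "ts' \<in> lists J" "word_prod W ts' = word_prod W ts" for ts'
    unfolding ts(3) using that ts(2) by (intro Least_le) blast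
  have uc: "u \<in> carrier W" using ts J word_prod_closed by (metis lists_mono subset_iff)
  have one: "minimal_in_coset J \<one>" by (simp add: minimal_in_coset_def)
  show ?thesis
    using len_mult_reduced_word[OF J n ts(1) min] len_mult_reduced_word[OF J one ts(1) min] ts(2) uc by simp
qed

text \<open>Let \<open>s\<close> be the first letter of a reduced word of \<open>n\<close>. Removing it keeps minimality, since
  multiplying a shorter element of \<open>n' W\<^sub>J\<close> by \<open>s\<close> would give an element of \<open>n W\<^sub>J\<close> shorter than \<open>n\<close>. It changes
  the coset, because \<open>n'\<close> is itself shorter than \<open>n\<close>; that is the last conclusion.\<close>

lemma minimal_in_coset_descend:
  assumes J: "J \<subseteq> S" and n: "minimal_in_coset J n" and ne: "n \<noteq> \<one>"
  obtains s n' where "s \<in> S" "n = s \<otimes> n'" "minimal_in_coset J n'" "len n = len s + len n'" "len n' < len n"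
    "\<And>u. u \<in> generate W J \<Longrightarrow> inv (n' \<otimes> u) \<otimes> s \<otimes> (n' \<otimes> u) \<notin> generate W J"
proof -
  have nc: "n \<in> carrier W" using n by (simp add: minimal_in_coset_def)
  obtain xs where xs: "xs \<in> lists S" "word_prod W xs = n" "length xs = len n"
    using ex_reduced_word nc by blast
  then obtain s ys where sys: "xs = s # ys" using ne by (cases xs) auto
  define n' where "n' = word_prod W ys"
  have s: "s \<in> S" and ys: "ys \<in> lists S" and eq: "n = s \<otimes> n'" using xs sys by (auto simp: n'_def)
  have c: "s \<in> carrier W" "n' \<in> carrier W" using s ys S_subset word_prod_closed by (auto simp: n'_def)
  have HJ: "subgroup (generate W J) W" using generate_is_subgroup J S_subset by blast
  have le1: "len s \<le> 1" using word_length_le[of "[s]"] s c by simp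
  have le2: "len n' < len n" using word_length_le[OF ys] xs(3) sys by (simp add: n'_def)
  have sum: "len n = len s + len n'" using len_mult_le[OF c] le1 le2 eq by simp
  have min: "minimal_in_coset J n'"
    unfolding minimal_in_coset_def
  proof (intro conjI ballI)
    fix v assume v: "v \<in> generate W J"
    then have vc: "v \<in> carrier W" using HJ subgroup.mem_carrier by metis
    have "len n \<le> len (s \<otimes> (n' \<otimes> v))" 
      using n v eq unfolding minimal_in_coset_def m_assoc[OF c vc, symmetric] by blast
    also have "\<dots> \<le> len s + len (n' \<otimes> v)" using len_mult_le c vc by simp
    finally show "len n' \<le> len (n' \<otimes> v)" using sum by simp
  qed (rule c)
  have "inv (n' \<otimes> u) \<otimes> s \<otimes> (n' \<otimes> u) \<notin> generate W J" if u: "u \<in> generate W J" for u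
  proof
    let ?v = "inv (n' \<otimes> u) \<otimes> s \<otimes> (n' \<otimes> u)"
    assume v: "?v \<in> generate W J"
    have uc: "u \<in> carrier W" and vc: "?v \<in> carrier W" using HJ subgroup.mem_carrier u v by metis+
    \<comment> \<open>this element of \<open>W\<^sub>J\<close> carries \<open>n\<close> to the shorter element \<open>n'\<close>\<close>
    have "u \<otimes> inv ?v \<otimes> inv u \<in> generate W J"
      using HJ u v by (meson subgroup.m_closed subgroup.m_inv_closed)
    moreover have "n \<otimes> (u \<otimes> inv ?v \<otimes> inv u) = n'"
      using eq c uc s by (simp add: inv_mult_group m_assoc inv_generator) 
        (simp add: m_assoc[symmetric] generator_involution)
    ultimately have "len n \<le> len n'" using n by (metis minimal_in_coset_def)
    then show False using le2 by simp
  qed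
  then show ?thesis using that s eq min sum le2 by blast
qed

text \<open>The choice depends only on the coset as a set, which makes the representative constant on cosets without
  an argument that minimal elements are unique.\<close>

definition coset_rep :: "'w set \<Rightarrow> 'w \<Rightarrow> 'w" where
  "coset_rep J w = (ARG_MIN len n. n \<in> w <# generate W J)"

lemma len_eq_0D:
  assumes "w \<in> carrier W" "len w = 0"
  shows "w = \<one>"
proof -
  obtain xs where "word_prod W xs = w" "length xs = len w" using ex_reduced_word[OF assms(1)] .
  then show ?thesis using assms(2) by simp
qed

context
  fixes J
  assumes J: "J \<subseteq> S"
begin

lemma parabolic_subgroup: "subgroup (generate W J) W"
  using generate_is_subgroup J S_subset by blast

lemma coset_rep_in_coset:
  assumes "w \<in> carrier W"
  shows "coset_rep J w \<in> w <# generate W J"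
proof -
  have "w \<in> w <# generate W J"
    using assms subgroup.one_closed[OF parabolic_subgroup] unfolding l_coset_def by force
  then show ?thesis unfolding coset_rep_def by (rule arg_min_natI)
qed

lemma coset_repE:
  assumes "w \<in> carrier W"
  obtains u where "u \<in> generate W J" "u \<in> carrier W" "coset_rep J w = w \<otimes> u"
  using coset_rep_in_coset[OF assms] subgroup.mem_carrier[OF parabolic_subgroup] that
  unfolding l_coset_def by blast

lemma minimal_coset_rep:
  assumes w: "w \<in> carrier W"
  shows "minimal_in_coset J (coset_rep J w)"
proof -
  obtain u where u: "u \<in> generate W J" "u \<in> carrier W" "coset_rep J w = w \<otimes> u"
    using coset_repE[OF w] .
  have "len (coset_rep J w) \<le> len (coset_rep J w \<otimes> v)" if v: "v \<in> generate W J" for v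
  proof -
    have "coset_rep J w \<otimes> v = w \<otimes> (u \<otimes> v)"
      using u w v subgroup.mem_carrier[OF parabolic_subgroup] by (simp add: m_assoc)
    moreover have "u \<otimes> v \<in> generate W J" using u v by (simp add: generate.eng)
    ultimately have "coset_rep J w \<otimes> v \<in> w <# generate W J" unfolding l_coset_def by blast
    then show ?thesis unfolding coset_rep_def by (rule arg_min_nat_le)
  qed
  then show ?thesis using u w by (simp add: minimal_in_coset_def)
qed

lemma coset_rep_mult:
  assumes "w \<in> carrier W" "u \<in> generate W J"
  shows "coset_rep J (w \<otimes> u) = coset_rep J w"
proof -
  note sub = subgroup.subset[OF parabolic_subgroup]
  have uc: "u \<in> carrier W" using assms sub by blast
  have "(w \<otimes> u) <# generate W J = w <# (u <# generate W J)"
    using lcos_m_assoc[OF sub assms(1) uc] by simp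
  also have "u <# generate W J = generate W J"
    using coset_join3[OF uc parabolic_subgroup assms(2)] .
  finally show ?thesis by (simp add: coset_rep_def)
qed

lemma coset_rep_one: "coset_rep J \<one> = \<one>"
proof -
  obtain u where u: "u \<in> generate W J" "u \<in> carrier W" "coset_rep J \<one> = \<one> \<otimes> u"
    using coset_repE[OF one_closed] .
  have "\<forall>v\<in>generate W J. len u \<le> len (u \<otimes> v)"
    using minimal_coset_rep[OF one_closed] u by (simp add: minimal_in_coset_def)
  from bspec[OF this subgroup.m_inv_closed[OF parabolic_subgroup u(1)]]
  have "len u = 0" using u(2) by simp
  then show ?thesis using u len_eq_0D by simp
qed

end

end

section \<open>Extension from a subgroup along a transversal\<close>

text \<open>The construction of the inverse functor uses only a subgroup \<open>H\<close> and representatives of its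
  left cosets that behave like the minimal ones: \<open>\<nu>\<close> is invertible at products of a
  representative with elements of \<open>H\<close>, and so are the gluing maps that start in \<open>H\<close> and
  are indexed by a representative.\<close>

locale gluing_transversal = gluing_data W S C \<Phi> \<nu> + sub: subgroup H W
  for W :: "('w, 'b) monoid_scheme" (structure) and S
    and C :: "'w \<Rightarrow> ('o, 'm, 'x) preadditive_data_scheme" and \<Phi> \<nu> and H +
  fixes rep :: "'w \<Rightarrow> 'w"
  assumes rep_closed: "w \<in> carrier W \<Longrightarrow> rep w \<in> carrier W"
    and rep_same_coset: "w \<in> carrier W \<Longrightarrow> inv (rep w) \<otimes> w \<in> H"
    and rep_mult: "\<lbrakk>w \<in> carrier W; u \<in> H\<rbrakk> \<Longrightarrow> rep (w \<otimes> u) = rep w"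
    and rep_one: "rep \<one> = \<one>"
    and rep_\<nu>_iso: "\<lbrakk>w \<in> carrier W; u \<in> H; v \<in> H; A \<in> obj (C v)\<rbrakk>
      \<Longrightarrow> is_iso (C (rep w \<otimes> (u \<otimes> v))) (\<nu> (rep w) u v A)"
    and rep_\<alpha>_iso: "\<lbrakk>(B, \<alpha>) \<in> glued_objects W C \<Phi> \<nu> (carrier W); w \<in> carrier W; v \<in> H\<rbrakk>
      \<Longrightarrow> is_iso (C (rep w \<otimes> v)) (\<alpha> (rep w, v))"
begin

definition tail :: "'w \<Rightarrow> 'w" where
  "tail w = inv (rep w) \<otimes> w"

lemma H_closed: "u \<in> H \<Longrightarrow> u \<in> carrier W"
  by (rule sub.mem_carrier)

lemma tail_closed: "w \<in> carrier W \<Longrightarrow> tail w \<in> H"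
  by (simp add: tail_def rep_same_coset)

lemma rep_tail: "w \<in> carrier W \<Longrightarrow> rep w \<otimes> tail w = w"
  using rep_closed by (simp add: tail_def m_assoc[symmetric])

lemma rep_subgroup: "u \<in> H \<Longrightarrow> rep u = \<one>"
  using rep_mult[of \<one> u] rep_one H_closed by simp

lemma tail_subgroup: "u \<in> H \<Longrightarrow> tail u = u"
  using rep_subgroup H_closed by (simp add: tail_def)

lemma rep_rep: "w \<in> carrier W \<Longrightarrow> rep (rep w) = rep w"
  using rep_mult[of "rep w" "tail w"] rep_tail[of w] tail_closed rep_closed by simp

lemma tail_rep: "w \<in> carrier W \<Longrightarrow> tail (rep w) = \<one>"
  using rep_rep rep_closed by (simp add: tail_def)

lemma mult_rep_tail:
  assumes "w \<in> carrier W" "x \<in> carrier W"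
  shows "w \<otimes> x = (w \<otimes> rep x) \<otimes> tail x"
  using assms rep_tail[of x] rep_closed[of x] tail_closed[of x] H_closed by (simp add: m_assoc)

lemma rep_mult_rep: "\<lbrakk>w \<in> carrier W; x \<in> carrier W\<rbrakk> \<Longrightarrow> rep (w \<otimes> rep x) = rep (w \<otimes> x)"
  using mult_rep_tail[of w x] rep_mult[of "w \<otimes> rep x" "tail x"] rep_closed tail_closed by simp

lemma tail_mult:
  assumes "w \<in> carrier W" "x \<in> carrier W"
  shows "tail (w \<otimes> x) = tail (w \<otimes> rep x) \<otimes> tail x"
proof -
  have "tail (w \<otimes> x) = inv (rep (w \<otimes> x)) \<otimes> ((w \<otimes> rep x) \<otimes> tail x)"
    unfolding tail_def[of "w \<otimes> x"] mult_rep_tail[OF assms, symmetric] ..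
  also have "\<dots> = inv (rep (w \<otimes> rep x)) \<otimes> (w \<otimes> rep x) \<otimes> tail x"
    using assms rep_mult_rep[OF assms] rep_closed tail_closed H_closed by (simp add: m_assoc)
  finally show ?thesis by (simp add: tail_def)
qed

lemma rep_mult_tail_mult_rep:
  assumes "w \<in> carrier W" "x \<in> carrier W"
  shows "rep (w \<otimes> x) \<otimes> tail (w \<otimes> rep x) = w \<otimes> rep x"
  using rep_tail[of "w \<otimes> rep x"] rep_mult_rep[OF assms] assms rep_closed by simp

text \<open>For \<open>x = n u\<close> and \<open>w n = m v\<close> with representatives \<open>n\<close>, \<open>m\<close> and \<open>u, v \<in> H\<close>, this is the morphism
  \<open>\<nu>\<^sub>m\<^sub>,\<^sub>v\<^sup>-\<^sup>1 \<circ> \<nu>\<^sub>w\<^sub>,\<^sub>n : \<Phi>\<^sub>w \<Phi>\<^sub>n A \<rightarrow> \<Phi>\<^sub>m \<Phi>\<^sub>v A\<close>. Characterizing it by its composite with \<open>\<nu>\<^sub>m\<^sub>,\<^sub>v\<close> reduces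
  each identity for it to one for \<open>\<nu>\<close>.\<close>

definition transition :: "'w \<Rightarrow> 'w \<Rightarrow> 'o \<Rightarrow> 'm" where
  "transition w x A = (THE k.
     k \<in> homset (C (w \<otimes> x)) (on_obj (\<Phi> w x) (on_obj (\<Phi> (rep x) (tail x)) A))
       (on_obj (\<Phi> (rep (w \<otimes> x)) (tail (w \<otimes> x))) (on_obj (\<Phi> (tail (w \<otimes> rep x)) (tail x)) A)) \<and>
     \<nu> (rep (w \<otimes> x)) (tail (w \<otimes> rep x)) (tail x) A \<cdot>\<^bsub>C (w \<otimes> x)\<^esub> k = \<nu> w (rep x) (tail x) A)"

lemma transition_ex1:
  assumes w: "w \<in> carrier W" and x: "x \<in> carrier W" and A: "A \<in> obj (C (tail x))"
  shows "\<exists>!k. k \<in> homset (C (w \<otimes> x)) (on_obj (\<Phi> w x) (on_obj (\<Phi> (rep x) (tail x)) A))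
       (on_obj (\<Phi> (rep (w \<otimes> x)) (tail (w \<otimes> x))) (on_obj (\<Phi> (tail (w \<otimes> rep x)) (tail x)) A)) \<and>
     \<nu> (rep (w \<otimes> x)) (tail (w \<otimes> rep x)) (tail x) A \<cdot>\<^bsub>C (w \<otimes> x)\<^esub> k = \<nu> w (rep x) (tail x) A"
proof (rule category.ex1_lift_along_iso)
  note wx = m_closed[OF w x] and n = rep_closed[OF x]
  note c = rep_closed[OF wx] H_closed[OF tail_closed[OF m_closed[OF w n]]] H_closed[OF tail_closed[OF x]]
  show "category (C (w \<otimes> x))" by (rule category_at[OF wx])
  show "is_iso (C (w \<otimes> x)) (\<nu> (rep (w \<otimes> x)) (tail (w \<otimes> rep x)) (tail x) A)"
    using rep_\<nu>_iso[OF wx tail_closed[OF m_closed[OF w n]] tail_closed[OF x] A]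
      tail_mult[OF w x] rep_tail[OF wx] by simp
  show "\<nu> (rep (w \<otimes> x)) (tail (w \<otimes> rep x)) (tail x) A \<in> homset (C (w \<otimes> x))
      (on_obj (\<Phi> (rep (w \<otimes> x)) (tail (w \<otimes> x))) (on_obj (\<Phi> (tail (w \<otimes> rep x)) (tail x)) A))
      (on_obj (\<Phi> (w \<otimes> rep x) (tail x)) A)"
    by (rule \<nu>_hom[OF A c tail_mult[OF w x, symmetric] rep_tail[OF wx] rep_mult_tail_mult_rep[OF w x]])
  show "\<nu> w (rep x) (tail x) A \<in> homset (C (w \<otimes> x))
      (on_obj (\<Phi> w x) (on_obj (\<Phi> (rep x) (tail x)) A)) (on_obj (\<Phi> (w \<otimes> rep x) (tail x)) A)"
    by (rule \<nu>_hom[OF A w n c(3) rep_tail[OF x] HOL.refl HOL.refl])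
qed

lemma
  assumes w: "w \<in> carrier W" and x: "x \<in> carrier W" and A: "A \<in> obj (C (tail x))"
  shows transition_hom: "transition w x A \<in> homset (C (w \<otimes> x))
      (on_obj (\<Phi> w x) (on_obj (\<Phi> (rep x) (tail x)) A))
      (on_obj (\<Phi> (rep (w \<otimes> x)) (tail (w \<otimes> x))) (on_obj (\<Phi> (tail (w \<otimes> rep x)) (tail x)) A))"
    and \<nu>_transition: "\<nu> (rep (w \<otimes> x)) (tail (w \<otimes> rep x)) (tail x) A \<cdot>\<^bsub>C (w \<otimes> x)\<^esub> transition w x A
      = \<nu> w (rep x) (tail x) A"
  using theI'[OF transition_ex1[OF assms]] unfolding transition_def by blast+

lemma transition_eqI:
  assumes w: "w \<in> carrier W" and x: "x \<in> carrier W" and A: "A \<in> obj (C (tail x))"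
    and "k \<in> homset (C (w \<otimes> x)) (on_obj (\<Phi> w x) (on_obj (\<Phi> (rep x) (tail x)) A))
       (on_obj (\<Phi> (rep (w \<otimes> x)) (tail (w \<otimes> x))) (on_obj (\<Phi> (tail (w \<otimes> rep x)) (tail x)) A))"
    and "\<nu> (rep (w \<otimes> x)) (tail (w \<otimes> rep x)) (tail x) A \<cdot>\<^bsub>C (w \<otimes> x)\<^esub> k = \<nu> w (rep x) (tail x) A"
  shows "transition w x A = k"
  unfolding transition_def using transition_ex1[OF w x A] assms by (intro the1_equality) auto

lemma \<nu>_rep_left_cancel:
  assumes w: "w \<in> carrier W" and u: "u \<in> H" and v: "v \<in> H" and A: "A \<in> obj (C v)"
    and eq: "u \<otimes> v = y" "rep w \<otimes> y = z"
    and k: "k \<in> homset (C z) X (on_obj (\<Phi> (rep w) y) (on_obj (\<Phi> u v) A))"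
    and k': "k' \<in> homset (C z) X (on_obj (\<Phi> (rep w) y) (on_obj (\<Phi> u v) A))"
    and "\<nu> (rep w) u v A \<cdot>\<^bsub>C z\<^esub> k = \<nu> (rep w) u v A \<cdot>\<^bsub>C z\<^esub> k'"
  shows "k = k'"
proof -
  note c = rep_closed[OF w] H_closed[OF u] H_closed[OF v]
  have z: "z \<in> carrier W" using c eq by auto
  interpret D: category "C z" by (rule category_at[OF z])
  note N = \<nu>_hom[OF A c eq HOL.refl]
  have "is_iso (C z) (\<nu> (rep w) u v A)" using rep_\<nu>_iso[OF w u v A] eq by simp
  from D.ex1_lift_along_iso[OF this N D.comp_in_homset[OF k' N]] show ?thesis
    using k k' assms(9) by blast
qed

text \<open>Both sides agree after composition with the isomorphism \<open>\<nu>\<^sub>m\<^sub>,\<^sub>v\<close>, by naturality of \<open>\<nu>\<close>.\<close>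

lemma transition_natural:
  assumes w: "w \<in> carrier W" and x: "x \<in> carrier W" and f: "f \<in> homset (C (tail x)) A B"
  shows "transition w x B \<cdot>\<^bsub>C (w \<otimes> x)\<^esub> on_arr (\<Phi> w x) (on_arr (\<Phi> (rep x) (tail x)) f)
    = on_arr (\<Phi> (rep (w \<otimes> x)) (tail (w \<otimes> x))) (on_arr (\<Phi> (tail (w \<otimes> rep x)) (tail x)) f)
      \<cdot>\<^bsub>C (w \<otimes> x)\<^esub> transition w x A"
proof -
  let ?n = "rep x" and ?u = "tail x" and ?z = "w \<otimes> x"
  let ?m = "rep ?z" and ?v = "tail (w \<otimes> ?n)"
  note z = m_closed[OF w x] and n = rep_closed[OF x] and uH = tail_closed[OF x]
  note vH = tail_closed[OF m_closed[OF w n]]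
  note u = H_closed[OF uH] and v = H_closed[OF vH] and m = rep_closed[OF z]
  note tz = H_closed[OF tail_closed[OF z]]
  note nu = rep_tail[OF x] and mz = rep_tail[OF z] and vu = tail_mult[OF w x, symmetric]
  note mv = rep_mult_tail_mult_rep[OF w x]
  interpret D: category "C ?z" by (rule category_at[OF z])
  interpret U: category "C ?u" by (rule category_at[OF u])
  have A: "A \<in> obj (C ?u)" and B: "B \<in> obj (C ?u)" using U.homset_objD[OF f] by auto
  note N = \<nu>_hom[OF _ m v u vu mz mv]
  note tA = transition_hom[OF w x A] and tB = transition_hom[OF w x B]
  note F1 = \<Phi>_hom[OF \<Phi>_hom[OF f n u nu] w x HOL.refl]
  note F2 = \<Phi>_hom[OF \<Phi>_hom[OF f v u vu] m tz mz]
  note F3 = \<Phi>_hom[OF f m_closed[OF w n] u mult_rep_tail[OF w x, symmetric]]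
  show ?thesis
  proof (rule \<nu>_rep_left_cancel[OF z vH uH B vu mz D.comp_in_homset[OF F1 tB] D.comp_in_homset[OF tA F2]])
    have "\<nu> ?m ?v ?u B \<cdot>\<^bsub>C ?z\<^esub> (transition w x B \<cdot>\<^bsub>C ?z\<^esub> on_arr (\<Phi> w x) (on_arr (\<Phi> ?n ?u) f))
        = \<nu> w ?n ?u B \<cdot>\<^bsub>C ?z\<^esub> on_arr (\<Phi> w x) (on_arr (\<Phi> ?n ?u) f)"
      using D.comp_assoc[OF F1 tB N[OF B]] \<nu>_transition[OF w x B] by simp
    also have "\<dots> = on_arr (\<Phi> (w \<otimes> ?n) ?u) f \<cdot>\<^bsub>C ?z\<^esub> \<nu> w ?n ?u A"
      by (rule \<nu>_naturality[OF f w n u nu HOL.refl HOL.refl])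
    also have "\<dots> = on_arr (\<Phi> (w \<otimes> ?n) ?u) f \<cdot>\<^bsub>C ?z\<^esub> (\<nu> ?m ?v ?u A \<cdot>\<^bsub>C ?z\<^esub> transition w x A)"
      using \<nu>_transition[OF w x A] by simp
    also have "\<dots> = (\<nu> ?m ?v ?u B \<cdot>\<^bsub>C ?z\<^esub> on_arr (\<Phi> ?m (tail ?z)) (on_arr (\<Phi> ?v ?u) f))
        \<cdot>\<^bsub>C ?z\<^esub> transition w x A"
      using D.comp_assoc[OF tA N[OF A] F3] \<nu>_naturality[OF f m v u vu mz mv] by simp
    also have "\<dots> = \<nu> ?m ?v ?u B \<cdot>\<^bsub>C ?z\<^esub>
        (on_arr (\<Phi> ?m (tail ?z)) (on_arr (\<Phi> ?v ?u) f) \<cdot>\<^bsub>C ?z\<^esub> transition w x A)"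
      by (rule D.comp_assoc[OF tA F2 N[OF B]])
    finally show "\<nu> ?m ?v ?u B \<cdot>\<^bsub>C ?z\<^esub> (transition w x B \<cdot>\<^bsub>C ?z\<^esub> on_arr (\<Phi> w x) (on_arr (\<Phi> ?n ?u) f))
      = \<nu> ?m ?v ?u B \<cdot>\<^bsub>C ?z\<^esub>
        (on_arr (\<Phi> ?m (tail ?z)) (on_arr (\<Phi> ?v ?u) f) \<cdot>\<^bsub>C ?z\<^esub> transition w x A)" .
  qed
qed

lemma transition_one:
  assumes x: "x \<in> carrier W" and A: "A \<in> obj (C (tail x))"
  shows "transition \<one> x A = ident (C x) (on_obj (\<Phi> (rep x) (tail x)) A)"
proof -
  note n = rep_closed[OF x] and u = H_closed[OF tail_closed[OF x]] and nu = rep_tail[OF x]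
  interpret D: category "C x" by (rule category_at[OF x])
  let ?B = "on_obj (\<Phi> (rep x) (tail x)) A"
  have B: "?B \<in> obj (C x)" by (rule \<Phi>_obj[OF A n u nu])
  note i = D.ident_closed[OF B]
  show ?thesis
  proof (rule transition_eqI[OF one_closed x A])
    show "ident (C x) ?B \<in> homset (C (\<one> \<otimes> x)) (on_obj (\<Phi> \<one> x) ?B)
       (on_obj (\<Phi> (rep (\<one> \<otimes> x)) (tail (\<one> \<otimes> x))) (on_obj (\<Phi> (tail (\<one> \<otimes> rep x)) (tail x)) A))"
      using i x n \<Phi>_one_obj[OF x B] \<Phi>_one_obj[OF u A] tail_rep[OF x] by simp
    show "\<nu> (rep (\<one> \<otimes> x)) (tail (\<one> \<otimes> rep x)) (tail x) A \<cdot>\<^bsub>C (\<one> \<otimes> x)\<^esub> ident (C x) ?B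
        = \<nu> \<one> (rep x) (tail x) A"
      using x n tail_rep[OF x] \<nu>_one_right[OF n u A] \<nu>_one_left[OF n u A] nu D.ident_comp[OF i] by simp
  qed
qed

text \<open>Within \<open>H\<close> both representatives are \<open>\<one>\<close> and both components of \<open>\<nu>\<close> are identities; hence
  extended objects restrict to the original ones on the nose.\<close>

lemma transition_subgroup:
  assumes w: "w \<in> H" and x: "x \<in> H" and A: "A \<in> obj (C x)"
  shows "transition w x A = ident (C (w \<otimes> x)) (on_obj (\<Phi> w x) A)"
proof -
  note wc = H_closed[OF w] and xc = H_closed[OF x]
  have wx: "w \<otimes> x \<in> H" using w x by simp
  interpret D: category "C (w \<otimes> x)" by (rule category_at[OF H_closed[OF wx]])
  let ?B = "on_obj (\<Phi> w x) A"
  have B: "?B \<in> obj (C (w \<otimes> x))" by (rule \<Phi>_obj[OF A wc xc HOL.refl])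
  note i = D.ident_closed[OF B]
  note s = rep_subgroup[OF x] tail_subgroup[OF x] rep_subgroup[OF wx] tail_subgroup[OF wx] tail_subgroup[OF w]
  show ?thesis
  proof (rule transition_eqI[OF wc xc])
    show "A \<in> obj (C (tail x))" using A s by simp
    show "ident (C (w \<otimes> x)) ?B \<in> homset (C (w \<otimes> x)) (on_obj (\<Phi> w x) (on_obj (\<Phi> (rep x) (tail x)) A))
       (on_obj (\<Phi> (rep (w \<otimes> x)) (tail (w \<otimes> x))) (on_obj (\<Phi> (tail (w \<otimes> rep x)) (tail x)) A))"
      using i \<Phi>_one_obj[OF xc A] \<Phi>_one_obj[OF H_closed[OF wx] B] wc by (simp add: s)
    show "\<nu> (rep (w \<otimes> x)) (tail (w \<otimes> rep x)) (tail x) A \<cdot>\<^bsub>C (w \<otimes> x)\<^esub> ident (C (w \<otimes> x)) ?B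
        = \<nu> w (rep x) (tail x) A"
      using \<nu>_one_right[OF wc xc A] \<nu>_one_left[OF wc xc A] wc D.ident_comp[OF i] by (simp add: s)
  qed
qed

text \<open>Write \<open>w\<^sub>2 x \<in> n\<^sub>2 H\<close> and \<open>w\<^sub>1 w\<^sub>2 x \<in> n\<^sub>1 H\<close>, with \<open>w\<^sub>2 n = n\<^sub>2 u\<^sub>2\<close> and \<open>w\<^sub>1 n\<^sub>2 = n\<^sub>1 u\<^sub>1\<close>. After composition with
  the isomorphism \<open>\<nu>\<close> at \<open>(n\<^sub>1, u\<^sub>1 u\<^sub>2)\<close>, three uses of the associativity of \<open>\<nu>\<close>, for the triples
  \<open>(n\<^sub>1, u\<^sub>1, u\<^sub>2)\<close>, \<open>(w\<^sub>1, n\<^sub>2, u\<^sub>2)\<close> and \<open>(w\<^sub>1, w\<^sub>2, n)\<close>, turn one side into the other.\<close>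

lemma transition_cocycle:
  assumes w1: "w1 \<in> carrier W" and w2: "w2 \<in> carrier W" and x: "x \<in> carrier W"
    and A: "A \<in> obj (C (tail x))"
    and y: "w2 \<otimes> x = y" and z: "w1 \<otimes> y = z"
  shows "on_arr (\<Phi> (rep z) (tail z)) (\<nu> (tail (w1 \<otimes> rep y)) (tail (w2 \<otimes> rep x)) (tail x) A)
      \<cdot>\<^bsub>C z\<^esub> (transition w1 y (on_obj (\<Phi> (tail (w2 \<otimes> rep x)) (tail x)) A)
        \<cdot>\<^bsub>C z\<^esub> on_arr (\<Phi> w1 y) (transition w2 x A))
    = transition (w1 \<otimes> w2) x A \<cdot>\<^bsub>C z\<^esub> \<nu> w1 w2 x (on_obj (\<Phi> (rep x) (tail x)) A)"
proof -
  define n u n2 u2 n1 u1 where d: "n = rep x" "u = tail x" "n2 = rep y" "u2 = tail (w2 \<otimes> n)"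
    "n1 = rep z" "u1 = tail (w1 \<otimes> n2)"
  have yc: "y \<in> carrier W" and zc: "z \<in> carrier W" using w1 w2 x y z by auto
  have w12: "w1 \<otimes> w2 \<in> carrier W" and w12x: "(w1 \<otimes> w2) \<otimes> x = z"
    using w1 w2 x y z by (auto simp: m_assoc)
  have n: "n \<in> carrier W" and n2: "n2 \<in> carrier W" and n1: "n1 \<in> carrier W"
    using d rep_closed x yc zc by auto
  have uH: "u \<in> H" and u2H: "u2 \<in> H" and u1H: "u1 \<in> H"
    using d tail_closed x m_closed[OF w2 n] m_closed[OF w1 n2] by auto
  have u: "u \<in> carrier W" and u2: "u2 \<in> carrier W" and u1: "u1 \<in> carrier W" using uH u2H u1H H_closed by auto
  have nu: "n \<otimes> u = x" using rep_tail[OF x] d by simp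
  have ty: "u2 \<otimes> u = tail y" using tail_mult[OF w2 x] d y by simp
  have n2y: "n2 \<otimes> tail y = y" using rep_tail[OF yc] d by simp
  have tz: "u1 \<otimes> tail y = tail z" using tail_mult[OF w1 yc] d z by simp
  have n1z: "n1 \<otimes> tail z = z" using rep_tail[OF zc] d by simp
  have n2u2: "n2 \<otimes> u2 = w2 \<otimes> n" using rep_mult_tail_mult_rep[OF w2 x] d y by simp
  have n1u1: "n1 \<otimes> u1 = w1 \<otimes> n2" using rep_mult_tail_mult_rep[OF w1 yc] d z by simp
  have u12: "tail ((w1 \<otimes> w2) \<otimes> n) = u1 \<otimes> u2"
  proof -
    have "tail (w1 \<otimes> (w2 \<otimes> n)) = tail (w1 \<otimes> rep (w2 \<otimes> n)) \<otimes> tail (w2 \<otimes> n)"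
      by (rule tail_mult[OF w1 m_closed[OF w2 n]])
    then show ?thesis using rep_mult_rep[OF w2 x] d y m_assoc[OF w1 w2 n] by simp
  qed
  have u12H: "u1 \<otimes> u2 \<in> H" and tyH: "tail y \<in> H" using u1H u2H tail_closed yc by auto
  note u12c = H_closed[OF u12H] and tyc = H_closed[OF tyH] and tzc = H_closed[OF tail_closed[OF zc]]
  have u12u: "(u1 \<otimes> u2) \<otimes> u = tail z" using tz ty m_assoc[OF u1 u2 u] by simp
  have w2n: "w2 \<otimes> n \<in> carrier W" and w1n2: "w1 \<otimes> n2 \<in> carrier W" using w1 w2 n n2 by auto
  have w2nu: "(w2 \<otimes> n) \<otimes> u = y" using m_assoc[OF w2 n u] nu y by simp
  have w1n2y: "(w1 \<otimes> n2) \<otimes> tail y = z" using m_assoc[OF w1 n2 tyc] n2y z by simp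
  have n1u12: "n1 \<otimes> (u1 \<otimes> u2) = w1 \<otimes> w2 \<otimes> n"
    using m_assoc[OF n1 u1 u2] m_assoc[OF w1 n2 u2] m_assoc[OF w1 w2 n] n1u1 n2u2 by simp
  have w1n2u2: "(w1 \<otimes> n2) \<otimes> u2 = w1 \<otimes> w2 \<otimes> n"
    using m_assoc[OF w1 n2 u2] m_assoc[OF w1 w2 n] n2u2 by simp
  interpret D: category "C z" by (rule category_at[OF zc])
  have Au: "A \<in> obj (C u)" using A d by simp
  define A2 where "A2 = on_obj (\<Phi> u2 u) A"
  define An where "An = on_obj (\<Phi> n u) A"
  have A2: "A2 \<in> obj (C (tail y))" unfolding A2_def by (rule \<Phi>_obj[OF Au u2 u ty])
  have An: "An \<in> obj (C x)" unfolding An_def by (rule \<Phi>_obj[OF Au n u nu])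
  define k2 where "k2 = transition w2 x A"
  define k1 where "k1 = transition w1 y A2"
  define k12 where "k12 = transition (w1 \<otimes> w2) x A"
  have k2: "k2 \<in> homset (C y) (on_obj (\<Phi> w2 x) An) (on_obj (\<Phi> n2 (tail y)) A2)"
    and \<nu>k2: "\<nu> n2 u2 u A \<cdot>\<^bsub>C y\<^esub> k2 = \<nu> w2 n u A"
    using transition_hom[OF w2 x A] \<nu>_transition[OF w2 x A] unfolding k2_def An_def A2_def y d by blast+
  have k1: "k1 \<in> homset (C z) (on_obj (\<Phi> w1 y) (on_obj (\<Phi> n2 (tail y)) A2))
      (on_obj (\<Phi> n1 (tail z)) (on_obj (\<Phi> u1 (tail y)) A2))"
    and \<nu>k1: "\<nu> n1 u1 (tail y) A2 \<cdot>\<^bsub>C z\<^esub> k1 = \<nu> w1 n2 (tail y) A2"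
    using transition_hom[OF w1 yc A2] \<nu>_transition[OF w1 yc A2] unfolding k1_def z d by blast+
  have k12: "k12 \<in> homset (C z) (on_obj (\<Phi> (w1 \<otimes> w2) x) An)
      (on_obj (\<Phi> n1 (tail z)) (on_obj (\<Phi> (u1 \<otimes> u2) u) A))"
    and \<nu>k12: "\<nu> n1 (u1 \<otimes> u2) u A \<cdot>\<^bsub>C z\<^esub> k12 = \<nu> (w1 \<otimes> w2) n u A"
    using transition_hom[OF w12 x A] \<nu>_transition[OF w12 x A]
    unfolding k12_def An_def w12x d(1,2,5)[symmetric] u12 by blast+
  have \<Phi>k2: "on_arr (\<Phi> w1 y) k2 \<in> homset (C z) (on_obj (\<Phi> w1 y) (on_obj (\<Phi> w2 x) An))
      (on_obj (\<Phi> w1 y) (on_obj (\<Phi> n2 (tail y)) A2))"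
    by (rule \<Phi>_hom[OF k2 w1 yc z])
  have N: "\<nu> n1 (u1 \<otimes> u2) u A \<in> homset (C z)
      (on_obj (\<Phi> n1 (tail z)) (on_obj (\<Phi> (u1 \<otimes> u2) u) A)) (on_obj (\<Phi> (w1 \<otimes> w2 \<otimes> n) u) A)"
    by (rule \<nu>_hom[OF Au n1 u12c u u12u n1z n1u12])
  have M: "on_arr (\<Phi> n1 (tail z)) (\<nu> u1 u2 u A) \<in> homset (C z)
      (on_obj (\<Phi> n1 (tail z)) (on_obj (\<Phi> u1 (tail y)) A2))
      (on_obj (\<Phi> n1 (tail z)) (on_obj (\<Phi> (u1 \<otimes> u2) u) A))"
    unfolding A2_def by (rule \<Phi>_hom[OF \<nu>_hom[OF Au u1 u2 u ty tz HOL.refl] n1 tzc n1z])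
  have V: "\<nu> w1 w2 x An \<in> homset (C z)
      (on_obj (\<Phi> w1 y) (on_obj (\<Phi> w2 x) An)) (on_obj (\<Phi> (w1 \<otimes> w2) x) An)"
    by (rule \<nu>_hom[OF An w1 w2 x y z HOL.refl])
  have P: "\<nu> n1 u1 (tail y) A2 \<in> homset (C z)
      (on_obj (\<Phi> n1 (tail z)) (on_obj (\<Phi> u1 (tail y)) A2)) (on_obj (\<Phi> (w1 \<otimes> n2) (tail y)) A2)"
    by (rule \<nu>_hom[OF A2 n1 u1 tyc tz n1z n1u1])
  have Q: "\<nu> (w1 \<otimes> n2) u2 u A \<in> homset (C z)
      (on_obj (\<Phi> (w1 \<otimes> n2) (tail y)) A2) (on_obj (\<Phi> (w1 \<otimes> w2 \<otimes> n) u) A)"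
    unfolding A2_def by (rule \<nu>_hom[OF Au w1n2 u2 u ty w1n2y w1n2u2])
  have R: "\<nu> w1 n2 (tail y) A2 \<in> homset (C z)
      (on_obj (\<Phi> w1 y) (on_obj (\<Phi> n2 (tail y)) A2)) (on_obj (\<Phi> (w1 \<otimes> n2) (tail y)) A2)"
    by (rule \<nu>_hom[OF A2 w1 n2 tyc n2y z HOL.refl])
  have T: "\<nu> n2 u2 u A \<in> homset (C y) (on_obj (\<Phi> n2 (tail y)) A2) (on_obj (\<Phi> (w2 \<otimes> n) u) A)"
    unfolding A2_def by (rule \<nu>_hom[OF Au n2 u2 u ty n2y n2u2])
  have \<Phi>T: "on_arr (\<Phi> w1 y) (\<nu> n2 u2 u A) \<in> homset (C z)
      (on_obj (\<Phi> w1 y) (on_obj (\<Phi> n2 (tail y)) A2)) (on_obj (\<Phi> w1 y) (on_obj (\<Phi> (w2 \<otimes> n) u) A))"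
    by (rule \<Phi>_hom[OF T w1 yc z])
  have U: "\<nu> w1 (w2 \<otimes> n) u A \<in> homset (C z)
      (on_obj (\<Phi> w1 y) (on_obj (\<Phi> (w2 \<otimes> n) u) A)) (on_obj (\<Phi> (w1 \<otimes> w2 \<otimes> n) u) A)"
    by (rule \<nu>_hom[OF Au w1 w2n u w2nu z m_assoc[OF w1 w2 n, symmetric]])
  have "on_arr (\<Phi> n1 (tail z)) (\<nu> u1 u2 u A) \<cdot>\<^bsub>C z\<^esub> (k1 \<cdot>\<^bsub>C z\<^esub> on_arr (\<Phi> w1 y) k2)
      = k12 \<cdot>\<^bsub>C z\<^esub> \<nu> w1 w2 x An"
  proof (rule \<nu>_rep_left_cancel[OF zc u12H uH Au u12u n1z[unfolded d(5)], folded d(5)])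
    note k1k2 = D.comp_in_homset[OF \<Phi>k2 k1]
    show "on_arr (\<Phi> n1 (tail z)) (\<nu> u1 u2 u A) \<cdot>\<^bsub>C z\<^esub> (k1 \<cdot>\<^bsub>C z\<^esub> on_arr (\<Phi> w1 y) k2) \<in> homset (C z)
        (on_obj (\<Phi> w1 y) (on_obj (\<Phi> w2 x) An)) (on_obj (\<Phi> n1 (tail z)) (on_obj (\<Phi> (u1 \<otimes> u2) u) A))"
      by (rule D.comp_in_homset[OF k1k2 M])
    show "k12 \<cdot>\<^bsub>C z\<^esub> \<nu> w1 w2 x An \<in> homset (C z)
        (on_obj (\<Phi> w1 y) (on_obj (\<Phi> w2 x) An)) (on_obj (\<Phi> n1 (tail z)) (on_obj (\<Phi> (u1 \<otimes> u2) u) A))"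
      by (rule D.comp_in_homset[OF V k12])
    have "\<nu> n1 (u1 \<otimes> u2) u A \<cdot>\<^bsub>C z\<^esub>
          (on_arr (\<Phi> n1 (tail z)) (\<nu> u1 u2 u A) \<cdot>\<^bsub>C z\<^esub> (k1 \<cdot>\<^bsub>C z\<^esub> on_arr (\<Phi> w1 y) k2))
        = (\<nu> (w1 \<otimes> n2) u2 u A \<cdot>\<^bsub>C z\<^esub> \<nu> n1 u1 (tail y) A2) \<cdot>\<^bsub>C z\<^esub> (k1 \<cdot>\<^bsub>C z\<^esub> on_arr (\<Phi> w1 y) k2)"
      using D.comp_assoc[OF k1k2 M N]
        \<nu>_associativity[OF Au n1 u1 u2 u ty tz n1z n1u1 HOL.refl] unfolding A2_def by simp
    also have "\<dots> = \<nu> (w1 \<otimes> n2) u2 u A \<cdot>\<^bsub>C z\<^esub> (\<nu> w1 n2 (tail y) A2 \<cdot>\<^bsub>C z\<^esub> on_arr (\<Phi> w1 y) k2)"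
      using D.comp_assoc[OF k1k2 P Q] D.comp_assoc[OF \<Phi>k2 k1 P] \<nu>k1 by simp
    also have "\<dots> = (\<nu> w1 (w2 \<otimes> n) u A \<cdot>\<^bsub>C z\<^esub> on_arr (\<Phi> w1 y) (\<nu> n2 u2 u A)) \<cdot>\<^bsub>C z\<^esub> on_arr (\<Phi> w1 y) k2"
      using D.comp_assoc[OF \<Phi>k2 R Q] \<nu>_associativity[OF Au w1 n2 u2 u ty n2y z HOL.refl n2u2]
      unfolding A2_def by simp
    also have "\<dots> = \<nu> w1 (w2 \<otimes> n) u A \<cdot>\<^bsub>C z\<^esub> on_arr (\<Phi> w1 y) (\<nu> w2 n u A)"
      using D.comp_assoc[OF \<Phi>k2 \<Phi>T U] \<Phi>_comp[OF k2 T w1 yc z] \<nu>k2 by simp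
    also have "\<dots> = \<nu> (w1 \<otimes> w2) n u A \<cdot>\<^bsub>C z\<^esub> \<nu> w1 w2 x An"
      using \<nu>_associativity[OF Au w1 w2 n u nu y z HOL.refl HOL.refl] unfolding An_def by simp
    also have "\<dots> = \<nu> n1 (u1 \<otimes> u2) u A \<cdot>\<^bsub>C z\<^esub> (k12 \<cdot>\<^bsub>C z\<^esub> \<nu> w1 w2 x An)"
      using D.comp_assoc[OF V k12 N] \<nu>k12 by simp
    finally show "\<nu> n1 (u1 \<otimes> u2) u A \<cdot>\<^bsub>C z\<^esub>
          (on_arr (\<Phi> n1 (tail z)) (\<nu> u1 u2 u A) \<cdot>\<^bsub>C z\<^esub> (k1 \<cdot>\<^bsub>C z\<^esub> on_arr (\<Phi> w1 y) k2))
        = \<nu> n1 (u1 \<otimes> u2) u A \<cdot>\<^bsub>C z\<^esub> (k12 \<cdot>\<^bsub>C z\<^esub> \<nu> w1 w2 x An)" .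
  qed
  then show ?thesis unfolding k1_def k2_def k12_def A2_def An_def d .
qed

section \<open>The extension functor and the equivalence\<close>

definition restriction :: "(('w, 'o, 'm) glued_object, ('w, 'o, 'm) glued_arrow,
    ('w, 'o, 'm) glued_object, ('w, 'o, 'm) glued_arrow) functor_data" where
  "restriction = \<lparr>on_obj = (\<lambda>(A, \<alpha>). (restrict A H, restrict \<alpha> (glue_index W H))),
     on_arr = (\<lambda>((A, \<alpha>), (B, \<beta>), f).
       ((restrict A H, restrict \<alpha> (glue_index W H)), (restrict B H, restrict \<beta> (glue_index W H)), restrict f H))\<rparr>"

definition extend_family :: "('w \<Rightarrow> 'o) \<Rightarrow> 'w \<Rightarrow> 'o" where
  "extend_family A = (\<lambda>w\<in>carrier W. on_obj (\<Phi> (rep w) (tail w)) (A (tail w)))"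

text \<open>With \<open>x = n u\<close> and \<open>w n = m v\<close> this is \<open>\<Phi>\<^sub>m(\<alpha>\<^sub>v\<^sub>,\<^sub>u)\<close> after the transition; the targets match because
  \<open>w x = m v u\<close>, so that \<open>v u\<close> is the tail of \<open>w x\<close>.\<close>

definition extend_maps :: "('w \<Rightarrow> 'o) \<Rightarrow> ('w \<times> 'w \<Rightarrow> 'm) \<Rightarrow> 'w \<times> 'w \<Rightarrow> 'm" where
  "extend_maps A \<alpha> = (\<lambda>(w, x)\<in>glue_index W (carrier W).
     on_arr (\<Phi> (rep (w \<otimes> x)) (tail (w \<otimes> x))) (\<alpha> (tail (w \<otimes> rep x), tail x))
       \<cdot>\<^bsub>C (w \<otimes> x)\<^esub> transition w x (A (tail x)))"

definition extend_components :: "('w \<Rightarrow> 'm) \<Rightarrow> 'w \<Rightarrow> 'm" where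
  "extend_components f = (\<lambda>w\<in>carrier W. on_arr (\<Phi> (rep w) (tail w)) (f (tail w)))"

definition extension :: "(('w, 'o, 'm) glued_object, ('w, 'o, 'm) glued_arrow,
    ('w, 'o, 'm) glued_object, ('w, 'o, 'm) glued_arrow) functor_data" where
  "extension = \<lparr>on_obj = (\<lambda>(A, \<alpha>). (extend_family A, extend_maps A \<alpha>)),
     on_arr = (\<lambda>((A, \<alpha>), (B, \<beta>), f).
       ((extend_family A, extend_maps A \<alpha>), (extend_family B, extend_maps B \<beta>), extend_components f))\<rparr>"

lemma H_subset: "H \<subseteq> carrier W"
  by (rule sub.subset)

lemma left_factor_in_subgroup:
  assumes "w \<in> carrier W" "v \<in> H" "w \<otimes> v \<in> H"
  shows "w \<in> H"
proof -
  have "(w \<otimes> v) \<otimes> inv v \<in> H" using assms by blast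
  then show ?thesis using assms H_closed by (simp add: m_assoc)
qed

lemma restrict_glued_object:
  assumes X: "(A, \<alpha>) \<in> glued_objects W C \<Phi> \<nu> (carrier W)"
  shows "(restrict A H, restrict \<alpha> (glue_index W H)) \<in> glued_objects W C \<Phi> \<nu> H"
proof (rule glued_objectI[OF H_subset])
  show "restrict A H w \<in> obj (C w)" if "w \<in> H" for w
    using glued_object_obj[OF X] that H_closed by simp
  show "restrict \<alpha> (glue_index W H) (w, v) \<in> homset (C x) (on_obj (\<Phi> w v) (restrict A H v)) (restrict A H x)"
    if "w \<in> carrier W" "v \<in> H" "w \<otimes> v = x" "x \<in> H" for w v x
    using glued_object_hom[OF X, of w v x] that H_closed by (simp add: glue_index_def)
  show "restrict \<alpha> (glue_index W H) (\<one>, v) = ident (C v) (restrict A H v)" if "v \<in> H" for v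
    using glued_object_one[OF X] that H_closed by (simp add: glue_index_def)
  show "restrict \<alpha> (glue_index W H) (w1, y) \<cdot>\<^bsub>C x\<^esub> on_arr (\<Phi> w1 y) (restrict \<alpha> (glue_index W H) (w2, v))
      = restrict \<alpha> (glue_index W H) (w1 \<otimes> w2, v) \<cdot>\<^bsub>C x\<^esub> \<nu> w1 w2 v (restrict A H v)"
    if h: "w1 \<in> carrier W" "w2 \<in> carrier W" "v \<in> H" "w2 \<otimes> v = y" "y \<in> H" "w1 \<otimes> y = x" "x \<in> H" for w1 w2 v y x
  proof -
    have "w1 \<otimes> w2 \<otimes> v = x" using h H_closed m_assoc[of w1 w2 v] by simp
    then show ?thesis
      using glued_object_assoc[OF X subset_refl h(1,2) H_closed[OF h(3)] h(4) H_closed[OF h(5)] h(6)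
          H_closed[OF h(7)] HOL.refl] h
      by (simp add: glue_index_def)
  qed
qed simp_all

lemma restrict_glued_arrow:
  assumes f: "((A, \<alpha>), (B, \<beta>), f) \<in> glued_arrows W C \<Phi> \<nu> (carrier W)"
  shows "((restrict A H, restrict \<alpha> (glue_index W H)), (restrict B H, restrict \<beta> (glue_index W H)), restrict f H)
    \<in> glued_arrows W C \<Phi> \<nu> H"
  using restrict_glued_object[OF glued_arrow_src[OF f]] restrict_glued_object[OF glued_arrow_tgt[OF f]]
proof (rule glued_arrowI)
  show "restrict f H w \<in> homset (C w) (restrict A H w) (restrict B H w)" if "w \<in> H" for w
    using glued_arrow_hom[OF f] that H_closed by simp
  show "restrict \<beta> (glue_index W H) (w, v) \<cdot>\<^bsub>C x\<^esub> on_arr (\<Phi> w v) (restrict f H v)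
      = restrict f H x \<cdot>\<^bsub>C x\<^esub> restrict \<alpha> (glue_index W H) (w, v)"
    if "w \<in> carrier W" "v \<in> H" "w \<otimes> v = x" "x \<in> H" for w v x
    using glued_arrow_comm[OF f, of w v x] that H_closed by (simp add: glue_index_def)
qed simp

text \<open>For associativity, naturality of the transition moves it past the inner gluing map; what remains
  is the associativity of \<open>\<alpha>\<close> in \<open>H\<close> under the functor of the representative, and the cocycle
  property of the transition.\<close>

lemma extend_glued_object:
  assumes X: "(A, \<alpha>) \<in> glued_objects W C \<Phi> \<nu> H"
  shows "(extend_family A, extend_maps A \<alpha>) \<in> glued_objects W C \<Phi> \<nu> (carrier W)"
proof (rule glued_objectI)
  have A: "A (tail w) \<in> obj (C (tail w))" if "w \<in> carrier W" for w
    using glued_object_obj[OF X] tail_closed that by blast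
  show "extend_family A w \<in> obj (C w)" if w: "w \<in> carrier W" for w
    using \<Phi>_obj[OF A[OF w] rep_closed[OF w] H_closed[OF tail_closed[OF w]] rep_tail[OF w]] w
    by (simp add: extend_family_def)
  have \<alpha>: "on_arr (\<Phi> (rep (w \<otimes> x)) (tail (w \<otimes> x))) (\<alpha> (tail (w \<otimes> rep x), tail x)) \<in> homset (C (w \<otimes> x))
      (on_obj (\<Phi> (rep (w \<otimes> x)) (tail (w \<otimes> x))) (on_obj (\<Phi> (tail (w \<otimes> rep x)) (tail x)) (A (tail x))))
      (on_obj (\<Phi> (rep (w \<otimes> x)) (tail (w \<otimes> x))) (A (tail (w \<otimes> x))))"
    if w: "w \<in> carrier W" and x: "x \<in> carrier W" for w x
  proof -
    note wx = m_closed[OF w x] and v = tail_closed[OF m_closed[OF w rep_closed[OF x]]]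
    show ?thesis
      by (rule \<Phi>_hom[OF glued_object_hom[OF X H_closed[OF v] tail_closed[OF x]
          tail_mult[OF w x, symmetric] tail_closed[OF wx]] rep_closed[OF wx]
          H_closed[OF tail_closed[OF wx]] rep_tail[OF wx]])
  qed
  show "extend_maps A \<alpha> (w, x) \<in> homset (C z) (on_obj (\<Phi> w x) (extend_family A x)) (extend_family A z)"
    if w: "w \<in> carrier W" and x: "x \<in> carrier W" and z: "w \<otimes> x = z" for w x z
    using category.comp_in_homset[OF category_at[OF m_closed[OF w x]] transition_hom[OF w x A[OF x]] \<alpha>[OF w x]] w x z
    by (auto simp: extend_maps_def extend_family_def glue_index_def)
  show "extend_maps A \<alpha> (\<one>, v) = ident (C v) (extend_family A v)" if v: "v \<in> carrier W" for v
  proof -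
    interpret D: category "C v" by (rule category_at[OF v])
    note c = rep_closed[OF v] H_closed[OF tail_closed[OF v]] rep_tail[OF v]
    have "\<alpha> (\<one>, tail v) = ident (C (tail v)) (A (tail v))"
      by (rule glued_object_one[OF X tail_closed[OF v]])
    then show ?thesis
      using v c tail_rep[OF v] transition_one[OF v A[OF v]] \<Phi>_ident[OF A[OF v] c]
        D.ident_comp[OF D.ident_closed[OF \<Phi>_obj[OF A[OF v] c]]]
      by (simp add: extend_maps_def extend_family_def glue_index_def)
  qed
  show "extend_maps A \<alpha> (w1, y) \<cdot>\<^bsub>C z\<^esub> on_arr (\<Phi> w1 y) (extend_maps A \<alpha> (w2, x))
      = extend_maps A \<alpha> (w1 \<otimes> w2, x) \<cdot>\<^bsub>C z\<^esub> \<nu> w1 w2 x (extend_family A x)"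
    if w1: "w1 \<in> carrier W" and w2: "w2 \<in> carrier W" and x: "x \<in> carrier W" and y: "w2 \<otimes> x = y"
      and yc: "y \<in> carrier W" and z: "w1 \<otimes> y = z" and zc: "z \<in> carrier W" for w1 w2 x y z
  proof -
    define n u n2 u2 n1 u1 where d: "n = rep x" "u = tail x" "n2 = rep y" "u2 = tail (w2 \<otimes> n)"
      "n1 = rep z" "u1 = tail (w1 \<otimes> n2)"
    have w12: "w1 \<otimes> w2 \<in> carrier W" and w12x: "w1 \<otimes> w2 \<otimes> x = z" using w1 w2 x y z by (auto simp: m_assoc)
    have uH: "u \<in> H" and u2H: "u2 \<in> H" and u1H: "u1 \<in> H" and tyH: "tail y \<in> H" and tzH: "tail z \<in> H"
      using d tail_closed x yc zc m_closed[OF w2 rep_closed[OF x]] m_closed[OF w1 rep_closed[OF yc]] by auto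
    note u = H_closed[OF uH] and u2 = H_closed[OF u2H] and u1 = H_closed[OF u1H]
      and ty = H_closed[OF tyH] and tz = H_closed[OF tzH]
    have n2: "n2 \<in> carrier W" and n1: "n1 \<in> carrier W" using d rep_closed yc zc by auto
    have u2u: "u2 \<otimes> u = tail y" using tail_mult[OF w2 x] d y by simp
    have u1ty: "u1 \<otimes> tail y = tail z" using tail_mult[OF w1 yc] d z by simp
    have n2y: "n2 \<otimes> tail y = y" and n1z: "n1 \<otimes> tail z = z" using rep_tail yc zc d by auto
    have u12: "tail ((w1 \<otimes> w2) \<otimes> n) = u1 \<otimes> u2"
    proof -
      have n: "n \<in> carrier W" using d rep_closed x by simp
      have "tail (w1 \<otimes> (w2 \<otimes> n)) = tail (w1 \<otimes> rep (w2 \<otimes> n)) \<otimes> tail (w2 \<otimes> n)"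
        by (rule tail_mult[OF w1 m_closed[OF w2 n]])
      then show ?thesis using rep_mult_rep[OF w2 x] d y m_assoc[OF w1 w2 n] by simp
    qed
    have u12u: "(u1 \<otimes> u2) \<otimes> u = tail z" using u1ty u2u m_assoc[OF u1 u2 u] by simp
    have u12H: "u1 \<otimes> u2 \<in> H" using u1H u2H by simp
    interpret D: category "C z" by (rule category_at[OF zc])
    interpret Y: category "C y" by (rule category_at[OF yc])
    define A2 where "A2 = on_obj (\<Phi> u2 u) (A u)"
    define An where "An = on_obj (\<Phi> (rep x) u) (A u)"
    have Au: "A u \<in> obj (C u)" using A[OF x] d by simp
    have A2: "A2 \<in> obj (C (tail y))" unfolding A2_def by (rule \<Phi>_obj[OF Au u2 u u2u])
    have An: "An \<in> obj (C x)" unfolding An_def using \<Phi>_obj[OF Au rep_closed[OF x] u] rep_tail[OF x] d by simp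
    define k1 k2 k12 where k: "k1 = transition w1 y (A (tail y))" "k2 = transition w2 x (A u)"
      "k12 = transition (w1 \<otimes> w2) x (A u)"
    define k1' where "k1' = transition w1 y A2"
    have a2: "\<alpha> (u2, u) \<in> homset (C (tail y)) A2 (A (tail y))"
      unfolding A2_def by (rule glued_object_hom[OF X u2 uH u2u tyH])
    have a1: "\<alpha> (u1, tail y) \<in> homset (C (tail z)) (on_obj (\<Phi> u1 (tail y)) (A (tail y))) (A (tail z))"
      by (rule glued_object_hom[OF X u1 tyH u1ty tzH])
    have a12: "\<alpha> (u1 \<otimes> u2, u) \<in> homset (C (tail z)) (on_obj (\<Phi> (u1 \<otimes> u2) u) (A u)) (A (tail z))"
      by (rule glued_object_hom[OF X H_closed[OF u12H] uH u12u tzH])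
    have N: "\<nu> u1 u2 u (A u) \<in> homset (C (tail z)) (on_obj (\<Phi> u1 (tail y)) A2) (on_obj (\<Phi> (u1 \<otimes> u2) u) (A u))"
      unfolding A2_def by (rule \<nu>_hom[OF Au u1 u2 u u2u u1ty HOL.refl])
    have k1h: "k1 \<in> homset (C z) (on_obj (\<Phi> w1 y) (on_obj (\<Phi> n2 (tail y)) (A (tail y))))
        (on_obj (\<Phi> n1 (tail z)) (on_obj (\<Phi> u1 (tail y)) (A (tail y))))"
      using transition_hom[OF w1 yc A[OF yc]] unfolding k z d .
    have k1'h: "k1' \<in> homset (C z) (on_obj (\<Phi> w1 y) (on_obj (\<Phi> n2 (tail y)) A2))
        (on_obj (\<Phi> n1 (tail z)) (on_obj (\<Phi> u1 (tail y)) A2))"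
      using transition_hom[OF w1 yc A2] unfolding k1'_def z d .
    have k2h: "k2 \<in> homset (C y) (on_obj (\<Phi> w2 x) An) (on_obj (\<Phi> n2 (tail y)) A2)"
      using transition_hom[OF w2 x A[OF x]] unfolding k An_def A2_def y d .
    have k12h: "k12 \<in> homset (C z) (on_obj (\<Phi> (w1 \<otimes> w2) x) An)
        (on_obj (\<Phi> n1 (tail z)) (on_obj (\<Phi> (u1 \<otimes> u2) u) (A u)))"
      using transition_hom[OF w12 x A[OF x]]
      unfolding k An_def w12x d(1,2,5)[symmetric] u12 .
    have V: "\<nu> w1 w2 x An \<in> homset (C z) (on_obj (\<Phi> w1 y) (on_obj (\<Phi> w2 x) An)) (on_obj (\<Phi> (w1 \<otimes> w2) x) An)"
      by (rule \<nu>_hom[OF An w1 w2 x y z HOL.refl])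
    note \<Phi>a2 = \<Phi>_hom[OF a2 n2 ty n2y]
    note \<Phi>k2 = \<Phi>_hom[OF k2h w1 yc z]
    note \<Phi>\<Phi>a2 = \<Phi>_hom[OF \<Phi>a2 w1 yc z]
    note \<Phi>u1a2 = \<Phi>_hom[OF a2 u1 ty u1ty]
    note \<Phi>n1u1a2 = \<Phi>_hom[OF \<Phi>u1a2 n1 tz n1z]
    note \<Phi>a1 = \<Phi>_hom[OF a1 n1 tz n1z] and \<Phi>a12 = \<Phi>_hom[OF a12 n1 tz n1z] and \<Phi>N = \<Phi>_hom[OF N n1 tz n1z]
    note kk = D.comp_in_homset[OF \<Phi>k2 k1'h]
    let ?F = "on_arr (\<Phi> n1 (tail z))"
    have e1: "extend_maps A \<alpha> (w1, y) = ?F (\<alpha> (u1, tail y)) \<cdot>\<^bsub>C z\<^esub> k1"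
      using w1 yc z zc by (simp add: extend_maps_def glue_index_def d k)
    have e2: "extend_maps A \<alpha> (w2, x) = on_arr (\<Phi> n2 (tail y)) (\<alpha> (u2, u)) \<cdot>\<^bsub>C y\<^esub> k2"
      using w2 x y yc by (simp add: extend_maps_def glue_index_def d k)
    have e12: "extend_maps A \<alpha> (w1 \<otimes> w2, x) = ?F (\<alpha> (u1 \<otimes> u2, u)) \<cdot>\<^bsub>C z\<^esub> k12"
    proof -
      have "extend_maps A \<alpha> (w1 \<otimes> w2, x) = on_arr (\<Phi> (rep (w1 \<otimes> w2 \<otimes> x)) (tail (w1 \<otimes> w2 \<otimes> x)))
          (\<alpha> (tail (w1 \<otimes> w2 \<otimes> rep x), tail x)) \<cdot>\<^bsub>C (w1 \<otimes> w2 \<otimes> x)\<^esub> transition (w1 \<otimes> w2) x (A (tail x))"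
        using w12 x by (simp add: extend_maps_def glue_index_def)
      then show ?thesis unfolding w12x d(1,2,5)[symmetric] u12 k .
    qed
    have eA: "extend_family A x = An" using x by (simp add: extend_family_def An_def d)
    have nat: "k1 \<cdot>\<^bsub>C z\<^esub> on_arr (\<Phi> w1 y) (on_arr (\<Phi> n2 (tail y)) (\<alpha> (u2, u)))
        = ?F (on_arr (\<Phi> u1 (tail y)) (\<alpha> (u2, u))) \<cdot>\<^bsub>C z\<^esub> k1'"
      using transition_natural[OF w1 yc a2] unfolding k k1'_def z d .
    have coc: "?F (\<nu> u1 u2 u (A u)) \<cdot>\<^bsub>C z\<^esub> (k1' \<cdot>\<^bsub>C z\<^esub> on_arr (\<Phi> w1 y) k2) = k12 \<cdot>\<^bsub>C z\<^esub> \<nu> w1 w2 x An"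
      using transition_cocycle[OF w1 w2 x A[OF x] y z] unfolding k k1'_def A2_def An_def d .
    have aa: "\<alpha> (u1, tail y) \<cdot>\<^bsub>C (tail z)\<^esub> on_arr (\<Phi> u1 (tail y)) (\<alpha> (u2, u))
        = \<alpha> (u1 \<otimes> u2, u) \<cdot>\<^bsub>C (tail z)\<^esub> \<nu> u1 u2 u (A u)"
      by (rule glued_object_assoc[OF X H_subset u1 u2 uH u2u tyH u1ty tzH HOL.refl])
    have "extend_maps A \<alpha> (w1, y) \<cdot>\<^bsub>C z\<^esub> on_arr (\<Phi> w1 y) (extend_maps A \<alpha> (w2, x))
        = (?F (\<alpha> (u1, tail y)) \<cdot>\<^bsub>C z\<^esub> k1) \<cdot>\<^bsub>C z\<^esub>
          (on_arr (\<Phi> w1 y) (on_arr (\<Phi> n2 (tail y)) (\<alpha> (u2, u))) \<cdot>\<^bsub>C z\<^esub> on_arr (\<Phi> w1 y) k2)"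
      unfolding e1 e2 using \<Phi>_comp[OF k2h \<Phi>a2 w1 yc z] by simp
    also have "\<dots> = ?F (\<alpha> (u1, tail y)) \<cdot>\<^bsub>C z\<^esub>
        ((?F (on_arr (\<Phi> u1 (tail y)) (\<alpha> (u2, u))) \<cdot>\<^bsub>C z\<^esub> k1') \<cdot>\<^bsub>C z\<^esub> on_arr (\<Phi> w1 y) k2)"
      using D.comp_assoc[OF D.comp_in_homset[OF \<Phi>k2 \<Phi>\<Phi>a2] k1h \<Phi>a1] D.comp_assoc[OF \<Phi>k2 \<Phi>\<Phi>a2 k1h] nat
      by simp
    also have "\<dots> = (?F (\<alpha> (u1, tail y)) \<cdot>\<^bsub>C z\<^esub> ?F (on_arr (\<Phi> u1 (tail y)) (\<alpha> (u2, u)))) \<cdot>\<^bsub>C z\<^esub>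
        (k1' \<cdot>\<^bsub>C z\<^esub> on_arr (\<Phi> w1 y) k2)"
      using D.comp_assoc[OF \<Phi>k2 k1'h \<Phi>n1u1a2] D.comp_assoc[OF kk \<Phi>n1u1a2 \<Phi>a1] by simp
    also have "\<dots> = (?F (\<alpha> (u1 \<otimes> u2, u)) \<cdot>\<^bsub>C z\<^esub> ?F (\<nu> u1 u2 u (A u))) \<cdot>\<^bsub>C z\<^esub>
        (k1' \<cdot>\<^bsub>C z\<^esub> on_arr (\<Phi> w1 y) k2)"
      using \<Phi>_comp[OF \<Phi>u1a2 a1 n1 tz n1z] \<Phi>_comp[OF N a12 n1 tz n1z] aa by simp
    also have "\<dots> = ?F (\<alpha> (u1 \<otimes> u2, u)) \<cdot>\<^bsub>C z\<^esub> (k12 \<cdot>\<^bsub>C z\<^esub> \<nu> w1 w2 x An)"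
      using D.comp_assoc[OF kk \<Phi>N \<Phi>a12] coc by simp
    also have "\<dots> = extend_maps A \<alpha> (w1 \<otimes> w2, x) \<cdot>\<^bsub>C z\<^esub> \<nu> w1 w2 x (extend_family A x)"
      unfolding e12 eA using D.comp_assoc[OF V k12h \<Phi>a12] by simp
    finally show ?thesis .
  qed
qed (simp_all add: extend_family_def extend_maps_def)

lemma extend_glued_arrow:
  assumes f: "((A, \<alpha>), (B, \<beta>), f) \<in> glued_arrows W C \<Phi> \<nu> H"
  shows "((extend_family A, extend_maps A \<alpha>), (extend_family B, extend_maps B \<beta>), extend_components f)
    \<in> glued_arrows W C \<Phi> \<nu> (carrier W)"
  using extend_glued_object[OF glued_arrow_src[OF f]] extend_glued_object[OF glued_arrow_tgt[OF f]]
proof (rule glued_arrowI)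
  have ft: "f (tail w) \<in> homset (C (tail w)) (A (tail w)) (B (tail w))" if "w \<in> carrier W" for w
    using glued_arrow_hom[OF f] tail_closed that by blast
  have \<Phi>f: "on_arr (\<Phi> (rep w) (tail w)) (f (tail w)) \<in> homset (C w)
      (on_obj (\<Phi> (rep w) (tail w)) (A (tail w))) (on_obj (\<Phi> (rep w) (tail w)) (B (tail w)))"
    if w: "w \<in> carrier W" for w
    by (rule \<Phi>_hom[OF ft[OF w] rep_closed[OF w] H_closed[OF tail_closed[OF w]] rep_tail[OF w]])
  show "extend_components f w \<in> homset (C w) (extend_family A w) (extend_family B w)" if "w \<in> carrier W" for w
    using \<Phi>f[OF that] that by (simp add: extend_components_def extend_family_def)
  show "extend_maps B \<beta> (w, x) \<cdot>\<^bsub>C z\<^esub> on_arr (\<Phi> w x) (extend_components f x)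
      = extend_components f z \<cdot>\<^bsub>C z\<^esub> extend_maps A \<alpha> (w, x)"
    if w: "w \<in> carrier W" and x: "x \<in> carrier W" and z: "w \<otimes> x = z" and zc: "z \<in> carrier W" for w x z
  proof -
    define u v where d: "u = tail x" "v = tail (w \<otimes> rep x)"
    have uH: "u \<in> H" and vH: "v \<in> H" and tzH: "tail z \<in> H"
      using d tail_closed x zc m_closed[OF w rep_closed[OF x]] by auto
    note u = H_closed[OF uH] and v = H_closed[OF vH] and tz = H_closed[OF tzH]
    have vu: "v \<otimes> u = tail z" using tail_mult[OF w x] d z by simp
    note m = rep_closed[OF zc] and mz = rep_tail[OF zc]
    interpret D: category "C z" by (rule category_at[OF zc])
    let ?F = "on_arr (\<Phi> (rep z) (tail z))"
    note S = glued_arrow_src[OF f] and T = glued_arrow_tgt[OF f]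
    have fu: "f u \<in> homset (C u) (A u) (B u)" using ft[OF x] d by simp
    have au: "A u \<in> obj (C u)" and bu: "B u \<in> obj (C u)"
      using glued_object_obj[OF S uH] glued_object_obj[OF T uH] .
    have tA: "transition w x (A u) \<in> homset (C z) (on_obj (\<Phi> w x) (on_obj (\<Phi> (rep x) u) (A u)))
        (on_obj (\<Phi> (rep z) (tail z)) (on_obj (\<Phi> v u) (A u)))"
      and tB: "transition w x (B u) \<in> homset (C z) (on_obj (\<Phi> w x) (on_obj (\<Phi> (rep x) u) (B u)))
        (on_obj (\<Phi> (rep z) (tail z)) (on_obj (\<Phi> v u) (B u)))"
      using transition_hom[OF w x] au bu unfolding d z by blast+
    note ah = glued_object_hom[OF S v uH vu tzH] and bh = glued_object_hom[OF T v uH vu tzH]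
    note \<Phi>a = \<Phi>_hom[OF ah m tz mz] and \<Phi>b = \<Phi>_hom[OF bh m tz mz]
    note vf = \<Phi>_hom[OF fu v u vu]
    note \<Phi>vf = \<Phi>_hom[OF vf m tz mz]
    have wf: "on_arr (\<Phi> w x) (on_arr (\<Phi> (rep x) u) (f u)) \<in> homset (C z)
        (on_obj (\<Phi> w x) (on_obj (\<Phi> (rep x) u) (A u))) (on_obj (\<Phi> w x) (on_obj (\<Phi> (rep x) u) (B u)))"
      using \<Phi>_hom[OF \<Phi>f[OF x] w x z] d by simp
    note fz = glued_arrow_hom[OF f tzH]
    have "extend_maps B \<beta> (w, x) \<cdot>\<^bsub>C z\<^esub> on_arr (\<Phi> w x) (extend_components f x)
        = (?F (\<beta> (v, u)) \<cdot>\<^bsub>C z\<^esub> transition w x (B u)) \<cdot>\<^bsub>C z\<^esub> on_arr (\<Phi> w x) (on_arr (\<Phi> (rep x) u) (f u))"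
      using w x z zc by (simp add: extend_maps_def extend_components_def glue_index_def d)
    also have "\<dots> = ?F (\<beta> (v, u)) \<cdot>\<^bsub>C z\<^esub> (?F (on_arr (\<Phi> v u) (f u)) \<cdot>\<^bsub>C z\<^esub> transition w x (A u))"
      using D.comp_assoc[OF wf tB \<Phi>b] transition_natural[OF w x ft[OF x]] unfolding d z by simp
    also have "\<dots> = ?F (\<beta> (v, u) \<cdot>\<^bsub>C (tail z)\<^esub> on_arr (\<Phi> v u) (f u)) \<cdot>\<^bsub>C z\<^esub> transition w x (A u)"
      using D.comp_assoc[OF tA \<Phi>vf \<Phi>b] \<Phi>_comp[OF vf bh m tz mz] by simp
    also have "\<dots> = ?F (f (tail z) \<cdot>\<^bsub>C (tail z)\<^esub> \<alpha> (v, u)) \<cdot>\<^bsub>C z\<^esub> transition w x (A u)"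
      using glued_arrow_comm[OF f v uH vu tzH] by simp
    also have "\<dots> = ?F (f (tail z)) \<cdot>\<^bsub>C z\<^esub> (?F (\<alpha> (v, u)) \<cdot>\<^bsub>C z\<^esub> transition w x (A u))"
      using D.comp_assoc[OF tA \<Phi>a \<Phi>_hom[OF fz m tz mz]] \<Phi>_comp[OF ah fz m tz mz] by simp
    also have "\<dots> = extend_components f z \<cdot>\<^bsub>C z\<^esub> extend_maps A \<alpha> (w, x)"
      using w x z zc by (simp add: extend_maps_def extend_components_def glue_index_def d)
    finally show ?thesis .
  qed
qed (simp add: extend_components_def)

lemma restriction_functor:
  "is_functor (glued_category W C \<Phi> \<nu> (carrier W)) (glued_category W C \<Phi> \<nu> H) restriction"
  unfolding is_functor_def
proof (intro conjI ballI impI)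
  show "category (glued_category W C \<Phi> \<nu> (carrier W))" "category (glued_category W C \<Phi> \<nu> H)"
    using glued_category_is_category H_subset by auto
next
  fix X assume "X \<in> obj (glued_category W C \<Phi> \<nu> (carrier W))"
  then show "on_obj restriction X \<in> obj (glued_category W C \<Phi> \<nu> H)"
    by (cases X) (simp add: restriction_def restrict_glued_object)
  show "on_arr restriction (ident (glued_category W C \<Phi> \<nu> (carrier W)) X)
      = ident (glued_category W C \<Phi> \<nu> H) (on_obj restriction X)"
    using H_closed by (cases X) (auto simp: restriction_def fun_eq_iff)
next
  fix h assume "h \<in> arr (glued_category W C \<Phi> \<nu> (carrier W))"
  moreover obtain A \<alpha> B \<beta> f where "h = ((A, \<alpha>), (B, \<beta>), f)" by (metis prod.exhaust)
  ultimately show "on_arr restriction h \<in> homset (glued_category W C \<Phi> \<nu> H)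
      (on_obj restriction (src (glued_category W C \<Phi> \<nu> (carrier W)) h))
      (on_obj restriction (tgt (glued_category W C \<Phi> \<nu> (carrier W)) h))"
    using restrict_glued_arrow by (simp add: homset_glued_iff restriction_def)
next
  fix h k assume eq: "tgt (glued_category W C \<Phi> \<nu> (carrier W)) h = src (glued_category W C \<Phi> \<nu> (carrier W)) k"
  obtain A \<alpha> B \<beta> f where h: "h = ((A, \<alpha>), (B, \<beta>), f)" by (metis prod.exhaust)
  obtain X D \<delta> g where "k = (X, (D, \<delta>), g)" by (metis prod.exhaust)
  then have k: "k = ((B, \<beta>), (D, \<delta>), g)" using eq h by simp
  show "on_arr restriction (k \<cdot>\<^bsub>glued_category W C \<Phi> \<nu> (carrier W)\<^esub> h)
      = on_arr restriction k \<cdot>\<^bsub>glued_category W C \<Phi> \<nu> H\<^esub> on_arr restriction h"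
    using H_closed unfolding h k by (auto simp: restriction_def fun_eq_iff)
qed

lemma extension_functor:
  "is_functor (glued_category W C \<Phi> \<nu> H) (glued_category W C \<Phi> \<nu> (carrier W)) extension"
  unfolding is_functor_def
proof (intro conjI ballI impI)
  show "category (glued_category W C \<Phi> \<nu> (carrier W))" "category (glued_category W C \<Phi> \<nu> H)"
    using glued_category_is_category H_subset by auto
next
  fix X assume X: "X \<in> obj (glued_category W C \<Phi> \<nu> H)"
  obtain A \<alpha> where XA: "X = (A, \<alpha>)" by (cases X)
  then have A: "(A, \<alpha>) \<in> glued_objects W C \<Phi> \<nu> H" using X by simp
  show "on_obj extension X \<in> obj (glued_category W C \<Phi> \<nu> (carrier W))"
    using extend_glued_object[OF A] XA by (simp add: extension_def)
  have "extend_components (\<lambda>w\<in>H. ident (C w) (A w)) = (\<lambda>w\<in>carrier W. ident (C w) (extend_family A w))"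
    unfolding extend_components_def
  proof (rule restrict_ext)
    fix w assume w: "w \<in> carrier W"
    show "on_arr (\<Phi> (rep w) (tail w)) ((\<lambda>w\<in>H. ident (C w) (A w)) (tail w)) = ident (C w) (extend_family A w)"
      using \<Phi>_ident[OF glued_object_obj[OF A tail_closed[OF w]] rep_closed[OF w] H_closed[OF tail_closed[OF w]]
          rep_tail[OF w]] tail_closed[OF w] w by (simp add: extend_family_def)
  qed
  then show "on_arr extension (ident (glued_category W C \<Phi> \<nu> H) X)
      = ident (glued_category W C \<Phi> \<nu> (carrier W)) (on_obj extension X)"
    using XA by (simp add: extension_def)
next
  fix h assume "h \<in> arr (glued_category W C \<Phi> \<nu> H)"
  moreover obtain A \<alpha> B \<beta> f where "h = ((A, \<alpha>), (B, \<beta>), f)" by (metis prod.exhaust)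
  ultimately show "on_arr extension h \<in> homset (glued_category W C \<Phi> \<nu> (carrier W))
      (on_obj extension (src (glued_category W C \<Phi> \<nu> H) h)) (on_obj extension (tgt (glued_category W C \<Phi> \<nu> H) h))"
    using extend_glued_arrow by (simp add: homset_glued_iff extension_def)
next
  fix h k assume ha: "h \<in> arr (glued_category W C \<Phi> \<nu> H)" and ka: "k \<in> arr (glued_category W C \<Phi> \<nu> H)"
    and eq: "tgt (glued_category W C \<Phi> \<nu> H) h = src (glued_category W C \<Phi> \<nu> H) k"
  obtain A \<alpha> B \<beta> f where h: "h = ((A, \<alpha>), (B, \<beta>), f)" by (metis prod.exhaust)
  obtain X D \<delta> g where "k = (X, (D, \<delta>), g)" by (metis prod.exhaust)
  then have k: "k = ((B, \<beta>), (D, \<delta>), g)" using eq h by simp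
  have f: "((A, \<alpha>), (B, \<beta>), f) \<in> glued_arrows W C \<Phi> \<nu> H" and g: "((B, \<beta>), (D, \<delta>), g) \<in> glued_arrows W C \<Phi> \<nu> H"
    using ha ka h k by simp_all
  have "extend_components (\<lambda>w\<in>H. g w \<cdot>\<^bsub>C w\<^esub> f w)
      = (\<lambda>w\<in>carrier W. extend_components g w \<cdot>\<^bsub>C w\<^esub> extend_components f w)"
    unfolding extend_components_def
  proof (rule restrict_ext)
    fix w assume w: "w \<in> carrier W"
    note t = tail_closed[OF w]
    show "on_arr (\<Phi> (rep w) (tail w)) ((\<lambda>w\<in>H. g w \<cdot>\<^bsub>C w\<^esub> f w) (tail w))
      = (\<lambda>w\<in>carrier W. on_arr (\<Phi> (rep w) (tail w)) (g (tail w))) w \<cdot>\<^bsub>C w\<^esub>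
        (\<lambda>w\<in>carrier W. on_arr (\<Phi> (rep w) (tail w)) (f (tail w))) w"
      using \<Phi>_comp[OF glued_arrow_hom[OF f t] glued_arrow_hom[OF g t] rep_closed[OF w] H_closed[OF t] rep_tail[OF w]] t w
      by simp
  qed
  then show "on_arr extension (k \<cdot>\<^bsub>glued_category W C \<Phi> \<nu> H\<^esub> h)
      = on_arr extension k \<cdot>\<^bsub>glued_category W C \<Phi> \<nu> (carrier W)\<^esub> on_arr extension h"
    unfolding h k by (simp add: extension_def)
qed

lemma restrict_extend_object:
  assumes X: "(A, \<alpha>) \<in> glued_objects W C \<Phi> \<nu> H"
  shows "restrict (extend_family A) H = A"
    and "restrict (extend_maps A \<alpha>) (glue_index W H) = \<alpha>"
proof -
  have ext: "A \<in> extensional H" "\<alpha> \<in> extensional (glue_index W H)"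
    using X by (auto simp: glued_objects_def PiE_def)
  show "restrict (extend_family A) H = A"
  proof (rule extensional_arrow_eqI[OF ext(1)])
    fix w assume w: "w \<in> H"
    then show "extend_family A w = A w"
      using \<Phi>_one_obj[OF H_closed[OF w] glued_object_obj[OF X w]] H_closed[OF w]
      by (simp add: extend_family_def rep_subgroup tail_subgroup)
  qed
  show "restrict (extend_maps A \<alpha>) (glue_index W H) = \<alpha>"
  proof (rule extensional_arrow_eqI[OF ext(2)])
    fix p assume p: "p \<in> glue_index W H"
    then obtain w x where wx: "p = (w, x)" "w \<in> carrier W" "x \<in> H" "w \<otimes> x \<in> H"
      by (auto simp: glue_index_def)
    have w: "w \<in> H" using left_factor_in_subgroup wx by blast
    interpret D: category "C (w \<otimes> x)" by (rule category_at[OF H_closed[OF wx(4)]])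
    note a = glued_object_hom[OF X wx(2,3) HOL.refl wx(4)]
    have "\<alpha> (w, x) \<in> arr (C (w \<otimes> x))" using a by (simp add: homset_def)
    then show "extend_maps A \<alpha> p = \<alpha> p"
      using wx w H_closed D.comp_ident[OF a] transition_subgroup[OF w wx(3) glued_object_obj[OF X wx(3)]]
        \<Phi>_one_arr[OF H_closed[OF wx(4)]]
      by (simp add: extend_maps_def glue_index_def rep_subgroup tail_subgroup)
  qed
qed

lemma restrict_extend_components:
  assumes f: "((A, \<alpha>), (B, \<beta>), f) \<in> glued_arrows W C \<Phi> \<nu> H"
  shows "restrict (extend_components f) H = f"
proof (rule extensional_arrow_eqI[OF glued_arrow_ext[OF f]])
  fix w assume w: "w \<in> H"
  have "f w \<in> arr (C w)" using glued_arrow_hom[OF f w] by (simp add: homset_def)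
  then show "extend_components f w = f w"
    using \<Phi>_one_arr[OF H_closed[OF w]] w H_closed[OF w]
    by (simp add: extend_components_def rep_subgroup tail_subgroup)
qed

definition comparison :: "('w, 'o, 'm) glued_object \<Rightarrow> ('w, 'o, 'm) glued_arrow" where
  "comparison X = (on_obj (extension \<circ>\<^sub>F restriction) X, X, \<lambda>w\<in>carrier W. snd X (rep w, tail w))"

text \<open>Compatibility with the gluing maps is the associativity of \<open>\<alpha>\<close> used twice, for the two factorizations
  \<open>w n = m v\<close>; the transition is exactly the discrepancy between them.\<close>

lemma comparison_arrow:
  assumes X: "(A, \<alpha>) \<in> glued_objects W C \<Phi> \<nu> (carrier W)"
  shows "((extend_family (restrict A H), extend_maps (restrict A H) (restrict \<alpha> (glue_index W H))), (A, \<alpha>),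
      \<lambda>w\<in>carrier W. \<alpha> (rep w, tail w)) \<in> glued_arrows W C \<Phi> \<nu> (carrier W)"
  using extend_glued_object[OF restrict_glued_object[OF X]] X
proof (rule glued_arrowI)
  show "(\<lambda>w\<in>carrier W. \<alpha> (rep w, tail w)) w \<in> homset (C w) (extend_family (restrict A H) w) (A w)"
    if w: "w \<in> carrier W" for w
    using glued_object_hom[OF X rep_closed[OF w] H_closed[OF tail_closed[OF w]] rep_tail[OF w] w] w tail_closed[OF w]
    by (simp add: extend_family_def)
  show "\<alpha> (w, x) \<cdot>\<^bsub>C z\<^esub> on_arr (\<Phi> w x) ((\<lambda>w\<in>carrier W. \<alpha> (rep w, tail w)) x)
      = (\<lambda>w\<in>carrier W. \<alpha> (rep w, tail w)) z \<cdot>\<^bsub>C z\<^esub>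
        extend_maps (restrict A H) (restrict \<alpha> (glue_index W H)) (w, x)"
    if w: "w \<in> carrier W" and x: "x \<in> carrier W" and z: "w \<otimes> x = z" and zc: "z \<in> carrier W" for w x z
  proof -
    define n u v m where d: "n = rep x" "u = tail x" "v = tail (w \<otimes> rep x)" "m = rep z"
    have uH: "u \<in> H" and vH: "v \<in> H" and tzH: "tail z \<in> H"
      using d tail_closed x zc m_closed[OF w rep_closed[OF x]] by auto
    note u = H_closed[OF uH] and v = H_closed[OF vH] and tz = H_closed[OF tzH]
    have n: "n \<in> carrier W" and m: "m \<in> carrier W" using d rep_closed x zc by auto
    have vu: "v \<otimes> u = tail z" using tail_mult[OF w x] d z by simp
    have nu: "n \<otimes> u = x" and mz: "m \<otimes> tail z = z" using rep_tail x zc d by auto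
    have mv: "m \<otimes> v = w \<otimes> n" using rep_mult_tail_mult_rep[OF w x] d z by simp
    have wnu: "(w \<otimes> n) \<otimes> u = z" using m_assoc[OF w n u] nu z by simp
    interpret D: category "C z" by (rule category_at[OF zc])
    have Au: "A u \<in> obj (C u)" by (rule glued_object_obj[OF X u])
    have t: "transition w x (A u) \<in> homset (C z) (on_obj (\<Phi> w x) (on_obj (\<Phi> n u) (A u)))
        (on_obj (\<Phi> m (tail z)) (on_obj (\<Phi> v u) (A u)))"
      and \<nu>t: "\<nu> m v u (A u) \<cdot>\<^bsub>C z\<^esub> transition w x (A u) = \<nu> w n u (A u)"
      using transition_hom[OF w x] \<nu>_transition[OF w x] Au unfolding d z by blast+
    note av = glued_object_hom[OF X v u vu tz] and am = glued_object_hom[OF X m tz mz zc]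
    note amv = glued_object_hom[OF X m_closed[OF w n] u wnu zc]
    note \<Phi>av = \<Phi>_hom[OF av m tz mz]
    note N = \<nu>_hom[OF Au m v u vu mz mv]
    have "\<alpha> (w, x) \<cdot>\<^bsub>C z\<^esub> on_arr (\<Phi> w x) (\<alpha> (n, u)) = \<alpha> (w \<otimes> n, u) \<cdot>\<^bsub>C z\<^esub> \<nu> w n u (A u)"
      by (rule glued_object_assoc[OF X subset_refl w n u nu x z zc HOL.refl])
    also have "\<dots> = (\<alpha> (w \<otimes> n, u) \<cdot>\<^bsub>C z\<^esub> \<nu> m v u (A u)) \<cdot>\<^bsub>C z\<^esub> transition w x (A u)"
      using D.comp_assoc[OF t N amv] \<nu>t by simp
    also have "\<dots> = (\<alpha> (m, tail z) \<cdot>\<^bsub>C z\<^esub> on_arr (\<Phi> m (tail z)) (\<alpha> (v, u))) \<cdot>\<^bsub>C z\<^esub> transition w x (A u)"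
      using glued_object_assoc[OF X subset_refl m v u vu tz mz zc mv] by simp
    also have "\<dots> = \<alpha> (m, tail z) \<cdot>\<^bsub>C z\<^esub> (on_arr (\<Phi> m (tail z)) (\<alpha> (v, u)) \<cdot>\<^bsub>C z\<^esub> transition w x (A u))"
      by (rule D.comp_assoc[OF t \<Phi>av am])
    finally show ?thesis
      using w x z zc uH v vu tzH by (simp add: extend_maps_def glue_index_def d)
  qed
qed simp

lemma comparison_natural_isomorphism:
  "natural_isomorphism (glued_category W C \<Phi> \<nu> (carrier W)) (glued_category W C \<Phi> \<nu> (carrier W))
     (extension \<circ>\<^sub>F restriction) id_functor comparison" (is "natural_isomorphism ?G ?G _ _ _")
proof -
  have on_obj: "on_obj (extension \<circ>\<^sub>F restriction) (A, \<alpha>) =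
      (extend_family (restrict A H), extend_maps (restrict A H) (restrict \<alpha> (glue_index W H)))" for A \<alpha>
    by (simp add: comp_functor_def extension_def restriction_def)
  have arrow: "comparison (A, \<alpha>) = (on_obj (extension \<circ>\<^sub>F restriction) (A, \<alpha>), (A, \<alpha>), \<lambda>w\<in>carrier W. \<alpha> (rep w, tail w))"
    for A \<alpha> by (simp add: comparison_def)
  have "is_functor ?G ?G (extension \<circ>\<^sub>F restriction)"
    using comp_is_functor[OF restriction_functor extension_functor] .
  moreover have "is_functor ?G ?G id_functor"
    using id_is_functor[OF glued_category_is_category[OF subset_refl]] .
  moreover have "comparison X \<in> homset ?G (on_obj (extension \<circ>\<^sub>F restriction) X) (on_obj id_functor X)"
    and "is_iso ?G (comparison X)" if "X \<in> obj ?G" for X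
  proof -
    obtain A \<alpha> where XA: "X = (A, \<alpha>)" by (cases X)
    then have A: "(A, \<alpha>) \<in> glued_objects W C \<Phi> \<nu> (carrier W)" using that by simp
    show "comparison X \<in> homset ?G (on_obj (extension \<circ>\<^sub>F restriction) X) (on_obj id_functor X)"
      using comparison_arrow[OF A] unfolding XA arrow on_obj by (simp add: homset_glued_iff id_functor_def)
    have "is_iso (C w) ((\<lambda>w\<in>carrier W. \<alpha> (rep w, tail w)) w)" if w: "w \<in> carrier W" for w
      using rep_\<alpha>_iso[OF A w tail_closed[OF w]] rep_tail[OF w] w by simp
    then show "is_iso ?G (comparison X)"
      using glued_iso[OF subset_refl comparison_arrow[OF A]] unfolding XA arrow on_obj by blast
  qed
  moreover have "comparison (tgt ?G h) \<cdot>\<^bsub>?G\<^esub> on_arr (extension \<circ>\<^sub>F restriction) h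
      = on_arr id_functor h \<cdot>\<^bsub>?G\<^esub> comparison (src ?G h)" if h: "h \<in> arr ?G" for h
  proof -
    obtain A \<alpha> B \<beta> f where hf: "h = ((A, \<alpha>), (B, \<beta>), f)" by (metis prod.exhaust)
    then have f: "((A, \<alpha>), (B, \<beta>), f) \<in> glued_arrows W C \<Phi> \<nu> (carrier W)" using h by simp
    have "\<beta> (rep w, tail w) \<cdot>\<^bsub>C w\<^esub> on_arr (\<Phi> (rep w) (tail w)) (f (tail w)) = f w \<cdot>\<^bsub>C w\<^esub> \<alpha> (rep w, tail w)"
      if w: "w \<in> carrier W" for w
      by (rule glued_arrow_comm[OF f rep_closed[OF w] H_closed[OF tail_closed[OF w]] rep_tail[OF w] w])
    then show ?thesis
      using tail_closed unfolding hf
      by (auto simp: comparison_def comp_functor_def id_functor_def extension_def restriction_def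
          extend_components_def fun_eq_iff)
  qed
  ultimately show ?thesis
    unfolding natural_isomorphism_def natural_transformation_def by blast
qed

theorem glued_category_equivalent_to_subgroup:
  "equivalent_categories (glued_category W C \<Phi> \<nu> (carrier W)) (glued_category W C \<Phi> \<nu> H)"
proof -
  let ?G = "glued_category W C \<Phi> \<nu> (carrier W)" and ?K = "glued_category W C \<Phi> \<nu> H"
  interpret K: category ?K by (rule glued_category_is_category[OF H_subset])
  obtain \<eta> where \<eta>: "natural_isomorphism ?G ?G id_functor (extension \<circ>\<^sub>F restriction) \<eta>"
    using natural_isomorphism_inverse[OF comparison_natural_isomorphism] by blast
  have obj_eq: "on_obj (restriction \<circ>\<^sub>F extension) X = X" if "X \<in> obj ?K" for X
    using restrict_extend_object that
    by (cases X) (simp add: comp_functor_def restriction_def extension_def)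
  have arr_eq: "on_arr (restriction \<circ>\<^sub>F extension) h = h" if "h \<in> arr ?K" for h
  proof -
    obtain A \<alpha> B \<beta> f where hf: "h = ((A, \<alpha>), (B, \<beta>), f)" by (metis prod.exhaust)
    then have f: "((A, \<alpha>), (B, \<beta>), f) \<in> glued_arrows W C \<Phi> \<nu> H" using that by simp
    show ?thesis
      using restrict_extend_object[OF glued_arrow_src[OF f]] restrict_extend_object[OF glued_arrow_tgt[OF f]]
        restrict_extend_components[OF f] unfolding hf
      by (simp add: comp_functor_def restriction_def extension_def)
  qed
  have "natural_isomorphism ?K ?K (restriction \<circ>\<^sub>F extension) id_functor (ident ?K)"
    unfolding natural_isomorphism_def natural_transformation_def
  proof (intro conjI ballI)
    show "is_functor ?K ?K (restriction \<circ>\<^sub>F extension)"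
      by (rule comp_is_functor[OF extension_functor restriction_functor])
    show "is_functor ?K ?K id_functor" by (rule id_is_functor[OF K.category_axioms])
    show "ident ?K X \<in> homset ?K (on_obj (restriction \<circ>\<^sub>F extension) X) (on_obj id_functor X)"
      "is_iso ?K (ident ?K X)" if "X \<in> obj ?K" for X
      using K.ident_closed[OF that] K.iso_ident[OF that] obj_eq[OF that] by (simp_all add: id_functor_def)
    show "ident ?K (tgt ?K h) \<cdot>\<^bsub>?K\<^esub> on_arr (restriction \<circ>\<^sub>F extension) h
        = on_arr id_functor h \<cdot>\<^bsub>?K\<^esub> ident ?K (src ?K h)" if "h \<in> arr ?K" for h
      using K.ident_left[OF that] K.ident_right[OF that] arr_eq[OF that] by (simp add: id_functor_def)
  qed
  then show ?thesis
    unfolding equivalent_categories_def using restriction_functor extension_functor \<eta> by blast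
qed

end

section \<open>Transport across simple reflections\<close>

context gluing_data
begin

text \<open>Put \<open>f = \<alpha>\<^sub>s\<^sub>,\<^sub>w\<close> and \<open>g = \<alpha>\<^sub>s\<^sub>,\<^sub>s\<^sub>w\<close>. Associativity for \<open>s s = \<one>\<close> says that \<open>g \<circ> \<Phi>\<^sub>s f\<close> and \<open>f \<circ> \<Phi>\<^sub>s g\<close> are
  components of \<open>\<nu>\<^sub>s\<close>, hence isomorphisms. So \<open>\<Phi>\<^sub>s f\<close> has a left inverse and, applying \<open>\<Phi>\<^sub>s\<close> to the
  second composite, a right inverse. Then \<open>\<Phi>\<^sub>s \<Phi>\<^sub>s f\<close> is an isomorphism, and so is \<open>f\<close>, since the
  invertible \<open>\<nu>\<^sub>s\<close> identifies the two by naturality.\<close>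

lemma generator_map_iso:
  assumes X: "(A, \<alpha>) \<in> glued_objects W C \<Phi> \<nu> (carrier W)" and s: "s \<in> S" and w: "w \<in> carrier W"
    and y: "s \<otimes> w = y"
    and Iw: "natural_isomorphism (C w) (C w) (\<Phi> s (s \<otimes> w) \<circ>\<^sub>F \<Phi> s w) id_functor (\<nu> s s w)"
    and Iy: "natural_isomorphism (C y) (C y) (\<Phi> s (s \<otimes> y) \<circ>\<^sub>F \<Phi> s y) id_functor (\<nu> s s y)"
  shows "is_iso (C y) (\<alpha> (s, w))"
proof -
  have sc: "s \<in> carrier W" and ss: "s \<otimes> s = \<one>" using s generator_involution by auto
  have yc: "y \<in> carrier W" using m_closed[OF sc w] y by simp
  have sy: "s \<otimes> y = w" using m_assoc[OF sc sc w] y ss w by simp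
  interpret Cw: category "C w" by (rule category_at[OF w])
  interpret Cy: category "C y" by (rule category_at[OF yc])
  note Aw = glued_object_obj[OF X w] and Ay = glued_object_obj[OF X yc]
  note f = glued_object_hom[OF X sc w y yc] and g = glued_object_hom[OF X sc yc sy w]
  note \<Phi>f = \<Phi>_hom[OF f sc yc sy] and \<Phi>g = \<Phi>_hom[OF g sc w y]
  note \<Phi>\<Phi>f = \<Phi>_hom[OF \<Phi>f sc w y] and \<Phi>\<Phi>g = \<Phi>_hom[OF \<Phi>g sc yc sy]
  have iso_w: "is_iso (C w) (\<nu> s s w B)" if "B \<in> obj (C w)" for B
    using Iw that by (simp add: natural_isomorphism_def)
  have iso_y: "is_iso (C y) (\<nu> s s y B)" if "B \<in> obj (C y)" for B
    using Iy that by (simp add: natural_isomorphism_def)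
  have Nw: "\<nu> s s w (A w) \<in> homset (C w) (on_obj (\<Phi> s y) (on_obj (\<Phi> s w) (A w))) (A w)"
    using \<nu>_hom[OF Aw sc sc w y sy ss] \<Phi>_one_obj[OF w Aw] by simp
  have Ny: "\<nu> s s y B \<in> homset (C y) (on_obj (\<Phi> s w) (on_obj (\<Phi> s y) B)) B" if "B \<in> obj (C y)" for B
    using \<nu>_hom[OF that sc sc yc sy y ss] \<Phi>_one_obj[OF yc that] by simp
  have gf: "\<alpha> (s, y) \<cdot>\<^bsub>C w\<^esub> on_arr (\<Phi> s y) (\<alpha> (s, w)) = \<nu> s s w (A w)"
    using glued_object_assoc[OF X subset_refl sc sc w y yc sy w ss] glued_object_one[OF X w] Cw.ident_comp[OF Nw]
    by simp
  have fg: "\<alpha> (s, w) \<cdot>\<^bsub>C y\<^esub> on_arr (\<Phi> s w) (\<alpha> (s, y)) = \<nu> s s y (A y)"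
    using glued_object_assoc[OF X subset_refl sc sc yc sy w y yc ss] glued_object_one[OF X yc]
      Cy.ident_comp[OF Ny[OF Ay]] by simp
  have "is_iso (C w) (on_arr (\<Phi> s y) (\<alpha> (s, w)))"
  proof (rule Cw.iso_if_comp_iso_both_sides[OF \<Phi>f g \<Phi>\<Phi>g])
    show "is_iso (C w) (\<alpha> (s, y) \<cdot>\<^bsub>C w\<^esub> on_arr (\<Phi> s y) (\<alpha> (s, w)))" using gf iso_w[OF Aw] by simp
    show "is_iso (C w) (on_arr (\<Phi> s y) (\<alpha> (s, w)) \<cdot>\<^bsub>C w\<^esub> on_arr (\<Phi> s y) (on_arr (\<Phi> s w) (\<alpha> (s, y))))"
      using \<Phi>_comp[OF \<Phi>g f sc yc sy] \<Phi>_iso[OF iso_y[OF Ay] sc yc sy] fg by simp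
  qed
  then have "is_iso (C y) (on_arr (\<Phi> s w) (on_arr (\<Phi> s y) (\<alpha> (s, w))))" by (rule \<Phi>_iso[OF _ sc w y])
  then have "is_iso (C y) (\<nu> s s y (A y) \<cdot>\<^bsub>C y\<^esub> on_arr (\<Phi> s w) (on_arr (\<Phi> s y) (\<alpha> (s, w))))"
    by (rule Cy.iso_comp[OF _ \<Phi>\<Phi>f iso_y[OF Ay] Ny[OF Ay]])
  moreover have "\<nu> s s y (A y) \<cdot>\<^bsub>C y\<^esub> on_arr (\<Phi> s w) (on_arr (\<Phi> s y) (\<alpha> (s, w)))
      = \<alpha> (s, w) \<cdot>\<^bsub>C y\<^esub> \<nu> s s y (on_obj (\<Phi> s w) (A w))"
    using \<nu>_naturality[OF f sc sc yc sy y ss] \<Phi>_one_arr[OF yc, of "\<alpha> (s, w)"] f by (simp add: homset_def)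
  moreover have sA: "on_obj (\<Phi> s w) (A w) \<in> obj (C y)" by (rule \<Phi>_obj[OF Aw sc w y])
  ultimately show ?thesis
    using Cy.iso_left_factor[OF iso_y[OF sA] Ny[OF sA] f] by simp
qed

text \<open>Induction on the length of \<open>n = s n'\<close>: associativity expresses \<open>\<alpha>\<close> at \<open>(n, v)\<close>, up to the isomorphism
  \<open>\<nu>\<close> at \<open>(s, n')\<close>, as the composite of the gluing map of the generator \<open>s\<close>, which crosses between two
  cosets, with \<open>\<Phi>\<^sub>s\<close> of the map at \<open>(n', v)\<close>.\<close>

lemma minimal_map_iso:
  assumes J: "J \<subseteq> S"
    and inv: "\<And>s w. \<lbrakk>s \<in> S; w \<in> carrier W; inv w \<otimes> s \<otimes> w \<notin> generate W J\<rbrakk>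
      \<Longrightarrow> natural_isomorphism (C w) (C w) (\<Phi> s (s \<otimes> w) \<circ>\<^sub>F \<Phi> s w) id_functor (\<nu> s s w)"
    and X: "(A, \<alpha>) \<in> glued_objects W C \<Phi> \<nu> (carrier W)"
    and "minimal_in_coset J n" and v: "v \<in> generate W J"
  shows "is_iso (C (n \<otimes> v)) (\<alpha> (n, v))"
  using assms(4)
proof (induction "len n" arbitrary: n rule: less_induct)
  case less
  have vc: "v \<in> carrier W" using generate_in_carrier[of J v] J S_subset v by blast
  show ?case
  proof (cases "n = \<one>")
    case True
    then show ?thesis
      using glued_object_one[OF X vc] category.iso_ident[OF category_at[OF vc] glued_object_obj[OF X vc]] vc by simp
  next
    case False
    obtain s n' where s: "s \<in> S" and n: "n = s \<otimes> n'" and min: "minimal_in_coset J n'"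
      and len: "len n = len s + len n'" and lt: "len n' < len n"
      and cross: "\<And>u. u \<in> generate W J \<Longrightarrow> inv (n' \<otimes> u) \<otimes> s \<otimes> (n' \<otimes> u) \<notin> generate W J"
      using minimal_in_coset_descend[OF J less.prems False] by blast
    have sc: "s \<in> carrier W" and n': "n' \<in> carrier W" using s min by (auto simp: minimal_in_coset_def)
    define y z where yz: "y = n' \<otimes> v" "z = s \<otimes> y"
    have y: "y \<in> carrier W" and z: "z \<in> carrier W" using yz sc n' vc by auto
    have nv: "n \<otimes> v = z" using n yz sc n' vc by (simp add: m_assoc)
    interpret D: category "C z" by (rule category_at[OF z])
    have IH: "is_iso (C y) (\<alpha> (n', v))" using less.hyps[OF lt min] yz by simp
    have y_cross: "inv y \<otimes> s \<otimes> y \<notin> generate W J" using cross[OF v] yz by simp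
    have "inv z \<otimes> s \<otimes> z = inv y \<otimes> (inv s \<otimes> s \<otimes> s) \<otimes> y"
      unfolding yz(2) using sc y by (simp add: inv_mult_group m_assoc)
    then have z_cross: "inv z \<otimes> s \<otimes> z \<notin> generate W J" using y_cross sc by simp
    have iso_s: "is_iso (C z) (\<alpha> (s, y))"
      by (rule generator_map_iso[OF X s y yz(2)[symmetric] inv[OF s y y_cross] inv[OF s z z_cross]])
    have Av: "A v \<in> obj (C v)" by (rule glued_object_obj[OF X vc])
    note a = glued_object_hom[OF X n' vc yz(1)[symmetric] y]
      and b = glued_object_hom[OF X sc y yz(2)[symmetric] z]
      and c = glued_object_hom[OF X m_closed[OF sc n'] vc nv[unfolded n] z]
    have "is_iso (C z) (\<alpha> (s, y) \<cdot>\<^bsub>C z\<^esub> on_arr (\<Phi> s y) (\<alpha> (n', v)))"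
      by (rule D.iso_comp[OF \<Phi>_iso[OF IH sc y yz(2)[symmetric]] \<Phi>_hom[OF a sc y yz(2)[symmetric]] iso_s b])
    moreover have "\<alpha> (s, y) \<cdot>\<^bsub>C z\<^esub> on_arr (\<Phi> s y) (\<alpha> (n', v)) = \<alpha> (s \<otimes> n', v) \<cdot>\<^bsub>C z\<^esub> \<nu> s n' v (A v)"
      by (rule glued_object_assoc[OF X subset_refl sc n' vc yz(1)[symmetric] y yz(2)[symmetric] z HOL.refl])
    moreover have "is_iso (C z) (\<nu> s n' v (A v))"
      using \<nu>_iso[OF sc n' vc] len n Av nv by (simp add: natural_isomorphism_def)
    ultimately have "is_iso (C z) (\<alpha> (s \<otimes> n', v))"
      using D.iso_left_factor[OF _ \<nu>_hom[OF Av sc n' vc yz(1)[symmetric] yz(2)[symmetric] HOL.refl] c] by simp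
    then show ?thesis using nv n by simp
  qed
qed

end


theorem theorem10p5p1:
  fixes W :: "('w, 'b) monoid_scheme" (structure)
    and S J :: "'w set"
    and C :: "'w \<Rightarrow> ('o, 'm, 'x) preadditive_data_scheme"
    and \<Phi> :: "'w \<Rightarrow> 'w \<Rightarrow> ('o, 'm, 'o, 'm) functor_data"
    and \<nu> :: "'w \<Rightarrow> 'w \<Rightarrow> 'w \<Rightarrow> 'o \<Rightarrow> 'm"
  assumes "coxeter_system W S"
    and "finite (carrier W)"
    and "gluing_data W S C \<Phi> \<nu>"
    and "J \<subseteq> S"
    and "\<And>s w. \<lbrakk>s \<in> S; w \<in> carrier W; inv w \<otimes> s \<otimes> w \<notin> generate W J\<rbrakk>
      \<Longrightarrow> natural_isomorphism (C w) (C w) (\<Phi> s (s \<otimes> w) \<circ>\<^sub>F \<Phi> s w) id_functor (\<nu> s s w)"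
  shows "equivalent_categories
    (glued_category W C \<Phi> \<nu> (carrier W)) (glued_category W C \<Phi> \<nu> (generate W J))"
proof -
  interpret gluing_data W S C \<Phi> \<nu> by (rule assms(3))
  note J = assms(4)
  note sub = parabolic_subgroup[OF J]
  interpret gluing_transversal W S C \<Phi> \<nu> "generate W J" "coset_rep J"
  proof (intro gluing_transversal.intro gluing_transversal_axioms.intro)
    show "gluing_data W S C \<Phi> \<nu>" by (rule assms(3))
    show "subgroup (generate W J) W" by (rule sub)
    show rc: "coset_rep J w \<in> carrier W" if "w \<in> carrier W" for w
      using minimal_coset_rep[OF J that] by (simp add: minimal_in_coset_def)
    show "inv (coset_rep J w) \<otimes> w \<in> generate W J" if w: "w \<in> carrier W" for w
    proof -
      obtain u where u: "u \<in> generate W J" "u \<in> carrier W" "coset_rep J w = w \<otimes> u"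
        using coset_repE[OF J w] .
      then have "inv (coset_rep J w) \<otimes> w = inv u" using w by (simp add: inv_mult_group m_assoc)
      then show ?thesis using subgroup.m_inv_closed[OF sub u(1)] by simp
    qed
    show "coset_rep J (w \<otimes> u) = coset_rep J w" if "w \<in> carrier W" "u \<in> generate W J" for w u
      by (rule coset_rep_mult[OF J that])
    show "coset_rep J \<one> = \<one>" by (rule coset_rep_one[OF J])
    show "is_iso (C (coset_rep J w \<otimes> (u \<otimes> v))) (\<nu> (coset_rep J w) u v A)"
      if w: "w \<in> carrier W" and u: "u \<in> generate W J" and v: "v \<in> generate W J" and A: "A \<in> obj (C v)" for w u v A
    proof -
      have c: "u \<in> carrier W" "v \<in> carrier W" using u v subgroup.mem_carrier[OF sub] by auto
      have "natural_isomorphism (C v) (C (coset_rep J w \<otimes> u \<otimes> v))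
          (\<Phi> (coset_rep J w) (u \<otimes> v) \<circ>\<^sub>F \<Phi> u v) (\<Phi> (coset_rep J w \<otimes> u) v) (\<nu> (coset_rep J w) u v)"
        by (rule \<nu>_iso[OF rc[OF w] c len_mult_minimal[OF J minimal_coset_rep[OF J w] u]])
      then show ?thesis using A m_assoc[OF rc[OF w] c] by (simp add: natural_isomorphism_def)
    qed
    show "is_iso (C (coset_rep J w \<otimes> v)) (\<alpha> (coset_rep J w, v))"
      if "(B, \<alpha>) \<in> glued_objects W C \<Phi> \<nu> (carrier W)" "w \<in> carrier W" "v \<in> generate W J" for B \<alpha> w v
      by (rule minimal_map_iso[OF J assms(5) that(1) minimal_coset_rep[OF J that(2)] that(3)])
  qed
  show ?thesis by (rule glued_category_equivalent_to_subgroup)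
qed

end
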